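(* Let $(R,m,k)$ be a complete regular local ring with algebraically closed residue field $k$. Suppose that for every $r\ge 1$, every choice of monic polynomials $f_i(y_i)=y_i^{n_i}+a_{i,1}y_i^{n_i-1}+\cdots+a_{i,n_i}\in R[y_i]$ ($i=1,\dots,r$, $n_i\ge 1$) with all $a_{i,j}\in m$, and every ideal $J$ of height zero in $$T=R[y_1,\dots,y_r]/(f_1(y_1),\dots,f_r(y_r))$$ such that the natural map $R\to T/J$ is injective, the ring $R$ is a direct summand of $T/J$ as an $R$-module. Then for every module-finite ring extension $R\hookrightarrow S$, $R$ is a direct summand of $S$ as an $R$-module (i.e. there is an $R$-linear map $\rho:S\to R$ with $\rho(1)=1$).
   Context: All rings are commutative Noetherian with identity. *)

theory Defs
  imports "HOL-Algebra.Algebra" "HOL-Library.Extended_Nat"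
begin

definition local_ring :: "('a, 'b) ring_scheme \<Rightarrow> bool" where
  "local_ring R \<longleftrightarrow> cring R \<and> (\<exists>!M. maximalideal M R)"

definition max_ideal :: "('a, 'b) ring_scheme \<Rightarrow> 'a set" where
  "max_ideal R = (THE M. maximalideal M R)"

definition prime_chain :: "('a, 'b) ring_scheme \<Rightarrow> 'a set list \<Rightarrow> bool" where
  "prime_chain R ps \<longleftrightarrow> ps \<noteq> [] \<and> (\<forall>P \<in> set ps. primeideal P R) \<and> sorted_wrt (\<subset>) ps"

definition krull_dim :: "('a, 'b) ring_scheme \<Rightarrow> enat" where
  "krull_dim R = Sup {enat (length ps - 1) | ps. prime_chain R ps}"

definition prime_height :: "('a, 'b) ring_scheme \<Rightarrow> 'a set \<Rightarrow> enat" where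
  "prime_height R P = Sup {enat (length ps - 1) | ps. prime_chain R ps \<and> last ps = P}"

text \<open>Height of an ideal: infimum of the heights of the primes containing it
  (the unit ideal has height \<open>\<infinity>\<close>).\<close>
definition ideal_height :: "('a, 'b) ring_scheme \<Rightarrow> 'a set \<Rightarrow> enat" where
  "ideal_height R J = Inf {prime_height R P | P. primeideal P R \<and> J \<subseteq> P}"

definition emb_dim :: "('a, 'b) ring_scheme \<Rightarrow> nat" where
  "emb_dim R = (LEAST n. \<exists>G. finite G \<and> card G = n \<and> G \<subseteq> carrier R \<and> Idl\<^bsub>R\<^esub> G = max_ideal R)"

definition regular_local_ring :: "('a, 'b) ring_scheme \<Rightarrow> bool" where
  "regular_local_ring R \<longleftrightarrow> local_ring R \<and> noetherian_ring R \<and> krull_dim R = enat (emb_dim R)"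

primrec ideal_pow :: "('a, 'b) ring_scheme \<Rightarrow> 'a set \<Rightarrow> nat \<Rightarrow> 'a set" where
  "ideal_pow R I 0 = carrier R"
| "ideal_pow R I (Suc k) = ideal_prod R I (ideal_pow R I k)"

definition madic_complete :: "('a, 'b) ring_scheme \<Rightarrow> bool" where
  "madic_complete R \<longleftrightarrow>
     (\<Inter>k. ideal_pow R (max_ideal R) k) = {\<zero>\<^bsub>R\<^esub>} \<and>
     (\<forall>x::nat \<Rightarrow> 'a. (\<forall>n. x n \<in> carrier R) \<and>
          (\<forall>k. \<exists>N. \<forall>p\<ge>N. \<forall>q\<ge>N. x p \<ominus>\<^bsub>R\<^esub> x q \<in> ideal_pow R (max_ideal R) k)
        \<longrightarrow> (\<exists>l\<in>carrier R. \<forall>k. \<exists>N. \<forall>n\<ge>N. x n \<ominus>\<^bsub>R\<^esub> l \<in> ideal_pow R (max_ideal R) k))"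

text \<open>Monomials in the variables y_0,...,y_(r-1) are exponent functions vanishing from r on;
  a polynomial is a finitely supported coefficient function on monomials.\<close>
definition monomials :: "nat \<Rightarrow> (nat \<Rightarrow> nat) set" where
  "monomials r = {m. \<forall>i\<ge>r. m i = 0}"

definition mpoly_ring :: "('a, 'b) ring_scheme \<Rightarrow> nat \<Rightarrow> ((nat \<Rightarrow> nat) \<Rightarrow> 'a) ring" where
  "mpoly_ring R r =
    \<lparr>carrier = {p. (\<forall>m. p m \<in> carrier R) \<and> (\<forall>m. m \<notin> monomials r \<longrightarrow> p m = \<zero>\<^bsub>R\<^esub>)
                   \<and> finite {m. p m \<noteq> \<zero>\<^bsub>R\<^esub>}},
     monoid.mult = (\<lambda>p q m. if m \<in> monomials r
                     then (\<Oplus>\<^bsub>R\<^esub> a \<in> {a. a \<le> m}. p a \<otimes>\<^bsub>R\<^esub> q (\<lambda>i. m i - a i))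
                     else \<zero>\<^bsub>R\<^esub>),
     monoid.one = (\<lambda>m. if m = (\<lambda>i. 0) then \<one>\<^bsub>R\<^esub> else \<zero>\<^bsub>R\<^esub>),
     ring.zero = (\<lambda>m. \<zero>\<^bsub>R\<^esub>),
     ring.add = (\<lambda>p q m. p m \<oplus>\<^bsub>R\<^esub> q m)\<rparr>"

definition mp_const :: "('a, 'b) ring_scheme \<Rightarrow> 'a \<Rightarrow> ((nat \<Rightarrow> nat) \<Rightarrow> 'a)" where
  "mp_const R c = (\<lambda>m. if m = (\<lambda>i. 0) then c else \<zero>\<^bsub>R\<^esub>)"

definition mp_var :: "('a, 'b) ring_scheme \<Rightarrow> nat \<Rightarrow> ((nat \<Rightarrow> nat) \<Rightarrow> 'a)" where
  "mp_var R i = (\<lambda>m. if m = (\<lambda>j. if j = i then 1 else 0) then \<one>\<^bsub>R\<^esub> else \<zero>\<^bsub>R\<^esub>)"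

definition monic_in_var ::
  "('a, 'b) ring_scheme \<Rightarrow> nat \<Rightarrow> nat \<Rightarrow> nat \<Rightarrow> (nat \<Rightarrow> 'a) \<Rightarrow> ((nat \<Rightarrow> nat) \<Rightarrow> 'a)" where
  "monic_in_var R r i n a =
     (let P = mpoly_ring R r in
      (mp_var R i [^]\<^bsub>P\<^esub> n) \<oplus>\<^bsub>P\<^esub>
      (\<Oplus>\<^bsub>P\<^esub> j \<in> {1..n}. mp_const R (a j) \<otimes>\<^bsub>P\<^esub> (mp_var R i [^]\<^bsub>P\<^esub> (n - j))))"

definition T_ring ::
  "('a, 'b) ring_scheme \<Rightarrow> nat \<Rightarrow> (nat \<Rightarrow> nat) \<Rightarrow> (nat \<Rightarrow> nat \<Rightarrow> 'a)
     \<Rightarrow> ((nat \<Rightarrow> nat) \<Rightarrow> 'a) set ring" where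
  "T_ring R r n a =
     mpoly_ring R r Quot (Idl\<^bsub>mpoly_ring R r\<^esub> {monic_in_var R r i (n i) (a i) | i. i < r})"

definition T_quot_map ::
  "('a, 'b) ring_scheme \<Rightarrow> nat \<Rightarrow> (nat \<Rightarrow> nat) \<Rightarrow> (nat \<Rightarrow> nat \<Rightarrow> 'a)
     \<Rightarrow> ((nat \<Rightarrow> nat) \<Rightarrow> 'a) set set \<Rightarrow> 'a \<Rightarrow> ((nat \<Rightarrow> nat) \<Rightarrow> 'a) set set" where
  "T_quot_map R r n a J x =
     J +>\<^bsub>T_ring R r n a\<^esub>
       (Idl\<^bsub>mpoly_ring R r\<^esub> {monic_in_var R r i (n i) (a i) | i. i < r} +>\<^bsub>mpoly_ring R r\<^esub> mp_const R x)"

definition direct_summand_via ::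
  "('a, 'b) ring_scheme \<Rightarrow> ('c, 'd) ring_scheme \<Rightarrow> ('a \<Rightarrow> 'c) \<Rightarrow> bool" where
  "direct_summand_via R S \<iota> \<longleftrightarrow>
     (\<exists>\<rho>. (\<forall>s\<in>carrier S. \<rho> s \<in> carrier R)
        \<and> (\<forall>s\<in>carrier S. \<forall>t\<in>carrier S. \<rho> (s \<oplus>\<^bsub>S\<^esub> t) = \<rho> s \<oplus>\<^bsub>R\<^esub> \<rho> t)
        \<and> (\<forall>x\<in>carrier R. \<forall>s\<in>carrier S. \<rho> (\<iota> x \<otimes>\<^bsub>S\<^esub> s) = x \<otimes>\<^bsub>R\<^esub> \<rho> s)
        \<and> \<rho> \<one>\<^bsub>S\<^esub> = \<one>\<^bsub>R\<^esub>)"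

definition module_finite_via ::
  "('a, 'b) ring_scheme \<Rightarrow> ('c, 'd) ring_scheme \<Rightarrow> ('a \<Rightarrow> 'c) \<Rightarrow> bool" where
  "module_finite_via R S \<iota> \<longleftrightarrow>
     (\<exists>G. finite G \<and> G \<subseteq> carrier S \<and>
        (\<forall>s\<in>carrier S. \<exists>c. (\<forall>g\<in>G. c g \<in> carrier R) \<and> s = (\<Oplus>\<^bsub>S\<^esub> g\<in>G. \<iota> (c g) \<otimes>\<^bsub>S\<^esub> g)))"

end

theory Submission
  imports Defs
begin

text \<open>
  A regular local ring is a domain, so \<open>S\<close> has a prime \<open>Q\<close> lying over zero, and it suffices to
  retract the domain \<open>D = S/Q\<close> onto \<open>R\<close>. Let \<open>s \<in> D\<close> satisfy a monic equation over \<open>R\<close>. Modulo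
  the maximal ideal the equation splits into linear factors, and factors with distinct roots are
  comaximal in \<open>R[s]\<close>. Idempotents lift because \<open>R\<close> is complete, and \<open>D\<close> has no nontrivial
  idempotents, so only one root \<open>c\<close> survives: \<open>s - c\<close> satisfies a monic equation whose lower
  coefficients lie in the maximal ideal. Shifting the generators of \<open>D\<close> in this way presents \<open>D\<close>
  as \<open>T/J\<close>. Here \<open>J\<close> is a prime of \<open>T\<close> contracting to zero in \<open>R\<close>, hence a minimal prime by
  incomparability, so the hypothesis applies.

  That a regular local ring is a domain follows from Krull's principal ideal theorem: if the
  maximal ideal is generated by \<open>d\<close> elements and \<open>P\<^sub>0 \<subset> \<dots> \<subset> P\<^sub>d\<close> is a chain of primes, choose a
  generator \<open>x \<notin> P\<^sub>0\<close> and a chain \<open>P\<^sub>0 \<subset> P\<^sub>1' \<subset> \<dots> \<subset> P\<^sub>d'\<close> with \<open>x \<in> P\<^sub>1'\<close>; by induction \<open>P\<^sub>1' = (x)\<close>,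
  so \<open>P\<^sub>0 = x P\<^sub>0\<close> and \<open>P\<^sub>0 = 0\<close> by Nakayama's lemma.
\<close>

section \<open>Primes and saturation in commutative rings\<close>

text \<open>Localisations, quotients and completions would each change the ring and its type. In the
  dimension theory an ideal of the localisation at P is represented by its contraction to R, a
  P-saturated ideal (\<open>psat\<close>), and a quotient by an ideal is replaced by a relative
  statement about the ideals above it. Submodules of an extension are spans of lists with
  coefficients in an ideal (\<open>fspan\<close>), so the m-adic filtration of R[s] is one span with
  coefficients in the powers of m. Limits in R[s] are then taken coefficient by coefficient. The
  obstacle is that this filtration must be separated: the spanning powers of s may be dependent, so
  coefficients cannot be compared, and a denominator has to be cleared first to reach independent
  powers. The splitting into linear factors is a congruence modulo m R[s] between values at s,
  obtained by finding one root at a time, and not a factorisation of polynomials.\<close>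

context cring
begin

lemma ideal_minus:
  assumes "ideal I R" "a \<in> I" "b \<in> I"
  shows "a \<ominus> b \<in> I"
  using assms additive_subgroup.a_closed additive_subgroup.a_inv_closed ideal.axioms(1)
  unfolding a_minus_def by metis

lemmas ideal_closed =
  ideal.Icarr additive_subgroup.zero_closed[OF ideal.axioms(1)]
  additive_subgroup.a_closed[OF ideal.axioms(1)]
  additive_subgroup.a_inv_closed[OF ideal.axioms(1)]
  ideal.I_l_closed ideal.I_r_closed ideal_minus

lemma ideal_subset_carrier: "ideal I R \<Longrightarrow> I \<subseteq> carrier R"
  by (rule subsetI) (rule ideal.Icarr)

lemma ideal_of_closed:
  assumes "I \<subseteq> carrier R" "\<zero> \<in> I" "\<And>a b. a \<in> I \<Longrightarrow> b \<in> I \<Longrightarrow> a \<oplus> b \<in> I"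
    and "\<And>r a. r \<in> carrier R \<Longrightarrow> a \<in> I \<Longrightarrow> r \<otimes> a \<in> I"
  shows "ideal I R"
proof (rule idealI[OF ring_axioms])
  have inv: "\<ominus> a \<in> I" if "a \<in> I" for a
  proof -
    have "\<ominus> a = (\<ominus> \<one>) \<otimes> a" using that assms(1) by (simp add: l_minus subset_iff)
    then show ?thesis using assms(4)[OF _ that, of "\<ominus> \<one>"] by simp
  qed
  show "subgroup I (add_monoid R)"
    by (rule add.subgroupI) (use assms inv in \<open>auto simp flip: a_inv_def\<close>)
  show "x \<otimes> a \<in> I" if "a \<in> I" "x \<in> carrier R" for a x using assms(4) that by auto
  show "a \<otimes> x \<in> I" if "a \<in> I" "x \<in> carrier R" for a x
    using assms(4)[of x a] assms(1) m_comm[of a x] that by auto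
qed

lemma ideal_cancel_add:
  assumes "ideal I R" "a \<oplus> b \<in> I" "a \<in> I" "b \<in> carrier R"
  shows "b \<in> I"
proof -
  have "a \<in> carrier R" using assms ideal.Icarr by fast
  then have "b = (a \<oplus> b) \<ominus> a" using assms(4) by algebra
  then show ?thesis using assms ideal_minus by metis
qed

lemma primeideal_one_notin: "primeideal P R \<Longrightarrow> \<one> \<notin> P"
  using ideal.one_imp_carrier primeideal.I_notcarr primeideal.axioms(1) by metis

lemma primeideal_pow:
  assumes "primeideal P R" "a \<in> carrier R" "a [^] (n::nat) \<in> P"
  shows "a \<in> P"
  using assms(3)
proof (induction n)
  case 0
  then show ?case using primeideal_one_notin[OF assms(1)] by simp
next
  case (Suc n)
  then show ?case using primeideal.I_prime[OF assms(1), of "a [^] n" a] assms(2) by auto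
qed

definition adjoin_ideal :: "'a set \<Rightarrow> 'a \<Rightarrow> 'a set" where
  "adjoin_ideal I x = {i \<oplus> r \<otimes> x | i r. i \<in> I \<and> r \<in> carrier R}"

lemma adjoin_idealE:
  assumes "a \<in> adjoin_ideal I x"
  obtains i r where "i \<in> I" "r \<in> carrier R" "a = i \<oplus> r \<otimes> x"
  using assms unfolding adjoin_ideal_def by blast

lemma adjoin_ideal:
  assumes I: "ideal I R" and x: "x \<in> carrier R"
  shows adjoin_ideal_ideal: "ideal (adjoin_ideal I x) R"
    and subset_adjoin_ideal: "I \<subseteq> adjoin_ideal I x"
    and mem_adjoin_ideal: "x \<in> adjoin_ideal I x"
proof -
  have eq: "adjoin_ideal I x = I <+> PIdl x"
    unfolding adjoin_ideal_def set_add_def' cgenideal_def by blast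
  show "ideal (adjoin_ideal I x) R"
    unfolding eq using add_ideals[OF I cgenideal_ideal[OF x]] .
  show "I \<subseteq> adjoin_ideal I x"
  proof
    fix i assume i: "i \<in> I"
    then have "i = i \<oplus> \<zero> \<otimes> x" using x ideal.Icarr[OF I] by simp
    then show "i \<in> adjoin_ideal I x" unfolding adjoin_ideal_def using i zero_closed by blast
  qed
  have "x = \<zero> \<oplus> \<one> \<otimes> x" using x by simp
  then show "x \<in> adjoin_ideal I x"
    unfolding adjoin_ideal_def using ideal_closed(2)[OF I] one_closed by blast
qed

lemma adjoin_ideal_minimal:
  assumes "ideal K R" "I \<subseteq> K" "x \<in> K"
  shows "adjoin_ideal I x \<subseteq> K"
  using assms ideal_closed(3,5)[OF assms(1)] unfolding adjoin_ideal_def by blast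

text \<open>An ideal M maximal among those containing I and avoiding the multiplicative set U is
  prime: if a and b lie outside M, then M + (a) and M + (b) both meet U, and the product of two such
  members lies in M as soon as ab does. This later yields the prime of S over zero.\<close>

lemma exists_primeideal_disjoint:
  assumes I: "ideal I R" and U: "U \<subseteq> carrier R" "\<one> \<in> U"
    and mult: "\<And>x y. x \<in> U \<Longrightarrow> y \<in> U \<Longrightarrow> x \<otimes> y \<in> U"
    and disj: "I \<inter> U = {}"
  shows "\<exists>P. primeideal P R \<and> I \<subseteq> P \<and> P \<inter> U = {}"
proof -
  define F where "F = {K. ideal K R \<and> I \<subseteq> K \<and> K \<inter> U = {}}"
  have "\<exists>M\<in>F. \<forall>K\<in>F. M \<subseteq> K \<longrightarrow> K = M"
  proof (rule subset_Zorn_nonempty)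
    show "F \<noteq> {}" using I disj unfolding F_def by blast
    fix C assume C: "C \<noteq> {}" "subset.chain F C"
    have "subset.chain {I. ideal I R} C"
      using C(2) unfolding F_def pred_on.chain_def by blast
    then have "ideal (\<Union>C) R" using chain_Union_is_ideal[of C] C(1) by simp
    then show "\<Union>C \<in> F" using C unfolding F_def pred_on.chain_def by blast
  qed
  then obtain M where MF: "M \<in> F" "\<forall>K\<in>F. M \<subseteq> K \<longrightarrow> K = M" by (elim bexE)
  then have M: "ideal M R" "I \<subseteq> M" "M \<inter> U = {}" unfolding F_def by simp_all
  have max: "K = M" if "ideal K R" "I \<subseteq> K" "K \<inter> U = {}" "M \<subseteq> K" for K
    using MF(2) that unfolding F_def by simp
  have meet: "\<exists>m r. m \<in> M \<and> r \<in> carrier R \<and> m \<oplus> r \<otimes> a \<in> U" if a: "a \<in> carrier R" "a \<notin> M" for a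
  proof (rule ccontr)
    assume "\<not> ?thesis"
    then have "adjoin_ideal M a \<inter> U = {}" unfolding adjoin_ideal_def by blast
    then have "adjoin_ideal M a = M"
      by (intro max adjoin_ideal(1,2)[OF M(1) a(1)] subset_trans[OF M(2) adjoin_ideal(2)[OF M(1) a(1)]])
    then show False using adjoin_ideal(3)[OF M(1) a(1)] a(2) by blast
  qed
  have "primeideal M R"
  proof (rule primeidealI[OF M(1) is_cring])
    show "carrier R \<noteq> M" using M(3) U by blast
    fix a b assume ab: "a \<in> carrier R" "b \<in> carrier R" "a \<otimes> b \<in> M"
    show "a \<in> M \<or> b \<in> M"
    proof (rule ccontr)
      assume "\<not> (a \<in> M \<or> b \<in> M)"
      then obtain m r m' r' where m: "m \<in> M" "r \<in> carrier R" "m \<oplus> r \<otimes> a \<in> U"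
        and m': "m' \<in> M" "r' \<in> carrier R" "m' \<oplus> r' \<otimes> b \<in> U"
        using meet ab by metis
      have c: "m \<in> carrier R" "m' \<in> carrier R" using m m' M(1) ideal.Icarr by fast+
      have "(m \<oplus> r \<otimes> a) \<otimes> (m' \<oplus> r' \<otimes> b) = (m' \<oplus> r' \<otimes> b) \<otimes> m \<oplus> ((r \<otimes> a) \<otimes> m' \<oplus> (r \<otimes> r') \<otimes> (a \<otimes> b))"
        using c m(2) m'(2) ab by algebra
      also have "\<dots> \<in> M"
        using m m' ab c by (simp add: ideal_closed(3,5)[OF M(1)])
      finally show False using mult[OF m(3) m'(3)] M(3) by blast
    qed
  qed
  then show ?thesis using M by blast
qed

text \<open>For an ideal K this is the contraction to R of the extension of K to the localisation at
  P. The ideals equal to their own saturation thus stand for the ideals of that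
  localisation.\<close>

definition psat :: "'a set \<Rightarrow> 'a set \<Rightarrow> 'a set" where
  "psat P K = {a \<in> carrier R. \<exists>u \<in> carrier R - P. u \<otimes> a \<in> K}"

lemma psatI: "a \<in> carrier R \<Longrightarrow> u \<in> carrier R \<Longrightarrow> u \<notin> P \<Longrightarrow> u \<otimes> a \<in> K \<Longrightarrow> a \<in> psat P K"
  unfolding psat_def by blast

lemma psatE:
  assumes "a \<in> psat P K"
  obtains u where "a \<in> carrier R" "u \<in> carrier R" "u \<notin> P" "u \<otimes> a \<in> K"
  using assms unfolding psat_def by blast

lemma psat_mono: "K \<subseteq> L \<Longrightarrow> psat P K \<subseteq> psat P L"
  unfolding psat_def by blast

lemma psat_antimono: "Q \<subseteq> P \<Longrightarrow> psat P K \<subseteq> psat Q K"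
  unfolding psat_def by blast

lemma subset_psat:
  assumes "primeideal P R" "K \<subseteq> carrier R"
  shows "K \<subseteq> psat P K"
proof
  fix a assume a: "a \<in> K"
  show "a \<in> psat P K"
    by (rule psatI[of a \<one>]) (use a assms primeideal_one_notin in auto)
qed

lemma psat_ideal:
  assumes P: "primeideal P R" and K: "ideal K R"
  shows "ideal (psat P K) R"
proof (rule ideal_of_closed)
  show "psat P K \<subseteq> carrier R" unfolding psat_def by blast
  show "\<zero> \<in> psat P K"
    using subset_psat[OF P ideal_subset_carrier[OF K]] ideal_closed(2)[OF K] by blast
next
  fix a b assume "a \<in> psat P K" "b \<in> psat P K"
  then obtain u v where u: "a \<in> carrier R" "u \<in> carrier R" "u \<notin> P" "u \<otimes> a \<in> K"
    and v: "b \<in> carrier R" "v \<in> carrier R" "v \<notin> P" "v \<otimes> b \<in> K"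
    by (metis psatE)
  have "(u \<otimes> v) \<otimes> (a \<oplus> b) = v \<otimes> (u \<otimes> a) \<oplus> u \<otimes> (v \<otimes> b)" using u v by algebra
  also have "\<dots> \<in> K" using u v by (simp add: ideal_closed(3,5)[OF K])
  finally show "a \<oplus> b \<in> psat P K"
    using primeideal.I_prime[OF P] u v by (intro psatI[of _ "u \<otimes> v"]) auto
next
  fix r a assume r: "r \<in> carrier R" and "a \<in> psat P K"
  then obtain u where u: "a \<in> carrier R" "u \<in> carrier R" "u \<notin> P" "u \<otimes> a \<in> K" by (metis psatE)
  have "u \<otimes> (r \<otimes> a) = r \<otimes> (u \<otimes> a)" using u r by algebra
  then show "r \<otimes> a \<in> psat P K"
    using u r ideal_closed(5)[OF K] by (intro psatI[of _ u]) auto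
qed

lemma psat_psat:
  assumes P: "primeideal P R"
  shows "psat P (psat P K) \<subseteq> psat P K"
proof
  fix a assume "a \<in> psat P (psat P K)"
  then obtain u v where u: "a \<in> carrier R" "u \<in> carrier R" "u \<notin> P"
    and v: "v \<in> carrier R" "v \<notin> P" "v \<otimes> (u \<otimes> a) \<in> K"
    by (metis psatE)
  then have "(v \<otimes> u) \<otimes> a \<in> K" by (simp add: m_assoc)
  then show "a \<in> psat P K"
    using u v primeideal.I_prime[OF P] by (intro psatI[of _ "v \<otimes> u"]) auto
qed

lemma psat_primeideal:
  assumes "primeideal p R" "p \<subseteq> q"
  shows "psat q p \<subseteq> p"
  using primeideal.I_prime[OF assms(1)] assms(2) unfolding psat_def by blast

end

section \<open>Noetherian rings: chain conditions and Nakayama's lemma for saturated ideals\<close>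

locale noetherian_cring = cring R + noetherian_ring R for R (structure)
begin

text \<open>The union of a nonempty chain of ideals is itself a member of the chain, so Zorn's lemma
  applies to an arbitrary nonempty family.\<close>

lemma exists_maximal_ideal_in:
  assumes "F \<noteq> {}" "\<And>K. K \<in> F \<Longrightarrow> ideal K R"
  shows "\<exists>M\<in>F. \<forall>K\<in>F. M \<subseteq> K \<longrightarrow> K = M"
proof (rule subset_Zorn_nonempty[OF assms(1)])
  fix C assume C: "C \<noteq> {}" "subset.chain F C"
  then have "subset.chain {I. ideal I R} C"
    using assms(2) by (auto simp: pred_on.chain_def)
  then have "\<Union>C \<in> C" using ideal_chain_is_trivial C(1) by blast
  then show "\<Union>C \<in> F" using C(2) unfolding pred_on.chain_def by blast
qed

lemma ascending_ideals_stationary: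
  fixes I :: "nat \<Rightarrow> 'a set"
  assumes "\<And>n. ideal (I n) R" "\<And>n. I n \<subseteq> I (Suc n)"
  shows "\<exists>N. \<forall>n\<ge>N. I n = I N"
proof -
  have "\<exists>M\<in>range I. \<forall>K\<in>range I. M \<subseteq> K \<longrightarrow> K = M"
    by (rule exists_maximal_ideal_in) (use assms(1) in auto)
  then obtain N where "\<forall>K\<in>range I. I N \<subseteq> K \<longrightarrow> K = I N" by blast
  then show ?thesis using lift_Suc_mono_le[of I, OF assms(2)] by blast
qed

text \<open>This says that the localisation of \<open>R/J\<close> at a minimal prime \<open>P\<close> of \<open>J\<close> is Artinian;
  \<open>P\<close>-saturated ideals stand in for ideals of the localisation.\<close>

lemma descending_saturated_ideals_stationary:
  fixes K :: "nat \<Rightarrow> 'a set"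
  assumes P: "primeideal P R"
    and minimal: "\<And>Q. primeideal Q R \<Longrightarrow> J \<subseteq> Q \<Longrightarrow> Q \<subseteq> P \<Longrightarrow> Q = P"
    and K: "\<And>n. ideal (K n) R" "\<And>n. psat P (K n) \<subseteq> K n" "\<And>n. J \<subseteq> K n" "\<And>n. K (Suc n) \<subseteq> K n"
  shows "\<exists>n. K n = K (Suc n)"
proof (rule ccontr)
  assume neg: "\<not> ?thesis"
  \<comment> \<open>Noetherian induction on a lower bound: L is chosen maximal among the saturated
    ideals over J that lie below a strictly descending chain of saturated ideals. A chain witnessing
    this for L then takes over the name of the given one.\<close>
  define bad where "bad = (\<lambda>L. \<exists>K. (\<forall>n. ideal (K n) R \<and> psat P (K n) \<subseteq> K n \<and> L \<subseteq> K n \<and> K (Suc n) \<subset> K n))"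
  define F where "F = {L. ideal L R \<and> psat P L \<subseteq> L \<and> J \<subseteq> L \<and> bad L}"
  define L0 where "L0 = (\<Inter>n. K n)"
  have "L0 \<in> F"
  proof -
    have "ideal L0 R" unfolding L0_def using i_Intersect[of "range K"] K(1) by auto
    moreover have "psat P L0 \<subseteq> L0"
      using K(2) psat_mono[of L0 "K n" P for n] unfolding L0_def by blast
    moreover have "J \<subseteq> L0" using K(3) unfolding L0_def by blast
    moreover have "bad L0" unfolding bad_def L0_def using K neg by blast
    ultimately show ?thesis unfolding F_def by blast
  qed
  then have "\<exists>M\<in>F. \<forall>K\<in>F. M \<subseteq> K \<longrightarrow> K = M"
    by (intro exists_maximal_ideal_in) (auto simp: F_def)
  then obtain L where LF: "L \<in> F" "\<forall>K\<in>F. L \<subseteq> K \<longrightarrow> K = L" by (elim bexE)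
  then have L: "ideal L R" "psat P L \<subseteq> L" "J \<subseteq> L" "bad L" unfolding F_def by simp_all
  have max: "M = L" if "M \<in> F" "L \<subseteq> M" for M using LF that by simp
  obtain K where "\<forall>n. ideal (K n) R \<and> psat P (K n) \<subseteq> K n \<and> L \<subseteq> K n \<and> K (Suc n) \<subset> K n"
    using L(4) unfolding bad_def by (elim exE)
  then have K: "\<And>n. ideal (K n) R" "\<And>n. psat P (K n) \<subseteq> K n" "\<And>n. L \<subseteq> K n" "\<And>n. K (Suc n) \<subset> K n"
    by simp_all
  have K_sub: "K (Suc n) \<subseteq> K n" for n by (rule psubset_imp_subset[OF K(4)])
  define colon where "colon = (\<lambda>w. {r \<in> carrier R. r \<otimes> w \<in> L})"
  have colon: "ideal (colon w) R" if "w \<in> carrier R" for w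
    unfolding colon_def
    by (rule ideal_of_closed)
      (use that ideal_closed[OF L(1)] in \<open>auto simp: l_distr m_assoc\<close>)
  \<comment> \<open>Take w outside L with maximal annihilator modulo L. This annihilator is prime,
    contains J, and lies in P because L is saturated, so it equals P: in the localisation w spans a
    simple module modulo L.\<close>
  define W where "W = carrier R - L"
  have "W \<noteq> {}" using K(3)[of 1] K(4)[of 0] ideal_subset_carrier[OF K(1)[of 0]] unfolding W_def by auto
  then have "\<exists>M\<in>colon ` W. \<forall>K\<in>colon ` W. M \<subseteq> K \<longrightarrow> K = M"
    by (intro exists_maximal_ideal_in) (auto simp: W_def colon)
  then obtain w where wW: "w \<in> W" "\<forall>K\<in>colon ` W. colon w \<subseteq> K \<longrightarrow> K = colon w" by (elim bexE imageE) simp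
  then have w: "w \<in> carrier R" "w \<notin> L" unfolding W_def by simp_all
  have wmax: "colon v = colon w" if "v \<in> carrier R" "v \<notin> L" "colon w \<subseteq> colon v" for v
    using wW(2) that unfolding W_def by simp
  have "primeideal (colon w) R"
  proof (rule primeidealI[OF colon[OF w(1)] is_cring])
    have "\<one> \<notin> colon w" using w unfolding colon_def by simp
    then show "carrier R \<noteq> colon w" by blast
    fix a b assume ab: "a \<in> carrier R" "b \<in> carrier R" "a \<otimes> b \<in> colon w"
    show "a \<in> colon w \<or> b \<in> colon w"
    proof (cases "b \<in> colon w")
      case False
      then have bw: "b \<otimes> w \<notin> L" using ab unfolding colon_def by blast
      have "colon w \<subseteq> colon (b \<otimes> w)"
      proof
        fix r assume r: "r \<in> colon w"
        then have "r \<otimes> (b \<otimes> w) = b \<otimes> (r \<otimes> w)" using ab w unfolding colon_def by (auto simp: m_lcomm)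
        then show "r \<in> colon (b \<otimes> w)" using r ab ideal_closed(5)[OF L(1)] unfolding colon_def by auto
      qed
      then have "colon (b \<otimes> w) = colon w" using wmax bw ab w by auto
      moreover have "a \<in> colon (b \<otimes> w)" using ab w unfolding colon_def by (auto simp: m_assoc)
      ultimately show ?thesis by blast
    qed simp
  qed
  moreover have "J \<subseteq> colon w"
    using L(3) w ideal_closed(1,6)[OF L(1)] unfolding colon_def by auto
  moreover have "colon w \<subseteq> P"
  proof
    fix u assume "u \<in> colon w"
    then show "u \<in> P" using w psatI[of w u P L] L(2) unfolding colon_def by auto
  qed
  ultimately have "colon w = P" by (rule minimal)
  then have Pw: "r \<otimes> w \<in> L" if "r \<in> P" for r using that unfolding colon_def by blast
  \<comment> \<open>\<open>S I\<close> is the saturation of I + (w). Since \<open>S L\<close> is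
    strictly larger than L, maximality of L forbids a strictly descending chain above it, so
    consecutive ideals \<open>S (K n)\<close> coincide at arbitrarily late indices.\<close>
  define S where "S = (\<lambda>I. psat P (adjoin_ideal I w))"
  have S: "ideal (S I) R" "psat P (S I) \<subseteq> S I" "I \<subseteq> S I" "w \<in> S I" if "ideal I R" for I
    using psat_ideal[OF P adjoin_ideal(1)[OF that w(1)]] psat_psat[OF P]
      subset_psat[OF P ideal_subset_carrier[OF adjoin_ideal(1)[OF that w(1)]]]
      adjoin_ideal(2,3)[OF that w(1)] unfolding S_def by blast+
  have S_mono: "S I \<subseteq> S I'" if "I \<subseteq> I'" for I I'
    unfolding S_def by (rule psat_mono) (use that in \<open>auto simp: adjoin_ideal_def\<close>)
  have "S L \<notin> F" using max[of "S L"] S(3,4)[OF L(1)] w by auto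
  then have "\<not> bad (S L)" using S(1-3)[OF L(1)] L(3) unfolding F_def by auto
  have S_stat: "\<exists>n. S (K (m + n)) = S (K (Suc (m + n)))" for m
  proof (rule ccontr)
    assume neq: "\<not> ?thesis"
    have "S (K (Suc (m + n))) \<subset> S (K (m + n))" for n
      using neq S_mono[OF K_sub[of "m + n"]] by auto
    then have "bad (S L)"
      unfolding bad_def
      using S(1,2)[OF K(1)] S_mono[OF K(3)] by (intro exI[of _ "\<lambda>n. S (K (m + n))"]) auto
    then show False using \<open>\<not> bad (S L)\<close> by simp
  qed
  \<comment> \<open>The chain descends, so w never returns once it has left; beyond m, membership of
    w in \<open>K n\<close> does not depend on n.\<close>
  have "\<exists>m. (\<forall>n. w \<in> K (m + n)) \<or> (\<forall>n. w \<notin> K (m + n))"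
  proof (cases "\<forall>n. w \<in> K n")
    case False
    then obtain m where m: "w \<notin> K m" by blast
    have "K (m + n) \<subseteq> K m" for n by (induction n) (use K_sub in auto)
    then show ?thesis using m by blast
  qed simp
  then obtain m where m: "(\<forall>n. w \<in> K (m + n)) \<or> (\<forall>n. w \<notin> K (m + n))" by blast
  obtain n where n: "S (K (m + n)) = S (K (Suc (m + n)))" using S_stat by blast
  \<comment> \<open>Nested saturated ideals over L coincide if they agree after adjoining w and have
    the same part in the simple module spanned by w. Two consecutive members of the chain do,
    against strict descent.\<close>
  have "K (m + n) \<subseteq> K (Suc (m + n))"
  proof
    fix a assume a: "a \<in> K (m + n)"
    then have "a \<in> S (K (Suc (m + n)))" using S(3)[OF K(1)[of "m + n"]] n by auto
    then obtain u b r where u: "a \<in> carrier R" "u \<in> carrier R" "u \<notin> P"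
      and br: "b \<in> K (Suc (m + n))" "r \<in> carrier R" "u \<otimes> a = b \<oplus> r \<otimes> w"
      unfolding S_def by (metis psatE adjoin_idealE)
    have b: "b \<in> K (m + n)" "b \<in> carrier R"
      using br(1) K_sub[of "m + n"] ideal.Icarr[OF K(1)] by auto
    have "b \<oplus> r \<otimes> w \<in> K (m + n)" using br(3) ideal_closed(5)[OF K(1) a u(2)] by simp
    then have rw: "r \<otimes> w \<in> K (m + n)"
      by (rule ideal_cancel_add[OF K(1)]) (use b br(2) w in auto)
    have "r \<otimes> w \<in> K (Suc (m + n))"
    proof (cases "w \<in> K (Suc (m + n))")
      case True
      then show ?thesis using ideal_closed(5)[OF K(1)] br(2) by simp
    next
      case False
      then have "w \<notin> K (m + n)" using m by (metis add_Suc_right)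
      \<comment> \<open>A multiplier outside P would put w itself into the saturated ideal, so r
        lies in P, and P annihilates w modulo L.\<close>
      then have "r \<in> P" using psatI[OF w(1) br(2) _ rw, of P] K(2)[of "m + n"] by auto
      then show ?thesis using Pw K(3)[of "Suc (m + n)"] by auto
    qed
    then have "u \<otimes> a \<in> K (Suc (m + n))" using br ideal_closed(3)[OF K(1)] by simp
    then show "a \<in> K (Suc (m + n))" using psatI[OF u] K(2)[of "Suc (m + n)"] by auto
  qed
  then show False using K(4)[of "m + n"] by auto
qed

text \<open>Nakayama's lemma over the localisation at q; the premise quantifies over all M
  containing L and qN instead of forming L + qN. Let M be maximal among the saturated ideals over L
  that do not contain N. If za lay outside M with z in q and a in N, then N would lie in the
  saturation of M + (za), so ua = m + rza for some u outside q. Then u - rz is outside q and carries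
  a into M, so a lies in M, a contradiction. Hence qN is inside M and the premise applies.\<close>

lemma nakayama_saturated:
  assumes q: "primeideal q R" and L: "ideal L R" and N: "ideal N R"
    and sub: "\<And>M. ideal M R \<Longrightarrow> L \<subseteq> M \<Longrightarrow> (\<And>z a. z \<in> q \<Longrightarrow> a \<in> N \<Longrightarrow> z \<otimes> a \<in> M) \<Longrightarrow> N \<subseteq> psat q M"
  shows "N \<subseteq> psat q L"
proof (rule ccontr)
  assume neg: "\<not> ?thesis"
  define F where "F = {M. ideal M R \<and> psat q M \<subseteq> M \<and> L \<subseteq> M \<and> \<not> N \<subseteq> M}"
  have "psat q L \<in> F"
    using neg psat_ideal[OF q L] psat_psat[OF q] subset_psat[OF q ideal_subset_carrier[OF L]]
    unfolding F_def by blast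
  then have "\<exists>M\<in>F. \<forall>K\<in>F. M \<subseteq> K \<longrightarrow> K = M"
    by (intro exists_maximal_ideal_in) (auto simp: F_def)
  then obtain M where MF: "M \<in> F" "\<forall>K\<in>F. M \<subseteq> K \<longrightarrow> K = M" by (elim bexE)
  then have M: "ideal M R" "psat q M \<subseteq> M" "L \<subseteq> M" "\<not> N \<subseteq> M" unfolding F_def by simp_all
  have max: "K = M" if "K \<in> F" "M \<subseteq> K" for K using MF that by simp
  have all: "N \<subseteq> psat q (adjoin_ideal M y)" if y: "y \<in> carrier R" "y \<notin> M" for y
  proof (rule ccontr)
    let ?S = "psat q (adjoin_ideal M y)"
    assume "\<not> N \<subseteq> ?S"
    note a = adjoin_ideal[OF M(1) y(1)]
    have sub: "adjoin_ideal M y \<subseteq> ?S" by (rule subset_psat[OF q ideal_subset_carrier[OF a(1)]])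
    then have "?S \<in> F"
      using \<open>\<not> N \<subseteq> ?S\<close> psat_ideal[OF q a(1)] psat_psat[OF q] a(2) M(3) unfolding F_def by blast
    then have "?S = M" using max sub a(2) by blast
    then show False using sub a(3) y by blast
  qed
  note qi = primeideal.axioms(1)[OF q]
  have "z \<otimes> a \<in> M" if z: "z \<in> q" and a: "a \<in> N" for z a
  proof (rule ccontr)
    have zc: "z \<in> carrier R" and ac: "a \<in> carrier R"
      by (rule ideal.Icarr[OF qi z], rule ideal.Icarr[OF N a])
    assume za: "z \<otimes> a \<notin> M"
    then have "a \<in> psat q (adjoin_ideal M (z \<otimes> a))" using all[OF _ za] a zc ac by auto
    then obtain u m r where u: "u \<in> carrier R" "u \<notin> q"
      and m: "m \<in> M" "r \<in> carrier R" "u \<otimes> a = m \<oplus> r \<otimes> (z \<otimes> a)"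
      by (metis psatE adjoin_idealE)
    have mc: "m \<in> carrier R" by (rule ideal.Icarr[OF M(1) m(1)])
    have "(u \<ominus> r \<otimes> z) \<otimes> a = u \<otimes> a \<ominus> r \<otimes> (z \<otimes> a)" using u(1) m(2) zc ac by algebra
    also have "\<dots> = m" using m(2) mc zc ac unfolding m(3) by algebra
    finally have "(u \<ominus> r \<otimes> z) \<otimes> a \<in> M" using m(1) by simp
    moreover have "u \<ominus> r \<otimes> z \<notin> q"
    proof
      assume "u \<ominus> r \<otimes> z \<in> q"
      moreover have "r \<otimes> z \<in> q" by (rule ideal_closed(5)[OF qi z m(2)])
      ultimately have "(u \<ominus> r \<otimes> z) \<oplus> r \<otimes> z \<in> q" by (rule ideal_closed(3)[OF qi])
      moreover have "(u \<ominus> r \<otimes> z) \<oplus> r \<otimes> z = u" using u(1) m(2) zc by algebra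
      ultimately show False using u(2) by simp
    qed
    ultimately have "a \<in> M" using psatI[of a "u \<ominus> r \<otimes> z" q M] ac u(1) m(2) zc M(2) by auto
    then show False using za zc ideal_closed(5)[OF M(1)] by simp
  qed
  then have "N \<subseteq> psat q M" by (rule sub[OF M(1,3)])
  then show False using M(2,4) by blast
qed

end

section \<open>Regular local rings are domains\<close>

context cring
begin

lemma ideal_pow_ideal:
  assumes "ideal I R"
  shows "ideal (ideal_pow R I n) R"
  by (induction n) (simp_all add: oneideal ideal_prod_is_ideal assms)

lemma pow_mem_ideal_pow:
  assumes "ideal I R" "y \<in> I"
  shows "y [^] n \<in> ideal_pow R I n"
proof (induction n)
  case (Suc n)
  have yc: "y \<in> carrier R" by (rule ideal.Icarr[OF assms])
  have "y \<otimes> y [^] n \<in> I \<cdot> ideal_pow R I n" by (rule ideal_prod.prod[OF assms(2) Suc])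
  then show ?case using yc by (simp add: m_comm)
qed simp

lemma ideal_pow_Suc_subset:
  assumes "ideal I R"
  shows "ideal_pow R I (Suc n) \<subseteq> ideal_pow R I n"
  using ideal_prod_inter[OF assms ideal_pow_ideal[OF assms]] by auto

lemma ideal_prod_subset:
  assumes "ideal M R" "\<And>i j. i \<in> I \<Longrightarrow> j \<in> J \<Longrightarrow> i \<otimes> j \<in> M"
  shows "I \<cdot> J \<subseteq> M"
proof
  fix a assume "a \<in> I \<cdot> J"
  then show "a \<in> M"
    by (induction rule: ideal_prod.induct) (simp_all add: assms ideal_closed(3)[OF assms(1)])
qed

lemma ideal_sum:
  assumes "ideal I R" "ideal J R"
  shows subset_ideal_sum1: "I \<subseteq> I <+>\<^bsub>R\<^esub> J" and subset_ideal_sum2: "J \<subseteq> I <+>\<^bsub>R\<^esub> J"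
    and ideal_sum_minimal: "ideal M R \<Longrightarrow> I \<subseteq> M \<Longrightarrow> J \<subseteq> M \<Longrightarrow> I <+>\<^bsub>R\<^esub> J \<subseteq> M"
proof -
  have "Idl (I \<union> J) = I <+>\<^bsub>R\<^esub> J" by (rule union_genideal[OF assms])
  moreover have "I \<union> J \<subseteq> Idl (I \<union> J)"
    by (rule genideal_self) (use assms ideal_subset_carrier in auto)
  moreover have "Idl (I \<union> J) \<subseteq> M" if "ideal M R" "I \<subseteq> M" "J \<subseteq> M"
    by (rule genideal_minimal) (use that in auto)
  ultimately show "I \<subseteq> I <+>\<^bsub>R\<^esub> J" "J \<subseteq> I <+>\<^bsub>R\<^esub> J"
    "ideal M R \<Longrightarrow> I \<subseteq> M \<Longrightarrow> J \<subseteq> M \<Longrightarrow> I <+>\<^bsub>R\<^esub> J \<subseteq> M" by auto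
qed

end

context noetherian_cring
begin

text \<open>Krull's principal ideal theorem. The ideals \<open>sq n\<close> below are the symbolic powers
  of \<open>q\<close> modulo \<open>p\<close>.\<close>

lemma exists_primeideal_between_containing:
  assumes p: "primeideal p R" and q: "primeideal q R" and P: "primeideal P R"
    and pq: "p \<subset> q" and qP: "q \<subset> P" and x: "x \<in> P"
  shows "\<exists>Q. primeideal Q R \<and> p \<subset> Q \<and> Q \<subset> P \<and> x \<in> Q"
proof (rule ccontr)
  assume none: "\<not> ?thesis"
  then have xq: "x \<notin> q" using q pq qP by auto
  note pi = primeideal.axioms(1)[OF p] and qi = primeideal.axioms(1)[OF q] and Pi = primeideal.axioms(1)[OF P]
  have xc: "x \<in> carrier R" by (rule ideal.Icarr[OF Pi x])
  \<comment> \<open>If the claim fails, P is minimal over p + (x): a prime Q of this kind contains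
    x, which lies outside q, so Q is strictly larger than p.\<close>
  have minimal: "Q = P" if Q: "primeideal Q R" "adjoin_ideal p x \<subseteq> Q" "Q \<subseteq> P" for Q
  proof -
    have "p \<subseteq> Q" "x \<in> Q" using adjoin_ideal(2,3)[OF pi xc] Q(2) by auto
    then have "p \<subset> Q" using xq pq by auto
    then show ?thesis using none Q \<open>x \<in> Q\<close> by auto
  qed
  define A where "A n = ideal_pow R q n <+>\<^bsub>R\<^esub> p" for n
  have A: "ideal (A n) R" "ideal_pow R q n \<subseteq> A n" "p \<subseteq> A n" for n
    unfolding A_def
    using add_ideals[OF ideal_pow_ideal[OF qi] pi] ideal_sum(1,2)[OF ideal_pow_ideal[OF qi] pi] by auto
  have A_dec: "A (Suc n) \<subseteq> A n" for n
    using ideal_sum_minimal[OF ideal_pow_ideal[OF qi] pi A(1)[of n]]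
      subset_trans[OF ideal_pow_Suc_subset[OF qi] A(2)[of n]] A(3)[of n]
    unfolding A_def by blast
  define sq where "sq n = psat q (A n)" for n
  have sq: "ideal (sq n) R" "psat q (sq n) \<subseteq> sq n" "A n \<subseteq> sq n" "sq (Suc n) \<subseteq> sq n" for n
    unfolding sq_def
    by (rule psat_ideal[OF q A(1)], rule psat_psat[OF q],
        rule subset_psat[OF q ideal_subset_carrier[OF A(1)]], rule psat_mono[OF A_dec])
  define K where "K n = psat P (adjoin_ideal (sq n) x)" for n
  have sqK: "adjoin_ideal (sq n) x \<subseteq> K n" for n
    unfolding K_def
    by (rule subset_psat[OF P ideal_subset_carrier[OF adjoin_ideal(1)[OF sq(1) xc]]])
  \<comment> \<open>\<open>K n\<close> represents \<open>sq n\<close> + (x) locally at P. These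
    ideals descend over p + (x), over which P is minimal, so the Artinian property stops
    them.\<close>
  have "\<exists>n. K n = K (Suc n)"
  proof (rule descending_saturated_ideals_stationary[OF P minimal])
    fix n
    show "ideal (K n) R" unfolding K_def by (rule psat_ideal[OF P adjoin_ideal(1)[OF sq(1) xc]])
    show "psat P (K n) \<subseteq> K n" unfolding K_def by (rule psat_psat[OF P])
    show "adjoin_ideal p x \<subseteq> K n"
      by (rule subset_trans[OF _ sqK])
        (use subset_trans[OF A(3) sq(3)] in \<open>auto simp: adjoin_ideal_def\<close>)
    show "K (Suc n) \<subseteq> K n"
      unfolding K_def by (rule psat_mono) (use sq(4)[of n] in \<open>auto simp: adjoin_ideal_def\<close>)
  qed
  then obtain n where n: "K n = K (Suc n)" by (elim exE)
  \<comment> \<open>Stationarity gives ua = b + cx with u outside P and b in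
    \<open>sq (Suc n)\<close>. As x is outside q and \<open>sq n\<close> is q-saturated, c lies in
    \<open>sq n\<close>. So locally at P the ideal \<open>sq n\<close> is \<open>sq (Suc n)\<close>
    plus x times itself, and x lies in P.\<close>
  have "sq n \<subseteq> psat P (sq (Suc n))"
  proof (rule nakayama_saturated[OF P sq(1) sq(1)])
    fix M assume M: "ideal M R" "sq (Suc n) \<subseteq> M" and PM: "\<And>z a. z \<in> P \<Longrightarrow> a \<in> sq n \<Longrightarrow> z \<otimes> a \<in> M"
    show "sq n \<subseteq> psat P M"
    proof
      fix a assume a: "a \<in> sq n"
      then have "a \<in> K (Suc n)" using n sqK[of n] adjoin_ideal(2)[OF sq(1) xc, of n] by auto
      then obtain u b c where u: "a \<in> carrier R" "u \<in> carrier R" "u \<notin> P"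
        and b: "b \<in> sq (Suc n)" "c \<in> carrier R" "u \<otimes> a = b \<oplus> c \<otimes> x"
        unfolding K_def by (metis psatE adjoin_idealE)
      have "b \<oplus> c \<otimes> x \<in> sq n" using ideal_closed(5)[OF sq(1) a u(2)] b(3) by simp
      moreover have "b \<in> sq n" using b(1) sq(4) by auto
      ultimately have "c \<otimes> x \<in> sq n" by (rule ideal_cancel_add[OF sq(1)]) (use b xc in auto)
      then have "x \<otimes> c \<in> sq n" using b(2) xc by (simp add: m_comm)
      then have "c \<in> sq n" using psatI[OF b(2) xc xq] sq(2)[of n] by auto
      then have "x \<otimes> c \<in> M" by (rule PM[OF x])
      then have "c \<otimes> x \<in> M" using b(2) xc by (simp add: m_comm)
      then have "u \<otimes> a \<in> M" using b M ideal_closed(3)[OF M(1)] by auto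
      then show "a \<in> psat P M" by (rule psatI[OF u])
    qed
  qed
  also have "\<dots> \<subseteq> psat q (sq (Suc n))" by (rule psat_antimono) (use qP in auto)
  also have "\<dots> \<subseteq> sq (Suc n)" by (rule sq(2))
  finally have stat: "sq n \<subseteq> psat q (A (Suc n))" unfolding sq_def .
  \<comment> \<open>Nakayama's lemma again, now at q: modulo p, consecutive powers of q agree there,
    so the n-th power of q lies in p. This contradicts that q is strictly larger than the prime
    p.\<close>
  have "A n \<subseteq> psat q p"
  proof (rule nakayama_saturated[OF q pi A(1)])
    fix M assume M: "ideal M R" "p \<subseteq> M" and qM: "\<And>z a. z \<in> q \<Longrightarrow> a \<in> A n \<Longrightarrow> z \<otimes> a \<in> M"
    have "ideal_pow R q (Suc n) \<subseteq> M"
      unfolding ideal_pow.simps by (rule ideal_prod_subset[OF M(1) qM]) (use A(2) in auto)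
    then have "A (Suc n) \<subseteq> M"
      unfolding A_def by (intro ideal_sum_minimal[OF ideal_pow_ideal[OF qi] pi M(1)] M(2))
    then show "A n \<subseteq> psat q M"
      using subset_trans[OF sq(3)[of n] stat] psat_mono[of "A (Suc n)" M q] by auto
  qed
  also have "\<dots> \<subseteq> p" by (rule psat_primeideal[OF p]) (use pq in auto)
  finally have An: "A n \<subseteq> p" .
  obtain y where y: "y \<in> q" "y \<notin> p" using pq by auto
  have "y [^] n \<in> p" using pow_mem_ideal_pow[OF qi y(1), of n] A(2)[of n] An by auto
  then have "y \<in> p" using primeideal_pow[OF p] ideal.Icarr[OF qi y(1)] by simp
  then show False using y(2) by simp
qed

text \<open>Krull's theorem moves x down one place: a prime Q containing x between
  \<open>P d\<close> and the top replaces \<open>P (Suc d)\<close>, and the induction continues with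
  the chain that ends at Q. The result is one step shorter, \<open>Q i\<close> taking the place of
  \<open>P (Suc i)\<close>; for d = 0 the top itself already contains x.\<close>

lemma exists_prime_chain_containing:
  fixes P :: "nat \<Rightarrow> 'a set"
  assumes "\<And>i. i \<le> Suc d \<Longrightarrow> primeideal (P i) R" "\<And>i. i \<le> d \<Longrightarrow> P i \<subset> P (Suc i)" "x \<in> P (Suc d)"
  shows "\<exists>Q. (\<forall>i\<le>d. primeideal (Q i) R) \<and> (\<forall>i<d. Q i \<subset> Q (Suc i)) \<and> x \<in> Q 0 \<and> P 0 \<subset> Q 0
    \<and> Q d = P (Suc d)"
  using assms
proof (induction d arbitrary: P)
  case 0
  show ?case by (rule exI[of _ "\<lambda>_. P 1"]) (use 0 in auto)
next
  case (Suc d)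
  have "\<exists>Q. primeideal Q R \<and> P d \<subset> Q \<and> Q \<subset> P (Suc (Suc d)) \<and> x \<in> Q"
    using Suc.prems by (intro exists_primeideal_between_containing[of "P d" "P (Suc d)"]) simp_all
  then obtain Q where Q: "primeideal Q R" "P d \<subset> Q" "Q \<subset> P (Suc (Suc d))" "x \<in> Q" by (elim exE conjE)
  let ?P = "P(Suc d := Q)"
  have "\<exists>Q'. (\<forall>i\<le>d. primeideal (Q' i) R) \<and> (\<forall>i<d. Q' i \<subset> Q' (Suc i)) \<and> x \<in> Q' 0 \<and> ?P 0 \<subset> Q' 0
    \<and> Q' d = ?P (Suc d)"
    by (rule Suc.IH) (use Suc.prems Q in \<open>auto simp: le_Suc_eq\<close>)
  then obtain Q' where Q': "\<forall>i\<le>d. primeideal (Q' i) R" "\<forall>i<d. Q' i \<subset> Q' (Suc i)" "x \<in> Q' 0"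
    "P 0 \<subset> Q' 0" "Q' d = Q" by (elim exE conjE) simp
  show ?case
    by (rule exI[of _ "Q'(Suc d := P (Suc (Suc d)))"])
      (use Suc.prems(1)[of "Suc (Suc d)"] Q Q' in \<open>auto simp: le_Suc_eq less_Suc_eq\<close>)
qed

section \<open>Local rings and prime chains of full length\<close>

lemma maximalideal_max_ideal: "local_ring R \<Longrightarrow> maximalideal (max_ideal R) R"
  unfolding local_ring_def max_ideal_def by (rule theI') simp

lemma proper_ideal_subset_max_ideal:
  assumes loc: "local_ring R" and I: "ideal I R" "\<one> \<notin> I"
  shows "I \<subseteq> max_ideal R"
proof -
  define F where "F = {K. ideal K R \<and> I \<subseteq> K \<and> \<one> \<notin> K}"
  have "\<exists>M\<in>F. \<forall>K\<in>F. M \<subseteq> K \<longrightarrow> K = M"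
    by (rule exists_maximal_ideal_in) (use I in \<open>auto simp: F_def\<close>)
  then obtain M where MF: "M \<in> F" "\<forall>K\<in>F. M \<subseteq> K \<longrightarrow> K = M" by (elim bexE)
  then have M: "ideal M R" "I \<subseteq> M" "\<one> \<notin> M" unfolding F_def by simp_all
  have "maximalideal M R"
  proof (rule maximalidealI[OF M(1)])
    show "carrier R \<noteq> M" using M(3) by auto
    fix J assume J: "ideal J R" "M \<subseteq> J" "J \<subseteq> carrier R"
    show "J = M \<or> J = carrier R"
      using MF(2) J M(2) ideal.one_imp_carrier[OF J(1)] unfolding F_def by auto
  qed
  then have "M = max_ideal R"
    using loc maximalideal_max_ideal[OF loc] unfolding local_ring_def by metis
  then show ?thesis using M(2) by simp
qed

lemma unit_of_notin_max_ideal: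
  assumes loc: "local_ring R" and u: "u \<in> carrier R" "u \<notin> max_ideal R"
  shows "u \<in> Units R"
proof -
  have "\<one> \<in> PIdl u"
    using proper_ideal_subset_max_ideal[OF loc cgenideal_ideal[OF u(1)]] cgenideal_self[OF u(1)] u(2)
    by auto
  then obtain v where "v \<in> carrier R" "\<one> = v \<otimes> u" unfolding cgenideal_def by auto
  then show ?thesis using u(1) m_comm[of v u] unfolding Units_def by auto
qed

text \<open>A version relative to I of the statement that the chain starts at zero: the generators
  already divided out are collected in I and those left form G, so the induction never leaves R. A
  generator x outside \<open>P 0\<close> moves from G to I, the chain is replaced by one through x
  that is a step shorter, and the induction hypothesis puts \<open>P 0\<close> inside I + (x).
  Primality of \<open>P 0\<close> turns this into I + x \<open>P 0\<close>.\<close>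

lemma chain_start_eq_ideal:
  fixes P :: "nat \<Rightarrow> 'a set"
  assumes loc: "local_ring R"
    and "ideal I R" "finite G" "card G \<le> d" "G \<subseteq> carrier R" "Idl (I \<union> G) = max_ideal R"
    and "\<And>i. i \<le> d \<Longrightarrow> primeideal (P i) R" "\<And>i. i < d \<Longrightarrow> P i \<subset> P (Suc i)"
    and "P d = max_ideal R" "I \<subseteq> P 0"
  shows "P 0 \<subseteq> I"
  using assms(2-)
proof (induction d arbitrary: I G P)
  case 0
  then show ?case using genideal_minimal[of I I] by auto
next
  case (Suc d)
  note I = \<open>ideal I R\<close>
  note m = maximalideal_max_ideal[OF loc]
  note mi = maximalideal.axioms(1)[OF m]
  have P0: "primeideal (P 0) R" using Suc.prems(6) by simp
  note P0i = primeideal.axioms(1)[OF P0]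
  have "P 0 \<subset> P (Suc k)" if "k \<le> d" for k
    using that by (induction k) (use Suc.prems(7) in \<open>auto simp: less_Suc_eq_le intro: psubset_trans\<close>)
  then have P0m: "P 0 \<subset> max_ideal R" using Suc.prems(8) by auto
  have "\<not> I \<union> G \<subseteq> P 0"
    using genideal_minimal[OF P0i, of "I \<union> G"] Suc.prems(5) P0m by auto
  then obtain x where x: "x \<in> G" "x \<notin> P 0" using Suc.prems(9) by auto
  have xc: "x \<in> carrier R" using x Suc.prems(4) by auto
  have IG: "I \<union> G \<subseteq> max_ideal R"
    using genideal_self[of "I \<union> G"] Suc.prems(4,5) ideal_subset_carrier[OF I] by auto
  have "x \<in> P (Suc d)" using x(1) IG Suc.prems(8) by auto
  then have "\<exists>Q. (\<forall>i\<le>d. primeideal (Q i) R) \<and> (\<forall>i<d. Q i \<subset> Q (Suc i)) \<and> x \<in> Q 0 \<and> P 0 \<subset> Q 0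
    \<and> Q d = P (Suc d)"
    by (intro exists_prime_chain_containing) (use Suc.prems(6,7) in auto)
  then obtain Q where Q: "\<forall>i\<le>d. primeideal (Q i) R" "\<forall>i<d. Q i \<subset> Q (Suc i)" "x \<in> Q 0" "P 0 \<subset> Q 0"
    "Q d = max_ideal R" using Suc.prems(8) by (elim exE conjE) simp
  note I' = adjoin_ideal[OF I xc]
  have Q0i: "ideal (Q 0) R" using Q(1) primeideal.axioms(1) by auto
  have sub': "adjoin_ideal I x \<union> (G - {x}) \<subseteq> max_ideal R"
    using adjoin_ideal_minimal[OF mi, of I x] IG x(1) by auto
  have "Q 0 \<subseteq> adjoin_ideal I x"
  proof (rule Suc.IH[of _ "G - {x}"])
    show "Idl (adjoin_ideal I x \<union> (G - {x})) = max_ideal R"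
    proof
      show "Idl (adjoin_ideal I x \<union> (G - {x})) \<subseteq> max_ideal R" by (rule genideal_minimal[OF mi sub'])
      have "I \<union> G \<subseteq> Idl (adjoin_ideal I x \<union> (G - {x}))"
        using genideal_self[of "adjoin_ideal I x \<union> (G - {x})"] I'(2,3)
          sub' ideal_subset_carrier[OF mi] by auto
      then have "Idl (I \<union> G) \<subseteq> Idl (adjoin_ideal I x \<union> (G - {x}))"
        by (intro genideal_minimal genideal_ideal) (use sub' ideal_subset_carrier[OF mi] in auto)
      then show "max_ideal R \<subseteq> Idl (adjoin_ideal I x \<union> (G - {x}))" using Suc.prems(5) by simp
    qed
    show "adjoin_ideal I x \<subseteq> Q 0"
      by (rule adjoin_ideal_minimal[OF Q0i]) (use Suc.prems(9) Q in auto)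
  qed (use Suc.prems Q x I' in auto)
  then have "P 0 \<subseteq> adjoin_ideal I x" using Q(4) by auto
  then have "\<forall>a\<in>P 0. \<exists>b\<in>P 0. \<exists>i\<in>I. a = i \<oplus> b \<otimes> x"
  proof (intro ballI)
    fix a assume a: "a \<in> P 0" and "P 0 \<subseteq> adjoin_ideal I x"
    then have "a \<in> adjoin_ideal I x" by auto
    then obtain i b where ib: "i \<in> I" "b \<in> carrier R" "a = i \<oplus> b \<otimes> x" by (rule adjoin_idealE)
    have "i \<oplus> b \<otimes> x \<in> P 0" using a ib(3) by simp
    moreover have "i \<in> P 0" using ib(1) Suc.prems(9) by auto
    ultimately have "b \<otimes> x \<in> P 0" by (rule ideal_cancel_add[OF P0i]) (use ib xc in auto)
    then have "b \<in> P 0" using primeideal.I_prime[OF P0 ib(2) xc] x(2) by auto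
    then show "\<exists>b\<in>P 0. \<exists>i\<in>I. a = i \<oplus> b \<otimes> x" using ib by auto
  qed
  then obtain f where f: "\<And>a. a \<in> P 0 \<Longrightarrow> f a \<in> P 0 \<and> (\<exists>i\<in>I. a = i \<oplus> f a \<otimes> x)" by metis
  show "P 0 \<subseteq> I"
  proof
    fix a assume a: "a \<in> P 0"
    \<comment> \<open>Nakayama's lemma by iteration: b 0 is a, and b n is x b (n+1) modulo I, so the
      ideals I + (b n) ascend. Where they stop, b (N+1) is c b N, hence c x b (N+1), modulo I, and 1
      - cx is a unit.\<close>
    define b where "b n = (f ^^ n) a" for n
    have bP: "b n \<in> P 0" for n by (induction n) (use a f in \<open>auto simp: b_def\<close>)
    have bc: "b n \<in> carrier R" for n by (rule ideal.Icarr[OF P0i bP])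
    have b_step: "\<exists>i\<in>I. b n = i \<oplus> b (Suc n) \<otimes> x" for n using f[OF bP[of n]] by (simp add: b_def)
    have b_in: "b n \<in> K" if K: "ideal K R" "I \<subseteq> K" "b (Suc n) \<in> K" for n K
    proof -
      obtain i where "i \<in> I" "b n = i \<oplus> b (Suc n) \<otimes> x" using b_step by metis
      then show ?thesis using K ideal_closed(3,6)[OF K(1)] xc by auto
    qed
    have "\<exists>N. \<forall>n\<ge>N. adjoin_ideal I (b n) = adjoin_ideal I (b N)"
    proof (rule ascending_ideals_stationary)
      fix n
      note adj = adjoin_ideal[OF I bc[of "Suc n"]]
      show "ideal (adjoin_ideal I (b n)) R" by (rule adjoin_ideal(1)[OF I bc])
      show "adjoin_ideal I (b n) \<subseteq> adjoin_ideal I (b (Suc n))"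
        by (rule adjoin_ideal_minimal[OF adj(1,2)]) (rule b_in[OF adj])
    qed
    then obtain N where "adjoin_ideal I (b (Suc N)) = adjoin_ideal I (b N)" by (metis le_SucI order_refl)
    then have "b (Suc N) \<in> adjoin_ideal I (b N)" using adjoin_ideal(3)[OF I bc] by metis
    then obtain i c where ic: "i \<in> I" "c \<in> carrier R" "b (Suc N) = i \<oplus> c \<otimes> b N" by (rule adjoin_idealE)
    obtain j where j: "j \<in> I" "b N = j \<oplus> b (Suc N) \<otimes> x" using b_step by metis
    note Ic = ideal.Icarr[OF I]
    define v where "v = \<one> \<ominus> c \<otimes> x"
    have "b (Suc N) = i \<oplus> c \<otimes> (j \<oplus> b (Suc N) \<otimes> x)" using ic(3) j(2) by simp
    also have "\<dots> = (i \<oplus> c \<otimes> j) \<oplus> (c \<otimes> x) \<otimes> b (Suc N)"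
      using Ic[OF ic(1)] Ic[OF j(1)] ic(2) xc bc[of "Suc N"] by algebra
    finally have eq: "b (Suc N) = (i \<oplus> c \<otimes> j) \<oplus> (c \<otimes> x) \<otimes> b (Suc N)" .
    have "v \<otimes> b (Suc N) = b (Suc N) \<ominus> (c \<otimes> x) \<otimes> b (Suc N)"
      unfolding v_def using ic(2) xc bc[of "Suc N"] by algebra
    also have "\<dots> = ((i \<oplus> c \<otimes> j) \<oplus> (c \<otimes> x) \<otimes> b (Suc N)) \<ominus> (c \<otimes> x) \<otimes> b (Suc N)"
      using eq by simp
    also have "\<dots> = i \<oplus> c \<otimes> j"
      using Ic[OF ic(1)] Ic[OF j(1)] ic(2) xc bc[of "Suc N"] by algebra
    also have "\<dots> \<in> I" using ic j ideal_closed(3,5)[OF I] by simp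
    finally have vb: "v \<otimes> b (Suc N) \<in> I" .
    have "v \<notin> max_ideal R"
    proof
      assume "v \<in> max_ideal R"
      moreover have "c \<otimes> x \<in> max_ideal R" using ideal_closed(5)[OF mi] ic(2) x(1) IG by auto
      ultimately have "v \<oplus> c \<otimes> x \<in> max_ideal R" by (rule ideal_closed(3)[OF mi])
      moreover have "v \<oplus> c \<otimes> x = \<one>" unfolding v_def using ic(2) xc by algebra
      ultimately show False
        using ideal.one_imp_carrier[OF mi] maximalideal.I_notcarr[OF m] by auto
    qed
    then have vU: "v \<in> Units R" by (rule unit_of_notin_max_ideal[OF loc, rotated]) (use ic xc in \<open>auto simp: v_def\<close>)
    then have "b (Suc N) = inv v \<otimes> (v \<otimes> b (Suc N))"
      using m_assoc[of "inv v" v "b (Suc N)"] bc[of "Suc N"] Units_closed[OF vU] by simp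
    also have "\<dots> \<in> I" using ideal_closed(5)[OF I vb] vU by simp
    finally have "b (Suc N) \<in> I" .
    moreover have "b 0 \<in> I" if "b n \<in> I" for n
      using that
    proof (induction n)
      case (Suc n)
      then show ?case using b_in[OF I subset_refl, of n] by simp
    qed
    ultimately have "b 0 \<in> I" by blast
    then show "a \<in> I" by (simp add: b_def)
  qed
qed

end

theorem regular_local_ring_domain:
  fixes R (structure)
  assumes reg: "regular_local_ring R"
  shows "domain R"
proof -
  have loc: "local_ring R" and noeth: "noetherian_ring R" and dim: "krull_dim R = enat (emb_dim R)"
    using reg unfolding regular_local_ring_def by auto
  interpret cring R using loc unfolding local_ring_def by simp
  interpret noetherian_ring R by (rule noeth)
  interpret noetherian_cring R ..
  note m = maximalideal_max_ideal[OF loc]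
  note mi = maximalideal.axioms(1)[OF m]
  define d where "d = emb_dim R"
  have "\<exists>n G. finite G \<and> card G = n \<and> G \<subseteq> carrier R \<and> Idl G = max_ideal R"
    using finetely_gen[OF mi] by auto
  then have "\<exists>G. finite G \<and> card G = d \<and> G \<subseteq> carrier R \<and> Idl G = max_ideal R"
    unfolding d_def emb_dim_def by (rule LeastI_ex)
  then obtain G where G: "finite G" "card G = d" "G \<subseteq> carrier R" "Idl G = max_ideal R"
    by (elim exE conjE)
  \<comment> \<open>The dimension is a supremum. If every chain were shorter than d > 0, the
    supremum would be at most d - 1; so some chain reaches d. For d = 0 no chain is
    requested.\<close>
  have "\<exists>ps. d = 0 \<or> (prime_chain R ps \<and> d \<le> length ps - 1)"
  proof (rule ccontr)
    assume none: "\<not> ?thesis"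
    then have neg: "length ps - 1 < d" if "prime_chain R ps" for ps using that not_le by auto
    have "d \<noteq> 0" using none by simp
    have "krull_dim R \<le> enat (d - 1)"
      unfolding krull_dim_def using neg by (intro Sup_least) fastforce
    then show False using dim \<open>d \<noteq> 0\<close> unfolding d_def by auto
  qed
  then obtain ps where ps: "d = 0 \<or> (prime_chain R ps \<and> d \<le> length ps - 1)" by (elim exE)
  \<comment> \<open>The chain found may have more than d steps or end below the maximal ideal, so
    its member at position d is replaced by the maximal ideal and the rest dropped. For d = 0 only
    the maximal ideal remains.\<close>
  define P where "P i = (if i < d then ps ! i else max_ideal R)" for i
  have psd: "d < length ps" "\<forall>Q\<in>set ps. primeideal Q R" "sorted_wrt (\<subset>) ps" if "d \<noteq> 0"
    using ps that unfolding prime_chain_def by (auto simp: Suc_le_eq)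
  have prime: "primeideal (P i) R" if "i \<le> d" for i
    using psd that maximalideal_prime[OF m] unfolding P_def by auto
  have "P 0 \<subseteq> {\<zero>}"
  proof (rule chain_start_eq_ideal[OF loc zeroideal, of G d])
    have sub: "{\<zero>} \<union> G \<subseteq> carrier R" using G by auto
    have "Idl ({\<zero>} \<union> G) = Idl G"
    proof
      show "Idl ({\<zero>} \<union> G) \<subseteq> Idl G"
        using genideal_self[OF G(3)] genideal_ideal[OF G(3)] ideal_closed(2)[OF genideal_ideal[OF G(3)]]
        by (intro genideal_minimal) auto
      show "Idl G \<subseteq> Idl ({\<zero>} \<union> G)" by (rule subset_Idl_subset[OF sub]) auto
    qed
    then show "Idl ({\<zero>} \<union> G) = max_ideal R" using G by simp
    show "P i \<subset> P (Suc i)" if i: "i < d" for i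
    proof -
      have lt: "ps ! i \<subset> ps ! Suc i"
        using psd(1,3) i sorted_wrt_nth_less[of "(\<subset>)" ps i "Suc i"] by simp
      have "primeideal (ps ! Suc i) R" using psd(1,2) i by simp
      then have "ps ! Suc i \<subseteq> max_ideal R"
        by (intro proper_ideal_subset_max_ideal[OF loc] primeideal_one_notin primeideal.axioms(1))
      then show ?thesis using lt i unfolding P_def by auto
    qed
    show "{\<zero>} \<subseteq> P 0" using ideal_closed(2) primeideal.axioms(1)[OF prime[of 0]] by auto
  qed (use G prime in \<open>auto simp: P_def\<close>)
  then have "P 0 = {\<zero>}" using ideal_closed(2)[OF primeideal.axioms(1)[OF prime[of 0]]] by auto
  then show ?thesis using zeroprimeideal_domainI prime[of 0] by simp
qed

section \<open>Module-finite extensions\<close>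

context ring_hom_cring
begin

abbreviation smult (infixl \<open>\<otimes>\<^sub>S\<close> 70) where "x \<otimes>\<^sub>S y \<equiv> x \<otimes>\<^bsub>S\<^esub> y"
abbreviation splus (infixl \<open>\<oplus>\<^sub>S\<close> 65) where "x \<oplus>\<^sub>S y \<equiv> x \<oplus>\<^bsub>S\<^esub> y"
abbreviation sminus (infixl \<open>\<ominus>\<^sub>S\<close> 65) where "x \<ominus>\<^sub>S y \<equiv> x \<ominus>\<^bsub>S\<^esub> y"
abbreviation suminus (\<open>\<ominus>\<^sub>S _\<close> [81] 80) where "\<ominus>\<^sub>S x \<equiv> \<ominus>\<^bsub>S\<^esub> x"
abbreviation spow (infixr \<open>[^]\<^sub>S\<close> 75) where "x [^]\<^sub>S (k::nat) \<equiv> x [^]\<^bsub>S\<^esub> k"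
abbreviation szero (\<open>\<zero>\<^sub>S\<close>) where "\<zero>\<^sub>S \<equiv> \<zero>\<^bsub>S\<^esub>"
abbreviation sone (\<open>\<one>\<^sub>S\<close>) where "\<one>\<^sub>S \<equiv> \<one>\<^bsub>S\<^esub>"

text \<open>The coefficient ideal is a parameter: with the k-th power of m this is m^k times the
  span. Recursion over a list lets proofs split off one generator at a time without any
  independence.\<close>

primrec fspan :: "'a set \<Rightarrow> 'c list \<Rightarrow> 'c set" where
  "fspan I [] = {\<zero>\<^sub>S}"
| "fspan I (g # gs) = {h c \<otimes>\<^sub>S g \<oplus>\<^sub>S v | c v. c \<in> I \<and> v \<in> fspan I gs}"

lemma fspan_ConsE:
  assumes "a \<in> fspan I (g # gs)"
  obtains c v where "c \<in> I" "v \<in> fspan I gs" "a = h c \<otimes>\<^sub>S g \<oplus>\<^sub>S v"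
  using assms by auto

lemma fspan_ConsI: "c \<in> I \<Longrightarrow> v \<in> fspan I gs \<Longrightarrow> h c \<otimes>\<^sub>S g \<oplus>\<^sub>S v \<in> fspan I (g # gs)"
  by auto

lemma fspan_carrier:
  assumes "I \<subseteq> carrier R" "set gs \<subseteq> carrier S"
  shows "fspan I gs \<subseteq> carrier S"
  using assms(2) by (induction gs) (use assms(1) in \<open>auto intro!: S.a_closed S.m_closed hom_closed\<close>)

lemma fspan_mono: "I \<subseteq> K \<Longrightarrow> fspan I gs \<subseteq> fspan K gs"
  by (induction gs) auto

lemma fspan_zero:
  assumes "ideal I R" "set gs \<subseteq> carrier S"
  shows "\<zero>\<^sub>S \<in> fspan I gs"
  using assms(2)
proof (induction gs)
  case (Cons g gs)
  have "h \<zero> \<otimes>\<^sub>S g \<oplus>\<^sub>S \<zero>\<^sub>S \<in> fspan I (g # gs)"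
    by (rule fspan_ConsI) (use Cons R.ideal_closed(2)[OF assms(1)] in auto)
  then show ?case using Cons.prems by simp
qed simp

lemma fspan_subset_Cons:
  assumes "ideal I R" "set (g # gs) \<subseteq> carrier S"
  shows "fspan I gs \<subseteq> fspan I (g # gs)"
proof
  fix v assume v: "v \<in> fspan I gs"
  then have "v \<in> carrier S" using fspan_carrier[OF R.ideal_subset_carrier[OF assms(1)]] assms(2) by auto
  then show "v \<in> fspan I (g # gs)"
    using fspan_ConsI[OF R.ideal_closed(2)[OF assms(1)] v, of g] assms(2) by simp
qed

lemma fspan_add:
  assumes I: "ideal I R" and "set gs \<subseteq> carrier S" "a \<in> fspan I gs" "b \<in> fspan I gs"
  shows "a \<oplus>\<^sub>S b \<in> fspan I gs"
  using assms(2-)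
proof (induction gs arbitrary: a b)
  case (Cons g gs)
  obtain c v where a: "c \<in> I" "v \<in> fspan I gs" "a = h c \<otimes>\<^sub>S g \<oplus>\<^sub>S v"
    using Cons.prems(2) by (rule fspan_ConsE)
  obtain d w where b: "d \<in> I" "w \<in> fspan I gs" "b = h d \<otimes>\<^sub>S g \<oplus>\<^sub>S w"
    using Cons.prems(3) by (rule fspan_ConsE)
  have cd: "c \<in> carrier R" "d \<in> carrier R" using a b R.ideal_closed(1)[OF I] by auto
  have vw: "v \<in> carrier S" "w \<in> carrier S" "g \<in> carrier S"
    using a(2) b(2) Cons.prems(1) fspan_carrier[OF R.ideal_subset_carrier[OF I]] by auto
  have "a \<oplus>\<^sub>S b = (h c \<oplus>\<^sub>S h d) \<otimes>\<^sub>S g \<oplus>\<^sub>S (v \<oplus>\<^sub>S w)"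
    unfolding a(3) b(3) using cd[THEN hom_closed] vw by algebra
  also have "\<dots> = h (c \<oplus> d) \<otimes>\<^sub>S g \<oplus>\<^sub>S (v \<oplus>\<^sub>S w)" using cd by simp
  also have "\<dots> \<in> fspan I (g # gs)"
    by (rule fspan_ConsI[OF R.ideal_closed(3)[OF I a(1) b(1)]]) (use Cons a b in auto)
  finally show ?case .
qed simp

lemma fspan_smult:
  assumes "I \<subseteq> carrier R" "set gs \<subseteq> carrier S" "c \<in> carrier R" "\<And>a. a \<in> I \<Longrightarrow> c \<otimes> a \<in> K"
    and "v \<in> fspan I gs"
  shows "h c \<otimes>\<^sub>S v \<in> fspan K gs"
  using assms(2,5)
proof (induction gs arbitrary: v)
  case Nil
  then show ?case using assms(3) by simp
next
  case (Cons g gs)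
  obtain d w where d: "d \<in> I" "w \<in> fspan I gs" "v = h d \<otimes>\<^sub>S g \<oplus>\<^sub>S w"
    using Cons.prems(2) by (rule fspan_ConsE)
  have dc: "d \<in> carrier R" using d assms(1) by auto
  have wg: "w \<in> carrier S" "g \<in> carrier S" using d(2) Cons.prems(1) fspan_carrier[OF assms(1)] by auto
  have "h c \<otimes>\<^sub>S v = (h c \<otimes>\<^sub>S h d) \<otimes>\<^sub>S g \<oplus>\<^sub>S h c \<otimes>\<^sub>S w"
    unfolding d(3) using hom_closed[OF dc] hom_closed[OF assms(3)] wg by algebra
  also have "\<dots> = h (c \<otimes> d) \<otimes>\<^sub>S g \<oplus>\<^sub>S h c \<otimes>\<^sub>S w" using dc assms(3) by simp
  also have "\<dots> \<in> fspan K (g # gs)"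
    by (rule fspan_ConsI[OF assms(4)[OF d(1)]]) (use Cons d in auto)
  finally show ?case .
qed

lemma fspan_smult_ideal:
  assumes "ideal I R" "set gs \<subseteq> carrier S" "c \<in> carrier R" "v \<in> fspan I gs"
  shows "h c \<otimes>\<^sub>S v \<in> fspan I gs"
  by (rule fspan_smult[OF R.ideal_subset_carrier[OF assms(1)] assms(2,3) R.ideal_closed(5)[OF assms(1) _ assms(3)] assms(4)])

lemma fspan_neg:
  assumes "ideal I R" "set gs \<subseteq> carrier S" "v \<in> fspan I gs"
  shows "\<ominus>\<^sub>S v \<in> fspan I gs"
proof -
  have "v \<in> carrier S" using fspan_carrier[OF R.ideal_subset_carrier[OF assms(1)] assms(2)] assms(3) by auto
  then have "\<ominus>\<^sub>S v = h (\<ominus> \<one>) \<otimes>\<^sub>S v" by (simp add: S.l_minus)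
  also have "\<dots> \<in> fspan I gs" by (rule fspan_smult_ideal[OF assms(1,2) _ assms(3)]) simp
  finally show ?thesis .
qed

lemma fspan_minus:
  assumes "ideal I R" "set gs \<subseteq> carrier S" "v \<in> fspan I gs" "w \<in> fspan I gs"
  shows "v \<ominus>\<^sub>S w \<in> fspan I gs"
  unfolding a_minus_def by (rule fspan_add[OF assms(1-3) fspan_neg[OF assms(1,2,4)]])

lemma fspan_gen:
  assumes "ideal I R" "set gs \<subseteq> carrier S" "c \<in> I" "g \<in> set gs"
  shows "h c \<otimes>\<^sub>S g \<in> fspan I gs"
  using assms(2,4)
proof (induction gs)
  case (Cons k gs)
  show ?case
  proof (cases "g = k")
    case True
    have "h c \<otimes>\<^sub>S g \<oplus>\<^sub>S \<zero>\<^sub>S \<in> fspan I (k # gs)"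
      unfolding True by (rule fspan_ConsI[OF assms(3)]) (use Cons fspan_zero[OF assms(1)] in auto)
    moreover have "h c \<otimes>\<^sub>S g \<in> carrier S"
      using Cons.prems R.ideal_closed(1)[OF assms(1,3)] by auto
    ultimately show ?thesis by simp
  next
    case False
    then show ?thesis using Cons fspan_subset_Cons[OF assms(1) Cons.prems(1)] by auto
  qed
qed simp

lemma fspan_gen_carrier:
  assumes "set gs \<subseteq> carrier S" "g \<in> set gs"
  shows "g \<in> fspan (carrier R) gs"
  using fspan_gen[OF R.oneideal assms(1) R.one_closed assms(2)] assms by auto

text \<open>Three coefficient ideals serve two purposes at once: with all of R they show that a span
  is stable under multiplication by x, and with smaller ideals they bound the coefficients of a
  product.\<close>

lemma fspan_mult:
  assumes I: "ideal I R" and I': "ideal I' R" and K: "ideal K R"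
    and gs: "set gs \<subseteq> carrier S" and gs': "set gs' \<subseteq> carrier S" and x: "x \<in> carrier S"
    and xg: "\<And>g. g \<in> set gs \<Longrightarrow> x \<otimes>\<^sub>S g \<in> fspan I gs'"
    and prod: "\<And>c a. c \<in> I' \<Longrightarrow> a \<in> I \<Longrightarrow> c \<otimes> a \<in> K"
    and v: "v \<in> fspan I' gs"
  shows "x \<otimes>\<^sub>S v \<in> fspan K gs'"
  using gs xg v
proof (induction gs arbitrary: v)
  case Nil
  then show ?case using x fspan_zero[OF K gs'] by simp
next
  case (Cons g gs)
  obtain c w where c: "c \<in> I'" "w \<in> fspan I' gs" "v = h c \<otimes>\<^sub>S g \<oplus>\<^sub>S w"
    using Cons.prems(3) by (rule fspan_ConsE)
  have cc: "c \<in> carrier R" by (rule R.ideal_closed(1)[OF I' c(1)])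
  have wg: "w \<in> carrier S" "g \<in> carrier S"
    using c(2) Cons.prems(1) fspan_carrier[OF R.ideal_subset_carrier[OF I']] by auto
  have "x \<otimes>\<^sub>S v = h c \<otimes>\<^sub>S (x \<otimes>\<^sub>S g) \<oplus>\<^sub>S x \<otimes>\<^sub>S w"
    unfolding c(3) using hom_closed[OF cc] x wg by algebra
  also have "\<dots> \<in> fspan K gs'"
  proof (rule fspan_add[OF K gs'])
    show "h c \<otimes>\<^sub>S (x \<otimes>\<^sub>S g) \<in> fspan K gs'"
      by (rule fspan_smult[OF R.ideal_subset_carrier[OF I] gs' cc prod[OF c(1)]]) (use Cons.prems(2) in auto)
    show "x \<otimes>\<^sub>S w \<in> fspan K gs'" using Cons.IH c(2) Cons.prems by auto
  qed
  finally show ?case .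
qed

section \<open>Submodules, integral equations and incomparability\<close>

definition submod :: "'c set \<Rightarrow> bool" where
  "submod M \<longleftrightarrow> M \<subseteq> carrier S \<and> \<zero>\<^sub>S \<in> M \<and> (\<forall>a\<in>M. \<forall>b\<in>M. a \<oplus>\<^sub>S b \<in> M)
    \<and> (\<forall>c\<in>carrier R. \<forall>a\<in>M. h c \<otimes>\<^sub>S a \<in> M)"

lemma submod_closed:
  assumes "submod M"
  shows "a \<in> M \<Longrightarrow> a \<in> carrier S" "\<zero>\<^sub>S \<in> M" "a \<in> M \<Longrightarrow> b \<in> M \<Longrightarrow> a \<oplus>\<^sub>S b \<in> M"
    "c \<in> carrier R \<Longrightarrow> a \<in> M \<Longrightarrow> h c \<otimes>\<^sub>S a \<in> M"
  using assms unfolding submod_def by auto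

lemma submod_minus:
  assumes "submod M" "a \<in> M" "b \<in> M"
  shows "a \<ominus>\<^sub>S b \<in> M"
proof -
  have "a \<ominus>\<^sub>S b = a \<oplus>\<^sub>S h (\<ominus> \<one>) \<otimes>\<^sub>S b"
    using submod_closed(1)[OF assms(1)] assms(2,3) by (simp add: S.l_minus a_minus_def)
  moreover have "h (\<ominus> \<one>) \<otimes>\<^sub>S b \<in> M" by (rule submod_closed(4)[OF assms(1) _ assms(3)]) simp
  ultimately show ?thesis using submod_closed(3)[OF assms(1,2)] by metis
qed

lemma submod_fspan: "set gs \<subseteq> carrier S \<Longrightarrow> ideal I R \<Longrightarrow> submod (fspan I gs)"
  unfolding submod_def
  using fspan_carrier[OF R.ideal_subset_carrier] fspan_zero fspan_add fspan_smult_ideal by auto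

lemma submod_Int: "submod M \<Longrightarrow> submod N \<Longrightarrow> submod (M \<inter> N)"
  unfolding submod_def by auto

lemma submod_finsum:
  assumes "submod M" "\<And>i. i \<in> A \<Longrightarrow> f i \<in> M"
  shows "finsum S f A \<in> M"
proof (cases "finite A")
  case True
  then show ?thesis using assms(2)
  proof (induction A)
    case empty
    then show ?case using submod_closed(2)[OF assms(1)] by simp
  next
    case (insert x A)
    have "f \<in> A \<rightarrow> carrier S" "f x \<in> carrier S" using insert.prems submod_closed(1)[OF assms(1)] by auto
    then show ?case using insert submod_closed(3)[OF assms(1)] by auto
  qed
next
  case False
  then show ?thesis using submod_closed(2)[OF assms(1)] by simp
qed

text \<open>Finite modules over a Noetherian ring are Noetherian, by induction on the generators.
  Both the intersections with the span F of the tail and the ideals of coefficients occurring at the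
  head g become stationary. After that, an element of M n differs from one of M N with the same head
  coefficient by an element of F that lies in M n, hence in M N.\<close>

lemma ascending_submods_stationary:
  fixes M :: "nat \<Rightarrow> 'c set"
  assumes noeth: "noetherian_ring R" and "set gs \<subseteq> carrier S"
    and "\<And>n. submod (M n)" "\<And>n. M n \<subseteq> fspan (carrier R) gs" "\<And>n. M n \<subseteq> M (Suc n)"
  shows "\<exists>N. \<forall>n\<ge>N. M n = M N"
  using assms(2-)
proof (induction gs arbitrary: M)
  case Nil
  have "M n = {\<zero>\<^sub>S}" for n using Nil(3)[of n] submod_closed(2)[OF Nil(2)[of n]] by auto
  then show ?case by simp
next
  case (Cons g gs)
  interpret noetherian_ring R by (rule noeth)
  interpret noetherian_cring R ..
  have gs: "set gs \<subseteq> carrier S" and g: "g \<in> carrier S" using Cons.prems(1) by auto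
  define F where "F = fspan (carrier R) gs"
  have F: "submod F" unfolding F_def by (rule submod_fspan[OF gs R.oneideal])
  have mono: "M n \<subseteq> M m" if "n \<le> m" for n m by (rule lift_Suc_mono_le[of M, OF Cons.prems(4) that])
  have "\<exists>N. \<forall>n\<ge>N. M n \<inter> F = M N \<inter> F"
  proof (rule Cons.IH[OF gs])
    fix n
    show "submod (M n \<inter> F)" by (rule submod_Int[OF Cons.prems(2) F])
    show "M n \<inter> F \<subseteq> fspan (carrier R) gs" unfolding F_def by simp
    show "M n \<inter> F \<subseteq> M (Suc n) \<inter> F" using Cons.prems(4) by auto
  qed
  then obtain N1 where N1: "\<And>n. n \<ge> N1 \<Longrightarrow> M n \<inter> F = M N1 \<inter> F" by auto
  define I where "I n = {c \<in> carrier R. \<exists>v\<in>F. h c \<otimes>\<^sub>S g \<oplus>\<^sub>S v \<in> M n}" for n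
  have "\<exists>N. \<forall>n\<ge>N. I n = I N"
  proof (rule ascending_ideals_stationary)
    fix n
    note Mn = submod_closed[OF Cons.prems(2)[of n]] and Fn = submod_closed[OF F]
    show "ideal (I n) R"
    proof (rule R.ideal_of_closed)
      show "I n \<subseteq> carrier R" unfolding I_def by auto
      show "\<zero> \<in> I n" unfolding I_def using Mn(2) Fn(2) g by (auto intro!: bexI[of _ "\<zero>\<^sub>S"])
    next
      fix a b assume "a \<in> I n" "b \<in> I n"
      then obtain v w where v: "a \<in> carrier R" "v \<in> F" "h a \<otimes>\<^sub>S g \<oplus>\<^sub>S v \<in> M n"
        and w: "b \<in> carrier R" "w \<in> F" "h b \<otimes>\<^sub>S g \<oplus>\<^sub>S w \<in> M n" unfolding I_def by auto
      have "(h a \<otimes>\<^sub>S g \<oplus>\<^sub>S v) \<oplus>\<^sub>S (h b \<otimes>\<^sub>S g \<oplus>\<^sub>S w) = (h a \<oplus>\<^sub>S h b) \<otimes>\<^sub>S g \<oplus>\<^sub>S (v \<oplus>\<^sub>S w)"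
        using g hom_closed[OF v(1)] hom_closed[OF w(1)] Fn(1)[OF v(2)] Fn(1)[OF w(2)] by algebra
      then have "h (a \<oplus> b) \<otimes>\<^sub>S g \<oplus>\<^sub>S (v \<oplus>\<^sub>S w) \<in> M n" using Mn(3)[OF v(3) w(3)] v(1) w(1) by simp
      then show "a \<oplus> b \<in> I n" unfolding I_def using v w Fn(3) by auto
    next
      fix r a assume r: "r \<in> carrier R" and "a \<in> I n"
      then obtain v where v: "a \<in> carrier R" "v \<in> F" "h a \<otimes>\<^sub>S g \<oplus>\<^sub>S v \<in> M n" unfolding I_def by auto
      have "h r \<otimes>\<^sub>S (h a \<otimes>\<^sub>S g \<oplus>\<^sub>S v) = (h r \<otimes>\<^sub>S h a) \<otimes>\<^sub>S g \<oplus>\<^sub>S h r \<otimes>\<^sub>S v"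
        using g hom_closed[OF v(1)] hom_closed[OF r] Fn(1)[OF v(2)] by algebra
      then have "h (r \<otimes> a) \<otimes>\<^sub>S g \<oplus>\<^sub>S h r \<otimes>\<^sub>S v \<in> M n" using Mn(4)[OF r v(3)] v(1) r by simp
      then show "r \<otimes> a \<in> I n" unfolding I_def using v r Fn(4) by auto
    qed
    show "I n \<subseteq> I (Suc n)" unfolding I_def using Cons.prems(4)[of n] by auto
  qed
  then obtain N2 where N2: "\<And>n. n \<ge> N2 \<Longrightarrow> I n = I N2" by auto
  define N where "N = max N1 N2"
  have "M n \<subseteq> M N" if n: "n \<ge> N" for n
  proof
    fix a assume a: "a \<in> M n"
    then have "a \<in> fspan (carrier R) (g # gs)" using Cons.prems(3) by auto
    then obtain c v where cv: "c \<in> carrier R" "v \<in> F" "a = h c \<otimes>\<^sub>S g \<oplus>\<^sub>S v"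
      unfolding F_def by (rule fspan_ConsE)
    have "c \<in> I n" unfolding I_def using cv a by auto
    then have "c \<in> I N" using N2[of n] N2[of N] n unfolding N_def by auto
    then obtain w where w: "w \<in> F" "h c \<otimes>\<^sub>S g \<oplus>\<^sub>S w \<in> M N" unfolding I_def by auto
    define b where "b = h c \<otimes>\<^sub>S g \<oplus>\<^sub>S w"
    have bN: "b \<in> M N" using w b_def by simp
    have car: "v \<in> carrier S" "w \<in> carrier S" "h c \<in> carrier S" "b \<in> carrier S" "a \<in> carrier S"
      using submod_closed(1)[OF F] cv(1,2) w(1) submod_closed(1)[OF Cons.prems(2)] bN a by auto
    have "a \<ominus>\<^sub>S b = v \<ominus>\<^sub>S w" unfolding cv(3) b_def using car g by algebra
    then have "a \<ominus>\<^sub>S b \<in> F" using submod_minus[OF F cv(2) w(1)] by simp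
    moreover have "a \<ominus>\<^sub>S b \<in> M n"
      using submod_minus[OF Cons.prems(2) a, of b] bN mono[OF n] by auto
    ultimately have "a \<ominus>\<^sub>S b \<in> M n \<inter> F" by simp
    then have "a \<ominus>\<^sub>S b \<in> M N" using N1[of n] N1[of N] n unfolding N_def by auto
    then have "(a \<ominus>\<^sub>S b) \<oplus>\<^sub>S b \<in> M N" using submod_closed(3)[OF Cons.prems(2)] bN by simp
    moreover have "(a \<ominus>\<^sub>S b) \<oplus>\<^sub>S b = a" using car by algebra
    ultimately show "a \<in> M N" by simp
  qed
  then show ?case using mono by (metis subset_antisym)
qed

text \<open>The powers below n are listed with the highest first, so that the head of the list is
  the leading term and \<open>pows s (Suc n)\<close> extends \<open>pows s n\<close>.\<close>

definition pows :: "'c \<Rightarrow> nat \<Rightarrow> 'c list" where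
  "pows s n = map (\<lambda>i. s [^]\<^sub>S i) (rev [0..<n])"

lemma pows_simps [simp]: "pows s 0 = []" "pows s (Suc n) = s [^]\<^sub>S n # pows s n"
  by (simp_all add: pows_def)

lemma set_pows: "set (pows s n) = (\<lambda>i. s [^]\<^sub>S i) ` {..<n}"
  by (auto simp: pows_def)

lemma pows_carrier: "s \<in> carrier S \<Longrightarrow> set (pows s n) \<subseteq> carrier S"
  by (auto simp: set_pows)

lemma fspan_pows_mono:
  assumes "ideal I R" "s \<in> carrier S" "n \<le> m"
  shows "fspan I (pows s n) \<subseteq> fspan I (pows s m)"
  using assms(3)
proof (induction m rule: dec_induct)
  case (step m)
  have "fspan I (pows s m) \<subseteq> fspan I (s [^]\<^sub>S m # pows s m)"
    by (rule fspan_subset_Cons[OF assms(1)]) (use pows_carrier[OF assms(2)] assms(2) in auto)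
  with step(3) show ?case by auto
qed simp

text \<open>The spans of 1, s, ..., s^(n-1) ascend inside a Noetherian module; where they stop, the
  next power of s is a combination of the earlier ones.\<close>

lemma exists_integral_equation:
  assumes noeth: "noetherian_ring R" and gs: "set gs \<subseteq> carrier S" "carrier S \<subseteq> fspan (carrier R) gs"
    and s: "s \<in> carrier S"
  shows "\<exists>n. s [^]\<^sub>S n \<in> fspan (carrier R) (pows s n)"
proof -
  note pc = pows_carrier[OF s]
  have "\<exists>N. \<forall>n\<ge>N. fspan (carrier R) (pows s n) = fspan (carrier R) (pows s N)"
  proof (rule ascending_submods_stationary[OF noeth gs(1)])
    fix n
    show "submod (fspan (carrier R) (pows s n))" by (rule submod_fspan[OF pc R.oneideal])
    show "fspan (carrier R) (pows s n) \<subseteq> fspan (carrier R) gs"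
      using fspan_carrier[OF subset_refl pc] gs(2) by auto
    show "fspan (carrier R) (pows s n) \<subseteq> fspan (carrier R) (pows s (Suc n))"
      by (rule fspan_pows_mono[OF R.oneideal s]) simp
  qed
  then obtain N where "fspan (carrier R) (pows s (Suc N)) = fspan (carrier R) (pows s N)"
    by (metis le_SucI order_refl)
  moreover have "s [^]\<^sub>S N \<in> fspan (carrier R) (pows s (Suc N))"
    by (rule fspan_gen_carrier[OF pc]) (simp add: set_pows)
  ultimately show ?thesis by auto
qed

text \<open>Incomparability. For x in J but not in P, no monic expression x^n + v with v of lower
  degree lies in P. Indeed, if x^(n+1) + hc + xw is in P, then hc is in J, so hc = 0, and x cancels
  because P is prime, leaving x^n + w in P. An integral equation of x allows v = -x^n, which would
  put zero outside P.\<close>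

lemma primeideal_subset_imp_eq:
  assumes P: "primeideal P S" and J: "ideal J S" "P \<subseteq> J"
    and contr: "\<And>c. c \<in> carrier R \<Longrightarrow> h c \<in> J \<Longrightarrow> h c = \<zero>\<^sub>S"
    and int: "\<And>x. x \<in> carrier S \<Longrightarrow> \<exists>n. x [^]\<^sub>S n \<in> fspan (carrier R) (pows x n)"
  shows "J = P"
proof -
  note Pi = primeideal.axioms(1)[OF P]
  have "x \<in> P" if x: "x \<in> J" for x
  proof (rule ccontr)
    assume xP: "x \<notin> P"
    have xc: "x \<in> carrier S" by (rule S.ideal_closed(1)[OF J(1) x])
    note pc = pows_carrier[OF xc]
    have step: "x [^]\<^sub>S n \<oplus>\<^sub>S v \<notin> P" if "v \<in> fspan (carrier R) (pows x n)" for n v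
      using that
    proof (induction n arbitrary: v)
      case 0
      then show ?case using S.primeideal_one_notin[OF P] by simp
    next
      case (Suc n)
      \<comment> \<open>The constant term is separated: v = hc + xw, with w in the span of one power
        fewer.\<close>
      have split: "\<exists>c w. c \<in> carrier R \<and> w \<in> fspan (carrier R) (pows x k) \<and> v = h c \<oplus>\<^sub>S x \<otimes>\<^sub>S w"
        if "v \<in> fspan (carrier R) (pows x (Suc k))" for v k
        using that
      proof (induction k arbitrary: v)
        case 0
        then obtain c where "c \<in> carrier R" "v = h c" by auto
        then show ?case using xc by (intro exI[of _ c] exI[of _ "\<zero>\<^sub>S"]) auto
      next
        case (Suc k)
        obtain d u where d: "d \<in> carrier R" "u \<in> fspan (carrier R) (pows x (Suc k))"
          "v = h d \<otimes>\<^sub>S x [^]\<^sub>S (Suc k) \<oplus>\<^sub>S u"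
          using Suc.prems by (subst (asm) (1) pows_simps(2)) (rule fspan_ConsE)
        obtain c w where c: "c \<in> carrier R" "w \<in> fspan (carrier R) (pows x k)" "u = h c \<oplus>\<^sub>S x \<otimes>\<^sub>S w"
          using Suc.IH[OF d(2)] by auto
        have wc: "w \<in> carrier S" using c(2) fspan_carrier[OF subset_refl pc] by auto
        have "v = h d \<otimes>\<^sub>S (x [^]\<^sub>S k \<otimes>\<^sub>S x) \<oplus>\<^sub>S (h c \<oplus>\<^sub>S x \<otimes>\<^sub>S w)" using d(3) c(3) by simp
        also have "\<dots> = h c \<oplus>\<^sub>S x \<otimes>\<^sub>S (h d \<otimes>\<^sub>S x [^]\<^sub>S k \<oplus>\<^sub>S w)"
          using hom_closed[OF d(1)] hom_closed[OF c(1)] xc wc S.nat_pow_closed[OF xc, of k] by algebra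
        finally show ?case using fspan_ConsI[OF d(1) c(2), of "x [^]\<^sub>S k"] c(1) by auto
      qed
      obtain c w where c: "c \<in> carrier R" "w \<in> fspan (carrier R) (pows x n)" "v = h c \<oplus>\<^sub>S x \<otimes>\<^sub>S w"
        using split[OF Suc.prems] by auto
      have wc: "w \<in> carrier S" using c(2) fspan_carrier[OF subset_refl pc] by auto
      note xn = S.nat_pow_closed[OF xc, of n]
      have eq: "x [^]\<^sub>S Suc n \<oplus>\<^sub>S v = x \<otimes>\<^sub>S (x [^]\<^sub>S n \<oplus>\<^sub>S w) \<oplus>\<^sub>S h c"
        unfolding c(3) S.nat_pow_Suc using hom_closed[OF c(1)] xc wc xn by algebra
      show ?case
      proof
        assume mem: "x [^]\<^sub>S Suc n \<oplus>\<^sub>S v \<in> P"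
        have xw: "x \<otimes>\<^sub>S (x [^]\<^sub>S n \<oplus>\<^sub>S w) \<in> J"
          by (rule S.ideal_closed(6)[OF J(1) x]) (use xn wc in auto)
        have "h c \<in> J"
          by (rule S.ideal_cancel_add[OF J(1) _ xw]) (use mem eq J(2) c(1) in auto)
        then have "h c = \<zero>\<^sub>S" by (rule contr[OF c(1)])
        then have "x \<otimes>\<^sub>S (x [^]\<^sub>S n \<oplus>\<^sub>S w) \<in> P" using mem eq xc wc xn by simp
        then have "x [^]\<^sub>S n \<oplus>\<^sub>S w \<in> P"
          using primeideal.I_prime[OF P xc, of "x [^]\<^sub>S n \<oplus>\<^sub>S w"] xP xn wc by auto
        then show False using Suc.IH[OF c(2)] by simp
      qed
    qed
    obtain n where n: "x [^]\<^sub>S n \<in> fspan (carrier R) (pows x n)" using int[OF xc] by auto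
    have "x [^]\<^sub>S n \<oplus>\<^sub>S \<ominus>\<^sub>S (x [^]\<^sub>S n) \<notin> P" by (rule step[OF fspan_neg[OF R.oneideal pc n]])
    then show False using S.r_neg[OF S.nat_pow_closed[OF xc]] S.ideal_closed(2)[OF Pi] by simp
  qed
  then show ?thesis using J(2) by auto
qed

end

section \<open>Integral elements over a complete local ring\<close>

primrec (in ring) psum :: "(nat \<Rightarrow> 'a) \<Rightarrow> nat \<Rightarrow> 'a" where
  "psum f 0 = \<zero>"
| "psum f (Suc k) = psum f k \<oplus> f k"

lemma (in ring) psum_closed: "(\<And>k. f k \<in> carrier R) \<Longrightarrow> psum f k \<in> carrier R"
  by (induction k) auto

locale complete_local_ring = noetherian_cring R for R (structure) +
  assumes local: "local_ring R" and complete: "madic_complete R"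
begin

abbreviation "\<mm> \<equiv> max_ideal R"
abbreviation "mp k \<equiv> ideal_pow R \<mm> k"

lemma m_maximal: "maximalideal \<mm> R" by (rule maximalideal_max_ideal[OF local])
lemma m_ideal: "ideal \<mm> R" by (rule maximalideal.axioms(1)[OF m_maximal])
lemma mp_ideal: "ideal (mp k) R" by (rule ideal_pow_ideal[OF m_ideal])

lemma mp_decreasing: "k \<le> l \<Longrightarrow> mp l \<subseteq> mp k"
proof (induction l rule: dec_induct)
  case (step l)
  then show ?case using ideal_pow_Suc_subset[OF m_ideal, of l] by auto
qed simp

lemma mp_Suc_subset_m: "mp (Suc k) \<subseteq> \<mm>"
  using ideal_prod_inter[OF m_ideal mp_ideal] by auto

lemma mp_one: "mp (Suc 0) = \<mm>"
  using ideal_prod_one[OF m_ideal] by simp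

lemma mp_Inter: "(\<And>k. a \<in> mp k) \<Longrightarrow> a = \<zero>"
  using complete unfolding madic_complete_def by auto

text \<open>\<open>psum c k\<close> stops before the term c k, so all later partial sums agree with
  it modulo m^k. Comparison with one late partial sum transfers this to the limit, which gives the
  explicit rate that is used coefficientwise below.\<close>

lemma series_converges:
  assumes c: "\<And>k. c k \<in> mp k"
  shows "\<exists>l\<in>carrier R. \<forall>k. l \<ominus> psum c k \<in> mp k"
proof -
  have cc: "c k \<in> carrier R" for k by (rule ideal_closed(1)[OF mp_ideal c])
  note pc = psum_closed[of c, OF cc]
  have tail: "psum c p \<ominus> psum c k \<in> mp k" if "k \<le> p" for p k
    using that
  proof (induction p rule: dec_induct)
    case base
    then show ?case using pc ideal_closed(2)[OF mp_ideal] by (simp add: a_minus_def r_neg)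
  next
    case (step p)
    have "psum c (Suc p) \<ominus> psum c k = (psum c p \<ominus> psum c k) \<oplus> c p"
      unfolding psum.simps using pc[of p] pc[of k] cc[of p] by algebra
    moreover have "c p \<in> mp k" using c[of p] mp_decreasing[of k p] step(1) by auto
    ultimately show ?case using ideal_closed(3)[OF mp_ideal] step(3) by simp
  qed
  have "psum c p \<ominus> psum c q \<in> mp k" if "p \<ge> k" "q \<ge> k" for p q k
  proof -
    have "psum c p \<ominus> psum c q = (psum c p \<ominus> psum c k) \<ominus> (psum c q \<ominus> psum c k)"
      using pc[of p] pc[of k] pc[of q] by algebra
    then show ?thesis using ideal_minus[OF mp_ideal tail[OF that(1)] tail[OF that(2)]] by simp
  qed
  then have "\<forall>k. \<exists>N. \<forall>p\<ge>N. \<forall>q\<ge>N. psum c p \<ominus> psum c q \<in> mp k" by auto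
  then obtain l where l: "l \<in> carrier R" "\<And>k. \<exists>N. \<forall>n\<ge>N. psum c n \<ominus> l \<in> mp k"
    using complete pc unfolding madic_complete_def by metis
  have "l \<ominus> psum c k \<in> mp k" for k
  proof -
    obtain N where N: "\<forall>n\<ge>N. psum c n \<ominus> l \<in> mp k" using l(2) by auto
    define n where "n = max N k"
    have "l \<ominus> psum c k = (psum c n \<ominus> psum c k) \<ominus> (psum c n \<ominus> l)"
      using pc[of n] pc[of k] l(1) by algebra
    moreover have "psum c n \<ominus> l \<in> mp k" using N unfolding n_def by auto
    ultimately show ?thesis using ideal_minus[OF mp_ideal tail[of k n]] unfolding n_def by simp
  qed
  then show ?thesis using l(1) by auto
qed

end

section \<open>The subring generated by one integral element\<close>

locale integral_element = ring_hom_cring R S h for R (structure) and S (structure) and h +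
  fixes s and N :: nat
  assumes s_closed: "s \<in> carrier S"
    and integral_eq: "s [^]\<^sub>S N \<in> fspan (carrier R) (pows s N)"
begin

text \<open>The extension of the ideal \<open>I\<close> to the subring generated by \<open>s\<close> over \<open>R\<close>.\<close>

definition ext :: "'a set \<Rightarrow> 'c set" where
  "ext I = fspan I (pows s N)"

lemma pow_mem_pows: "i < n \<Longrightarrow> x [^]\<^sub>S i \<in> set (pows x n)"
  unfolding set_pows by (rule imageI) simp

lemmas pws = pows_carrier[OF s_closed]

lemma ext_carrier: "ideal I R \<Longrightarrow> a \<in> ext I \<Longrightarrow> a \<in> carrier S"
  unfolding ext_def using fspan_carrier[OF R.ideal_subset_carrier pws] by auto

lemma ext_zero: "ideal I R \<Longrightarrow> \<zero>\<^sub>S \<in> ext I"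
  unfolding ext_def by (rule fspan_zero[OF _ pws])

lemma ext_add: "ideal I R \<Longrightarrow> a \<in> ext I \<Longrightarrow> b \<in> ext I \<Longrightarrow> a \<oplus>\<^sub>S b \<in> ext I"
  unfolding ext_def by (rule fspan_add[OF _ pws])

lemma ext_neg: "ideal I R \<Longrightarrow> a \<in> ext I \<Longrightarrow> \<ominus>\<^sub>S a \<in> ext I"
  unfolding ext_def by (rule fspan_neg[OF _ pws])

lemma ext_minus: "ideal I R \<Longrightarrow> a \<in> ext I \<Longrightarrow> b \<in> ext I \<Longrightarrow> a \<ominus>\<^sub>S b \<in> ext I"
  unfolding ext_def by (rule fspan_minus[OF _ pws])

lemma ext_mono: "I \<subseteq> K \<Longrightarrow> ext I \<subseteq> ext K"
  unfolding ext_def by (rule fspan_mono)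

lemma ext_subset: "ideal I R \<Longrightarrow> ext I \<subseteq> ext (carrier R)"
  by (rule ext_mono[OF R.ideal_subset_carrier])

lemma pow_mem_ext: "s [^]\<^sub>S (j::nat) \<in> ext (carrier R)"
proof (induction j)
  case 0
  show ?case
  proof (cases "N = 0")
    \<comment> \<open>The empty list spans only zero, and \<open>integral_eq\<close> is then
      literally the goal.\<close>
    case True
    then show ?thesis using integral_eq unfolding ext_def by simp
  next
    case False
    then show ?thesis unfolding ext_def by (intro fspan_gen_carrier[OF pws] pow_mem_pows) simp
  qed
next
  case (Suc j)
  have "s \<otimes>\<^sub>S (s [^]\<^sub>S j) \<in> ext (carrier R)"
    unfolding ext_def
  proof (rule fspan_mult[OF R.oneideal R.oneideal R.oneideal pws pws s_closed])
    fix g assume "g \<in> set (pows s N)"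
    then obtain i where i: "i < N" "g = s [^]\<^sub>S i" by (auto simp: set_pows)
    have "s \<otimes>\<^sub>S g = s [^]\<^sub>S Suc i" using i s_closed by (simp add: S.m_comm)
    moreover have "s [^]\<^sub>S Suc i \<in> fspan (carrier R) (pows s N)"
    proof (cases "Suc i = N")
      case True
      then show ?thesis using integral_eq by simp
    next
      case False
      show ?thesis by (rule fspan_gen_carrier[OF pws pow_mem_pows]) (use i False in simp)
    qed
    ultimately show "s \<otimes>\<^sub>S g \<in> fspan (carrier R) (pows s N)" by simp
  qed (use Suc in \<open>auto simp: ext_def\<close>)
  then show ?case using s_closed by (simp add: S.m_comm)
qed

lemma one_mem_ext: "\<one>\<^sub>S \<in> ext (carrier R)"
  using pow_mem_ext[of 0] by simp

lemma s_mem_ext: "s \<in> ext (carrier R)"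
  using pow_mem_ext[of 1] s_closed by simp

lemma hom_mem_ext:
  assumes "ideal I R" "c \<in> I"
  shows "h c \<in> ext I"
proof -
  have cc: "c \<in> carrier R" by (rule R.ideal_closed(1)[OF assms])
  have "h c \<otimes>\<^sub>S \<one>\<^sub>S \<in> ext I"
    unfolding ext_def
    by (rule fspan_smult[OF subset_refl pws cc R.ideal_closed(6)[OF assms]])
      (use one_mem_ext in \<open>auto simp: ext_def\<close>)
  then show ?thesis using cc by simp
qed

lemma ext_mult:
  assumes I: "ideal I R" and I': "ideal I' R" and K: "ideal K R"
    and prod: "\<And>c a. c \<in> I' \<Longrightarrow> a \<in> I \<Longrightarrow> c \<otimes> a \<in> K"
    and v: "v \<in> ext I" and w: "w \<in> ext I'"
  shows "v \<otimes>\<^sub>S w \<in> ext K"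
proof -
  have vc: "v \<in> carrier S" by (rule ext_carrier[OF I v])
  have vs: "v \<otimes>\<^sub>S s [^]\<^sub>S j \<in> ext I" for j :: nat
  proof -
    have "s [^]\<^sub>S j \<otimes>\<^sub>S v \<in> ext I"
      unfolding ext_def
    proof (rule fspan_mult[OF R.oneideal I I pws pws])
      fix g assume "g \<in> set (pows s N)"
      then obtain i :: nat where "g = s [^]\<^sub>S i" by (auto simp: set_pows)
      then have "s [^]\<^sub>S j \<otimes>\<^sub>S g = s [^]\<^sub>S (j + i)" using s_closed by (simp add: S.nat_pow_mult)
      then show "s [^]\<^sub>S j \<otimes>\<^sub>S g \<in> fspan (carrier R) (pows s N)"
        using pow_mem_ext unfolding ext_def by simp
    qed (use v s_closed R.ideal_closed(6)[OF I] in \<open>auto simp: ext_def\<close>)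
    then show ?thesis using vc s_closed by (simp add: S.m_comm)
  qed
  show ?thesis
    unfolding ext_def
    by (rule fspan_mult[OF I I' K pws pws vc _ prod])
      (use vs w in \<open>auto simp: ext_def set_pows\<close>)
qed

lemma ext_mult_carrier:
  assumes "ideal I R" "v \<in> ext I" "b \<in> ext (carrier R)"
  shows "v \<otimes>\<^sub>S b \<in> ext I" "b \<otimes>\<^sub>S v \<in> ext I"
  by (rule ext_mult[OF assms(1) R.oneideal assms(1) R.ideal_closed(5)[OF assms(1)] assms(2,3)], assumption+)
    (rule ext_mult[OF R.oneideal assms(1) assms(1) R.ideal_closed(6)[OF assms(1)] assms(3,2)], assumption+)

end

locale complete_integral_element =
  integral_element R S h s N + complete_local_ring R + S: domain S
  for R (structure) and S (structure) and h s N +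
  assumes inj: "inj_on h (carrier R)"
begin

lemma hom_eq_zero: "c \<in> carrier R \<Longrightarrow> h c = \<zero>\<^sub>S \<Longrightarrow> c = \<zero>"
  using inj hom_zero R.zero_closed unfolding inj_on_def by metis

text \<open>Coefficients of v k are chosen inside m^k for each k separately; they need not be
  unique. Their series converge in R, and the combination of the limits is a limit for v.\<close>

lemma fspan_series_converges:
  assumes "set gs \<subseteq> carrier S" "\<And>k. v k \<in> fspan (mp k) gs"
  shows "\<exists>l\<in>fspan (carrier R) gs. \<forall>k. l \<ominus>\<^sub>S S.psum v k \<in> fspan (mp k) gs"
  using assms
proof (induction gs arbitrary: v)
  case Nil
  have "S.psum v k = \<zero>\<^sub>S" for k by (induction k) (use Nil in auto)
  then show ?case by (simp add: a_minus_def)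
next
  case (Cons g gs)
  have gs: "set gs \<subseteq> carrier S" "g \<in> carrier S" using Cons.prems(1) by auto
  have "\<forall>k. \<exists>c w. c \<in> mp k \<and> w \<in> fspan (mp k) gs \<and> v k = h c \<otimes>\<^sub>S g \<oplus>\<^sub>S w"
    using Cons.prems(2) by (metis fspan_ConsE)
  then obtain c w where cw: "\<And>k. c k \<in> mp k" "\<And>k. w k \<in> fspan (mp k) gs"
    "\<And>k. v k = h (c k) \<otimes>\<^sub>S g \<oplus>\<^sub>S w k" by metis
  have cc: "c k \<in> carrier R" for k by (rule R.ideal_closed(1)[OF mp_ideal cw(1)])
  have wc: "w k \<in> carrier S" for k
    using fspan_carrier[OF R.ideal_subset_carrier[OF mp_ideal] gs(1)] cw(2) by auto
  note pc = R.psum_closed[of c, OF cc] and pw = S.psum_closed[of w, OF wc]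
  obtain l where l: "l \<in> carrier R" "\<And>k. l \<ominus> R.psum c k \<in> mp k"
    using series_converges[of c, OF cw(1)] by auto
  obtain l' where l': "l' \<in> fspan (carrier R) gs" "\<And>k. l' \<ominus>\<^sub>S S.psum w k \<in> fspan (mp k) gs"
    using Cons.IH[OF gs(1) cw(2)] by auto
  have l'c: "l' \<in> carrier S" using l'(1) fspan_carrier[OF subset_refl gs(1)] by auto
  have psum: "S.psum v k = h (R.psum c k) \<otimes>\<^sub>S g \<oplus>\<^sub>S S.psum w k" for k
  proof (induction k)
    case 0
    then show ?case using gs by simp
  next
    case (Suc k)
    have "S.psum v (Suc k) = (h (R.psum c k) \<otimes>\<^sub>S g \<oplus>\<^sub>S S.psum w k) \<oplus>\<^sub>S (h (c k) \<otimes>\<^sub>S g \<oplus>\<^sub>S w k)"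
      using Suc cw(3)[of k] by simp
    also have "\<dots> = (h (R.psum c k) \<oplus>\<^sub>S h (c k)) \<otimes>\<^sub>S g \<oplus>\<^sub>S (S.psum w k \<oplus>\<^sub>S w k)"
      using hom_closed[OF pc[of k]] hom_closed[OF cc[of k]] wc[of k] pw[of k] gs(2) by algebra
    finally show ?case using pc cc by simp
  qed
  show ?case
  proof (intro bexI[of _ "h l \<otimes>\<^sub>S g \<oplus>\<^sub>S l'"] allI)
    fix k
    have "(h l \<otimes>\<^sub>S g \<oplus>\<^sub>S l') \<ominus>\<^sub>S S.psum v k
        = (h l \<ominus>\<^sub>S h (R.psum c k)) \<otimes>\<^sub>S g \<oplus>\<^sub>S (l' \<ominus>\<^sub>S S.psum w k)"
      unfolding psum using hom_closed[OF pc[of k]] hom_closed[OF l(1)] l'c pw[of k] gs(2) by algebra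
    also have "h l \<ominus>\<^sub>S h (R.psum c k) = h (l \<ominus> R.psum c k)"
      using l(1) pc by (simp add: a_minus_def)
    also have "h (l \<ominus> R.psum c k) \<otimes>\<^sub>S g \<oplus>\<^sub>S (l' \<ominus>\<^sub>S S.psum w k) \<in> fspan (mp k) (g # gs)"
      by (rule fspan_ConsI[OF l(2) l'(2)])
    finally show "(h l \<otimes>\<^sub>S g \<oplus>\<^sub>S l') \<ominus>\<^sub>S S.psum v k \<in> fspan (mp k) (g # gs)" .
  qed (rule fspan_ConsI[OF l(1) l'(1)])
qed

text \<open>A relation \<open>h b \<cdot> s\<^sup>q \<in> span(1, \<dots>, s\<^sup>q\<^sup>-\<^sup>1)\<close> with \<open>b \<noteq> 0\<close> of minimal degree makes
  \<open>1, \<dots>, s\<^sup>q\<^sup>-\<^sup>1\<close> independent, and a power of \<open>b\<close> multiplies \<open>R[s]\<close> into their span;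
  separatedness is thereby inherited from \<open>R\<close>.\<close>

lemma ext_mp_Inter:
  assumes z: "\<And>k. z \<in> ext (mp k)"
  shows "z = \<zero>\<^sub>S"
proof -
  define rel where "rel q = (\<exists>b\<in>carrier R. b \<noteq> \<zero> \<and> h b \<otimes>\<^sub>S s [^]\<^sub>S q \<in> fspan (carrier R) (pows s q))" for q :: nat
  have "\<one> \<noteq> \<zero>" using hom_one hom_zero S.one_not_zero by metis
  then have "rel N" unfolding rel_def using integral_eq s_closed by (intro bexI[of _ \<one>]) auto
  then have relq: "rel (LEAST q. rel q)" by (rule LeastI)
  define q where "q = (LEAST q. rel q)"
  have least: "\<not> rel j" if "j < q" for j using not_less_Least that unfolding q_def by auto
  obtain b where b: "b \<in> carrier R" "b \<noteq> \<zero>" "h b \<otimes>\<^sub>S s [^]\<^sub>S q \<in> fspan (carrier R) (pows s q)"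
    using relq unfolding rel_def q_def by auto
  note hb = hom_closed[OF b(1)]
  have hb0: "h b \<noteq> \<zero>\<^sub>S" using hom_eq_zero b(1,2) by auto
  \<comment> \<open>For q = 0 the relation would say h b = 0.\<close>
  have "q \<noteq> 0" using b(3) hb hb0 by (cases q) auto
  \<comment> \<open>Multiplication by t = hb s keeps the span of 1, ..., s^(q-1): it sends s^i to hb
    s^(i+1), and at the top the relation for b applies.\<close>
  define t where "t = h b \<otimes>\<^sub>S s"
  have tc: "t \<in> carrier S" unfolding t_def using hb s_closed by simp
  have t_pow: "t [^]\<^sub>S j \<in> fspan (carrier R) (pows s q)" for j :: nat
  proof (induction j)
    case 0
    show ?case using fspan_gen_carrier[OF pws[of q] pow_mem_pows[of 0 q s]] \<open>q \<noteq> 0\<close> by simp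
  next
    case (Suc j)
    have "t \<otimes>\<^sub>S t [^]\<^sub>S j \<in> fspan (carrier R) (pows s q)"
    proof (rule fspan_mult[OF R.oneideal R.oneideal R.oneideal pws pws tc _ _ Suc])
      fix g assume "g \<in> set (pows s q)"
      then obtain i where i: "i < q" "g = s [^]\<^sub>S i" by (auto simp: set_pows)
      have eq: "t \<otimes>\<^sub>S g = h b \<otimes>\<^sub>S s [^]\<^sub>S Suc i"
        unfolding t_def i(2) S.nat_pow_Suc using hb s_closed S.nat_pow_closed[OF s_closed, of i] by algebra
      show "t \<otimes>\<^sub>S g \<in> fspan (carrier R) (pows s q)"
      proof (cases "Suc i = q")
        case True
        then show ?thesis using b(3) eq by simp
      next
        case False
        then show ?thesis unfolding eq using i(1)
          by (intro fspan_gen[OF R.oneideal pws b(1)] pow_mem_pows) (use False in simp)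
      qed
    qed auto
    then show ?case using tc by (simp add: S.m_comm)
  qed
  \<comment> \<open>The exponent N serves all generators at once: (hb)^N s^i = (hb)^(N-i) t^i for
    every i < N.\<close>
  define x where "x = h b [^]\<^sub>S N"
  have xc: "x \<in> carrier S" unfolding x_def using hb by simp
  have xz: "x \<otimes>\<^sub>S z \<in> fspan (mp k) (pows s q)" for k
  proof (rule fspan_mult[OF R.oneideal mp_ideal mp_ideal pws pws xc])
    show "z \<in> fspan (mp k) (pows s N)" using z unfolding ext_def by simp
    fix g assume "g \<in> set (pows s N)"
    then obtain i where i: "i < N" "g = s [^]\<^sub>S i" by (auto simp: set_pows)
    have "x = h b [^]\<^sub>S (N - i) \<otimes>\<^sub>S h b [^]\<^sub>S i"
      unfolding x_def using i(1) hb by (simp add: S.nat_pow_mult)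
    then have "x \<otimes>\<^sub>S g = h b [^]\<^sub>S (N - i) \<otimes>\<^sub>S (h b [^]\<^sub>S i \<otimes>\<^sub>S s [^]\<^sub>S i)"
      using i hb s_closed by (simp add: S.m_assoc)
    also have "h b [^]\<^sub>S i \<otimes>\<^sub>S s [^]\<^sub>S i = t [^]\<^sub>S i"
      unfolding t_def using hb s_closed by (simp add: S.nat_pow_distrib)
    also have "h b [^]\<^sub>S (N - i) = h (b [^] (N - i))" using b(1) by (simp add: hom_pow)
    finally show "x \<otimes>\<^sub>S g \<in> fspan (carrier R) (pows s q)"
      using fspan_smult_ideal[OF R.oneideal pws R.nat_pow_closed[OF b(1)] t_pow, of "N - i" i] by metis
  qed (rule R.ideal_closed(6)[OF mp_ideal])
  \<comment> \<open>Below degree q the powers of s are independent by minimality of q, so the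
    leading coefficient of y does not depend on k. It therefore lies in every power of m and
    vanishes, and y drops to degree j - 1.\<close>
  have "y = \<zero>\<^sub>S" if "j \<le> q" "\<And>k. y \<in> fspan (mp k) (pows s j)" for j y
    using that
  proof (induction j)
    case 0
    then show ?case by simp
  next
    case (Suc j)
    have "\<forall>k. \<exists>c w. c \<in> mp k \<and> w \<in> fspan (mp k) (pows s j) \<and> y = h c \<otimes>\<^sub>S s [^]\<^sub>S j \<oplus>\<^sub>S w"
      using Suc.prems(2) unfolding pows_simps by (metis fspan_ConsE)
    then obtain c w where cw: "\<And>k. c k \<in> mp k" "\<And>k. w k \<in> fspan (mp k) (pows s j)"
      "\<And>k. y = h (c k) \<otimes>\<^sub>S s [^]\<^sub>S j \<oplus>\<^sub>S w k" by metis
    have cc: "c k \<in> carrier R" for k by (rule R.ideal_closed(1)[OF mp_ideal cw(1)])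
    have wR: "w k \<in> fspan (carrier R) (pows s j)" for k
      using cw(2) fspan_mono[OF R.ideal_subset_carrier[OF mp_ideal]] by auto
    have wc: "w k \<in> carrier S" for k using wR fspan_carrier[OF subset_refl pws] by auto
    note sj = S.nat_pow_closed[OF s_closed, of j]
    have "c k = c 0" for k
    proof -
      have "h (c k \<ominus> c 0) \<otimes>\<^sub>S s [^]\<^sub>S j = (h (c k) \<ominus>\<^sub>S h (c 0)) \<otimes>\<^sub>S s [^]\<^sub>S j"
        using cc by (simp add: a_minus_def)
      also have "\<dots> = ((h (c k) \<otimes>\<^sub>S s [^]\<^sub>S j \<oplus>\<^sub>S w k) \<ominus>\<^sub>S (h (c 0) \<otimes>\<^sub>S s [^]\<^sub>S j \<oplus>\<^sub>S w 0)) \<oplus>\<^sub>S (w 0 \<ominus>\<^sub>S w k)"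
        using hom_closed[OF cc[of k]] hom_closed[OF cc[of 0]] sj wc[of 0] wc[of k] by algebra
      also have "\<dots> = (y \<ominus>\<^sub>S y) \<oplus>\<^sub>S (w 0 \<ominus>\<^sub>S w k)" using cw(3)[of k] cw(3)[of 0] by simp
      also have "\<dots> = w 0 \<ominus>\<^sub>S w k"
      proof -
        have "y \<in> carrier S" using cw(3)[of 0] sj wc cc by simp
        then show ?thesis using wc[of 0] wc[of k] by algebra
      qed
      also have "\<dots> \<in> fspan (carrier R) (pows s j)" by (rule fspan_minus[OF R.oneideal pws wR wR])
      finally have "h (c k \<ominus> c 0) \<otimes>\<^sub>S s [^]\<^sub>S j \<in> fspan (carrier R) (pows s j)" .
      moreover have "c k \<ominus> c 0 \<in> carrier R" using cc by simp
      moreover have "\<not> rel j" using least Suc.prems(1) by simp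
      ultimately have "c k \<ominus> c 0 = \<zero>" unfolding rel_def by metis
      then show ?thesis using cc by simp
    qed
    then have c0: "c k = c 0" for k .
    then have "c 0 \<in> mp k" for k using cw(1)[of k] by metis
    then have "c 0 = \<zero>" by (rule mp_Inter)
    then have "y = w k" for k using cw(3)[of k] c0[of k] wc sj by simp
    then have "y \<in> fspan (mp k) (pows s j)" for k using cw(2) by metis
    then show ?case using Suc by simp
  qed
  from this[OF order_refl xz] have "x \<otimes>\<^sub>S z = \<zero>\<^sub>S" .
  moreover have "x \<noteq> \<zero>\<^sub>S"
    using S.primeideal_pow[OF S.zeroprimeideal hb, of N] hb0 unfolding x_def by auto
  ultimately show ?thesis using S.integral_iff xc ext_carrier[OF mp_ideal z] by auto
qed

text \<open>Newton iteration lifts f to an exact idempotent g of R[s] congruent to f modulo m: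
  convergence comes from completeness, exactness from separatedness. In a domain g is 0 or
  1.\<close>

lemma idempotent_mod_max_ideal:
  assumes f: "f \<in> ext (carrier R)" and idem: "f \<otimes>\<^sub>S f \<ominus>\<^sub>S f \<in> ext \<mm>"
  shows "f \<in> ext \<mm> \<or> \<one>\<^sub>S \<ominus>\<^sub>S f \<in> ext \<mm>"
proof -
  define W where "W x = x \<otimes>\<^sub>S x \<ominus>\<^sub>S x" for x
  \<comment> \<open>The Newton step for x^2 - x. The derivative 2x - 1 has square 1 + 4(x^2 - x), so
    it is its own inverse modulo x^2 - x, and the division becomes a multiplication.\<close>
  define F where "F x = x \<ominus>\<^sub>S W x \<otimes>\<^sub>S (x \<oplus>\<^sub>S x \<ominus>\<^sub>S \<one>\<^sub>S)" for x
  define e where "e k = (F ^^ k) f" for k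
  have e_simps: "e 0 = f" "e (Suc k) = F (e k)" for k unfolding e_def by simp_all
  note R1 = R.oneideal
  have lin: "x \<oplus>\<^sub>S y \<ominus>\<^sub>S \<one>\<^sub>S \<in> ext (carrier R)" if "x \<in> ext (carrier R)" "y \<in> ext (carrier R)" for x y
    by (rule ext_minus[OF R1 ext_add[OF R1 that] one_mem_ext])
  have ind: "e k \<in> ext (carrier R) \<and> W (e k) \<in> ext (mp (Suc k))" for k
  proof (induction k)
    case 0
    then show ?case using f idem unfolding e_simps W_def mp_one by simp
  next
    case (Suc k)
    let ?w = "W (e k)"
    have ek: "e k \<in> ext (carrier R)" and wk: "?w \<in> ext (mp (Suc k))" using Suc by auto
    have wk': "?w \<in> ext (carrier R)" using wk ext_subset[OF mp_ideal, of "Suc k"] by blast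
    have c: "e k \<in> carrier S" "?w \<in> carrier S" using ext_carrier[OF R1] ek wk' by auto
    have 1: "e (Suc k) \<in> ext (carrier R)"
      unfolding e_simps F_def
      by (rule ext_minus[OF R1 ek ext_mult_carrier(1)[OF R1 wk' lin[OF ek ek]]])
    \<comment> \<open>With w = x^2 - x and d = 2x - 1 the new defect is w - w d^2 + w^2 d^2.
      Substituting d^2 = 4w + 1 leaves w^2 (4w - 3).\<close>
    let ?four = "?w \<oplus>\<^sub>S ?w \<oplus>\<^sub>S ?w \<oplus>\<^sub>S ?w \<ominus>\<^sub>S (\<one>\<^sub>S \<oplus>\<^sub>S \<one>\<^sub>S \<oplus>\<^sub>S \<one>\<^sub>S)"
    have "W (e (Suc k)) = (?w \<otimes>\<^sub>S ?w) \<otimes>\<^sub>S ?four"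
    proof -
      define w where "w = ?w"
      define d where "d = e k \<oplus>\<^sub>S e k \<ominus>\<^sub>S \<one>\<^sub>S"
      have wd: "w \<in> carrier S" "d \<in> carrier S" unfolding w_def d_def using c by simp_all
      have dd: "d \<otimes>\<^sub>S d = w \<oplus>\<^sub>S w \<oplus>\<^sub>S w \<oplus>\<^sub>S w \<oplus>\<^sub>S \<one>\<^sub>S"
        unfolding d_def w_def W_def using c(1) by algebra
      have "W (e (Suc k)) = (e k \<ominus>\<^sub>S w \<otimes>\<^sub>S d) \<otimes>\<^sub>S (e k \<ominus>\<^sub>S w \<otimes>\<^sub>S d) \<ominus>\<^sub>S (e k \<ominus>\<^sub>S w \<otimes>\<^sub>S d)"
        unfolding e_simps F_def W_def[of "_ \<ominus>\<^sub>S _"] w_def d_def ..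
      also have "\<dots> = (e k \<otimes>\<^sub>S e k \<ominus>\<^sub>S e k) \<ominus>\<^sub>S (w \<otimes>\<^sub>S d) \<otimes>\<^sub>S (e k \<oplus>\<^sub>S e k \<ominus>\<^sub>S \<one>\<^sub>S) \<oplus>\<^sub>S (w \<otimes>\<^sub>S w) \<otimes>\<^sub>S (d \<otimes>\<^sub>S d)"
        using c(1) wd by algebra
      also have "\<dots> = w \<ominus>\<^sub>S w \<otimes>\<^sub>S (d \<otimes>\<^sub>S d) \<oplus>\<^sub>S (w \<otimes>\<^sub>S w) \<otimes>\<^sub>S (d \<otimes>\<^sub>S d)"
        unfolding d_def[symmetric] W_def[symmetric] w_def[symmetric] using wd by (simp add: S.m_assoc)
      also have "\<dots> = (w \<otimes>\<^sub>S w) \<otimes>\<^sub>S (w \<oplus>\<^sub>S w \<oplus>\<^sub>S w \<oplus>\<^sub>S w \<ominus>\<^sub>S (\<one>\<^sub>S \<oplus>\<^sub>S \<one>\<^sub>S \<oplus>\<^sub>S \<one>\<^sub>S))"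
        unfolding dd using wd(1) by algebra
      finally show ?thesis unfolding w_def .
    qed
    moreover have "?w \<otimes>\<^sub>S ?w \<in> ext (mp (Suc (Suc k)))"
    proof (rule ext_mult[OF mp_ideal mp_ideal mp_ideal _ wk wk])
      fix a b assume "a \<in> mp (Suc k)" "b \<in> mp (Suc k)"
      \<comment> \<open>The first factor counts only as a member of m: the exponent grows by one,
        which is enough for convergence.\<close>
      then show "a \<otimes> b \<in> mp (Suc (Suc k))"
        using mp_Suc_subset_m[of k] ideal_prod.prod[of a \<mm> b "mp (Suc k)" R] by auto
    qed
    moreover have "?four \<in> ext (carrier R)"
      by (intro ext_minus ext_add R1 wk' one_mem_ext)
    ultimately have 2: "W (e (Suc k)) \<in> ext (mp (Suc (Suc k)))"
      using ext_mult_carrier(1)[OF mp_ideal[of "Suc (Suc k)"]] by metis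
    show ?case using 1 2 by blast
  qed
  have eR: "e k \<in> ext (carrier R)" and We: "W (e k) \<in> ext (mp (Suc k))" for k using ind by auto
  have ec: "e k \<in> carrier S" for k by (rule ext_carrier[OF R1 eR])
  define v where "v k = e (Suc k) \<ominus>\<^sub>S e k" for k
  have v_mem: "v k \<in> ext (mp (Suc k))" for k
  proof -
    have wc: "W (e k) \<in> carrier S" by (rule ext_carrier[OF mp_ideal We])
    have "v k = \<ominus>\<^sub>S (W (e k) \<otimes>\<^sub>S (e k \<oplus>\<^sub>S e k \<ominus>\<^sub>S \<one>\<^sub>S))"
      unfolding v_def e_simps F_def using wc ec[of k] by algebra
    then show ?thesis
      using ext_neg[OF mp_ideal ext_mult_carrier(1)[OF mp_ideal We lin[OF eR eR]]] by simp
  qed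
  have v_mem': "v k \<in> ext (mp k)" for k
    using v_mem[of k] ext_mono[OF mp_decreasing[of k "Suc k"]] by auto
  have psum: "S.psum v k = e k \<ominus>\<^sub>S e 0" for k
  proof (induction k)
    case 0
    then show ?case using ec[of 0] by (simp add: a_minus_def S.r_neg)
  next
    case (Suc k)
    have "S.psum v (Suc k) = (e k \<ominus>\<^sub>S e 0) \<oplus>\<^sub>S (e (Suc k) \<ominus>\<^sub>S e k)" using Suc v_def[of k] by simp
    also have "\<dots> = e (Suc k) \<ominus>\<^sub>S e 0" using ec[of k] ec[of 0] ec[of "Suc k"] by algebra
    finally show ?case .
  qed
  obtain l where l: "l \<in> ext (carrier R)" "\<And>k. l \<ominus>\<^sub>S S.psum v k \<in> ext (mp k)"
    using fspan_series_converges[OF pws[of N], of v] v_mem' unfolding ext_def by auto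
  have lc: "l \<in> carrier S" by (rule ext_carrier[OF R1 l(1)])
  define g where "g = e 0 \<oplus>\<^sub>S l"
  have gR: "g \<in> ext (carrier R)" unfolding g_def by (rule ext_add[OF R1 eR l(1)])
  have gc: "g \<in> carrier S" by (rule ext_carrier[OF R1 gR])
  have ge: "g \<ominus>\<^sub>S e k \<in> ext (mp k)" for k
  proof -
    have "g \<ominus>\<^sub>S e k = l \<ominus>\<^sub>S S.psum v k" unfolding g_def psum using lc ec[of k] ec[of 0] by algebra
    then show ?thesis using l(2) by simp
  qed
  have "g \<otimes>\<^sub>S g \<ominus>\<^sub>S g = \<zero>\<^sub>S"
  proof (rule ext_mp_Inter)
    fix k
    have "g \<otimes>\<^sub>S g \<ominus>\<^sub>S g = (g \<ominus>\<^sub>S e k) \<otimes>\<^sub>S (g \<oplus>\<^sub>S e k \<ominus>\<^sub>S \<one>\<^sub>S) \<oplus>\<^sub>S W (e k)"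
      unfolding W_def using gc ec[of k] by algebra
    moreover have "(g \<ominus>\<^sub>S e k) \<otimes>\<^sub>S (g \<oplus>\<^sub>S e k \<ominus>\<^sub>S \<one>\<^sub>S) \<in> ext (mp k)"
      by (rule ext_mult_carrier(1)[OF mp_ideal ge lin[OF gR eR]])
    moreover have "W (e k) \<in> ext (mp k)"
      using We[of k] ext_mono[OF mp_decreasing[of k "Suc k"]] by auto
    ultimately show "g \<otimes>\<^sub>S g \<ominus>\<^sub>S g \<in> ext (mp k)" using ext_add[OF mp_ideal] by simp
  qed
  moreover have "g \<otimes>\<^sub>S g \<ominus>\<^sub>S g = g \<otimes>\<^sub>S (g \<ominus>\<^sub>S \<one>\<^sub>S)" using gc by algebra
  ultimately have g01: "g = \<zero>\<^sub>S \<or> g \<ominus>\<^sub>S \<one>\<^sub>S = \<zero>\<^sub>S"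
    using S.integral[of g "g \<ominus>\<^sub>S \<one>\<^sub>S"] gc by auto
  \<comment> \<open>The comparison with f goes through e 1, since closeness to e 0 is only known
    modulo m^0, the whole ring.\<close>
  have "(g \<ominus>\<^sub>S e (Suc 0)) \<oplus>\<^sub>S v 0 \<in> ext (mp (Suc 0))"
    by (rule ext_add[OF mp_ideal ge v_mem])
  moreover have "(g \<ominus>\<^sub>S e (Suc 0)) \<oplus>\<^sub>S v 0 = g \<ominus>\<^sub>S f"
    unfolding v_def e_simps(1)[symmetric] using gc ec[of 0] ec[of "Suc 0"] by algebra
  ultimately have gf: "g \<ominus>\<^sub>S f \<in> ext \<mm>" unfolding mp_one by simp
  have fc: "f \<in> carrier S" by (rule ext_carrier[OF R1 f])
  show ?thesis
  proof (cases "g = \<zero>\<^sub>S")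
    case True
    have "f = \<ominus>\<^sub>S (\<zero>\<^sub>S \<ominus>\<^sub>S f)" using fc by algebra
    then show ?thesis using ext_neg[OF m_ideal gf] True by simp
  next
    case False
    then have "g = \<one>\<^sub>S" using g01 gc by simp
    then show ?thesis using gf by simp
  qed
qed

text \<open>With f = ux one has 1 - f = vy, so f (1 - f) = uv xy lies in m R[s] and f is idempotent
  there. If ux is in m R[s], then so is x = x(ux) + v(xy), and symmetrically for y.\<close>

lemma comaximal_mult_mem:
  assumes B: "x \<in> ext (carrier R)" "y \<in> ext (carrier R)" "u \<in> ext (carrier R)" "v \<in> ext (carrier R)"
    and comax: "u \<otimes>\<^sub>S x \<oplus>\<^sub>S v \<otimes>\<^sub>S y = \<one>\<^sub>S" and xy: "x \<otimes>\<^sub>S y \<in> ext \<mm>"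
  shows "x \<in> ext \<mm> \<or> y \<in> ext \<mm>"
proof -
  note R1 = R.oneideal
  note c = B[THEN ext_carrier[OF R1]]
  let ?f = "u \<otimes>\<^sub>S x"
  have vy: "\<one>\<^sub>S \<ominus>\<^sub>S ?f = v \<otimes>\<^sub>S y" unfolding comax[symmetric] using c by algebra
  have "?f \<otimes>\<^sub>S ?f \<ominus>\<^sub>S ?f = \<ominus>\<^sub>S (?f \<otimes>\<^sub>S (\<one>\<^sub>S \<ominus>\<^sub>S ?f))" using c by algebra
  also have "\<dots> = \<ominus>\<^sub>S ((u \<otimes>\<^sub>S v) \<otimes>\<^sub>S (x \<otimes>\<^sub>S y))" unfolding vy using c by algebra
  also have "\<dots> \<in> ext \<mm>"
    by (rule ext_neg[OF m_ideal ext_mult_carrier(2)[OF m_ideal xy ext_mult_carrier(1)[OF R1 B(3,4)]]])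
  finally have "?f \<otimes>\<^sub>S ?f \<ominus>\<^sub>S ?f \<in> ext \<mm>" .
  then have "?f \<in> ext \<mm> \<or> v \<otimes>\<^sub>S y \<in> ext \<mm>"
    using idempotent_mod_max_ideal[OF ext_mult_carrier(1)[OF R1 B(3,1)]] vy by simp
  then show ?thesis
  proof
    assume f: "?f \<in> ext \<mm>"
    have "x = x \<otimes>\<^sub>S (u \<otimes>\<^sub>S x \<oplus>\<^sub>S v \<otimes>\<^sub>S y)" unfolding comax using c by simp
    also have "\<dots> = x \<otimes>\<^sub>S ?f \<oplus>\<^sub>S v \<otimes>\<^sub>S (x \<otimes>\<^sub>S y)" using c by algebra
    also have "\<dots> \<in> ext \<mm>"
      by (rule ext_add[OF m_ideal ext_mult_carrier(2)[OF m_ideal f B(1)] ext_mult_carrier(2)[OF m_ideal xy B(4)]])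
    finally show ?thesis by simp
  next
    assume f: "v \<otimes>\<^sub>S y \<in> ext \<mm>"
    have "y = y \<otimes>\<^sub>S (u \<otimes>\<^sub>S x \<oplus>\<^sub>S v \<otimes>\<^sub>S y)" unfolding comax using c by simp
    also have "\<dots> = y \<otimes>\<^sub>S (v \<otimes>\<^sub>S y) \<oplus>\<^sub>S u \<otimes>\<^sub>S (x \<otimes>\<^sub>S y)" using c by algebra
    also have "\<dots> \<in> ext \<mm>"
      by (rule ext_add[OF m_ideal ext_mult_carrier(2)[OF m_ideal f B(2)] ext_mult_carrier(2)[OF m_ideal xy B(3)]])
    finally show ?thesis by simp
  qed
qed

end

section \<open>Linear factors of an integral equation modulo the maximal ideal\<close>

lemma (in complete_local_ring) exists_root_mod_max_ideal:
  assumes closed: "algebraically_closed (R Quot \<mm>)" and l: "set l \<subseteq> carrier R" "l \<noteq> []"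
  shows "\<exists>c\<in>carrier R. eval (\<one> # l) c \<in> \<mm>"
proof -
  interpret k: algebraically_closed "R Quot \<mm>" by (rule closed)
  interpret q: ring_hom_ring R "R Quot \<mm>" "(+>) \<mm>" by (rule ideal.rcos_ring_hom_ring[OF m_ideal])
  let ?p = "map ((+>) \<mm>) (\<one> # l)"
  have "\<mm> +> \<one> = \<one>\<^bsub>R Quot \<mm>\<^esub>" by simp
  then have p: "?p \<in> carrier (poly_ring (R Quot \<mm>))"
    unfolding univ_poly_carrier[symmetric] polynomial_def using l(1) k.one_not_zero by auto
  \<comment> \<open>Over an algebraically closed field the number of roots is the degree, here
    \<open>length l\<close>, which is positive.\<close>
  have "k.splitted ?p" by (rule k.roots_over_carrier[OF p])
  then have "size (k.roots ?p) \<noteq> 0" unfolding k.splitted_def using l(2) by simp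
  then obtain a where "a \<in># k.roots ?p" by (metis multiset_nonemptyE size_empty)
  then have a: "a \<in> carrier (R Quot \<mm>)" "k.eval ?p a = \<zero>\<^bsub>R Quot \<mm>\<^esub>"
    using k.roots_mem_iff_is_root[OF p] unfolding k.is_root_def by auto
  obtain c where c: "c \<in> carrier R" "a = \<mm> +> c"
    using a(1) unfolding FactRing_def A_RCOSETS_def' by auto
  have l': "set (\<one> # l) \<subseteq> carrier R" using l by simp
  have "\<mm> +> eval (\<one> # l) c = \<zero>\<^bsub>R Quot \<mm>\<^esub>"
    using q.eval_hom'[OF c(1) l'] a(2) c(2) by simp
  then have "\<mm> +> eval (\<one> # l) c = \<mm>" unfolding FactRing_def by simp
  then have "eval (\<one> # l) c \<in> \<mm>"
    by (rule ideal.rcos_const_imp_mem[OF m_ideal eval_in_carrier[OF l' c(1)]])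
  then show ?thesis using c(1) by auto
qed

context ring_hom_cring
begin

lemma set_map_hom: "set l \<subseteq> carrier R \<Longrightarrow> set (map h l) \<subseteq> carrier S"
  by auto

text \<open>Horner's scheme: the coefficients of the quotient are the values at c of the initial
  segments of the list. The identity is stated for values at s. The clause on \<open>hd q\<close>
  keeps the quotient monic so that division can be repeated.\<close>

lemma synthetic_division:
  assumes "a \<in> carrier R" "set l \<subseteq> carrier R" "c \<in> carrier R" "s \<in> carrier S"
  shows "\<exists>q. set q \<subseteq> carrier R \<and> length q = length l \<and> (l \<noteq> [] \<longrightarrow> hd q = a) \<and>
    S.eval (map h (a # l)) s = (s \<ominus>\<^sub>S h c) \<otimes>\<^sub>S S.eval (map h q) s \<oplus>\<^sub>S h (R.eval (a # l) c)"
  using assms(2)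
proof (induction l rule: rev_induct)
  case Nil
  show ?case by (rule exI[of _ "[]"]) (use assms in auto)
next
  case (snoc b l)
  then obtain q where q: "set q \<subseteq> carrier R" "length q = length l" "l \<noteq> [] \<longrightarrow> hd q = a"
    "S.eval (map h (a # l)) s = (s \<ominus>\<^sub>S h c) \<otimes>\<^sub>S S.eval (map h q) s \<oplus>\<^sub>S h (R.eval (a # l) c)"
    by auto
  have b: "b \<in> carrier R" and al: "set (a # l) \<subseteq> carrier R" using snoc.prems assms(1) by auto
  define r where "r = R.eval (a # l) c"
  define Q where "Q = S.eval (map h q) s"
  have r: "r \<in> carrier R" unfolding r_def by (rule R.eval_in_carrier[OF al assms(3)])
  have Q: "Q \<in> carrier S" unfolding Q_def by (rule S.eval_in_carrier[OF set_map_hom[OF q(1)] assms(4)])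
  have er: "R.eval (a # l @ [b]) c = r \<otimes> c \<oplus> b"
    using R.eval_append_aux[OF al b assms(3)] unfolding r_def by simp
  have "S.eval (map h (a # l @ [b])) s = S.eval (map h (a # l)) s \<otimes>\<^sub>S s \<oplus>\<^sub>S h b"
    using S.eval_append_aux[OF set_map_hom[OF al] hom_closed[OF b] assms(4)] by simp
  also have "\<dots> = ((s \<ominus>\<^sub>S h c) \<otimes>\<^sub>S Q \<oplus>\<^sub>S h r) \<otimes>\<^sub>S s \<oplus>\<^sub>S h b"
    using q(4) unfolding r_def Q_def by simp
  also have "\<dots> = (s \<ominus>\<^sub>S h c) \<otimes>\<^sub>S (Q \<otimes>\<^sub>S s \<oplus>\<^sub>S h r) \<oplus>\<^sub>S (h r \<otimes>\<^sub>S h c \<oplus>\<^sub>S h b)"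
    using Q assms(4) hom_closed[OF r] hom_closed[OF b] hom_closed[OF assms(3)] by algebra
  also have "h r \<otimes>\<^sub>S h c \<oplus>\<^sub>S h b = h (R.eval (a # l @ [b]) c)"
    unfolding er using r b assms(3) by simp
  also have "Q \<otimes>\<^sub>S s \<oplus>\<^sub>S h r = S.eval (map h (q @ [r])) s"
    using S.eval_append_aux[OF set_map_hom[OF q(1)] hom_closed[OF r] assms(4)] unfolding Q_def by simp
  finally have eq: "S.eval (map h (a # l @ [b])) s
    = (s \<ominus>\<^sub>S h c) \<otimes>\<^sub>S S.eval (map h (q @ [r])) s \<oplus>\<^sub>S h (R.eval (a # l @ [b]) c)" .
  have "hd (q @ [r]) = a"
  proof (cases "l = []")
    case True
    then show ?thesis using q(2) assms(1) by (simp add: r_def)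
  next
    case False
    then have "q \<noteq> []" using q(2) by auto
    then show ?thesis using q(3) False by simp
  qed
  then show ?case using eq q r by (intro exI[of _ "q @ [r]"]) auto
qed

lemma fspan_pows_eval:
  assumes "s \<in> carrier S" "v \<in> fspan (carrier R) (pows s n)"
  shows "\<exists>l. set l \<subseteq> carrier R \<and> length l = n \<and> v = S.eval (map h l) s"
  using assms(2)
proof (induction n arbitrary: v)
  case (Suc n)
  obtain c w where cw: "c \<in> carrier R" "w \<in> fspan (carrier R) (pows s n)" "v = h c \<otimes>\<^sub>S s [^]\<^sub>S n \<oplus>\<^sub>S w"
    using Suc.prems unfolding pows_simps by (rule fspan_ConsE)
  obtain l where "set l \<subseteq> carrier R" "length l = n" "w = S.eval (map h l) s" using Suc.IH[OF cw(2)] by auto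
  then show ?case using cw by (intro exI[of _ "c # l"]) auto
qed simp

primrec linprod :: "'c \<Rightarrow> 'a list \<Rightarrow> 'c" where
  "linprod s [] = \<one>\<^sub>S"
| "linprod s (c # cs) = (s \<ominus>\<^sub>S h c) \<otimes>\<^sub>S linprod s cs"

end

context complete_integral_element
begin

abbreviation "B \<equiv> ext (carrier R)"

lemmas B_closed = ext_carrier[OF R.oneideal]
  and B_add = ext_add[OF R.oneideal] and B_minus = ext_minus[OF R.oneideal] and B_neg = ext_neg[OF R.oneideal]
  and B_mult = ext_mult_carrier(1)[OF R.oneideal]
  and mB_mult = ext_mult_carrier[OF m_ideal]
  and mB_closed = ext_carrier[OF m_ideal]

lemma hom_mem_B: "c \<in> carrier R \<Longrightarrow> h c \<in> B"
  by (rule hom_mem_ext[OF R.oneideal])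

lemma lin_mem_B: "c \<in> carrier R \<Longrightarrow> s \<ominus>\<^sub>S h c \<in> B"
  by (rule B_minus[OF s_mem_ext hom_mem_B])

lemma linprod_mem_B: "set cs \<subseteq> carrier R \<Longrightarrow> linprod s cs \<in> B"
  by (induction cs) (auto intro: one_mem_ext B_mult lin_mem_B)

lemma pow_mem_B: "x \<in> B \<Longrightarrow> x [^]\<^sub>S (k::nat) \<in> B"
  by (induction k) (auto intro: one_mem_ext B_mult)

text \<open>Each division by s - hc at a root c modulo m leaves a remainder in m and a monic
  quotient of degree one less, to which the induction applies.\<close>

lemma exists_linear_factors:
  assumes closed: "algebraically_closed (R Quot \<mm>)" and l: "set l \<subseteq> carrier R"
  shows "\<exists>cs. set cs \<subseteq> carrier R \<and> S.eval (map h (\<one> # l)) s \<ominus>\<^sub>S linprod s cs \<in> ext \<mm>"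
  using l
proof (induction "length l" arbitrary: l)
  case 0
  then show ?case
    using ext_zero[OF m_ideal] by (intro exI[of _ "[]"]) (auto simp: a_minus_def S.r_neg)
next
  case (Suc n)
  have "l \<noteq> []" using Suc(2) by auto
  obtain c where c: "c \<in> carrier R" "R.eval (\<one> # l) c \<in> \<mm>"
    using exists_root_mod_max_ideal[OF closed Suc.prems \<open>l \<noteq> []\<close>] by auto
  obtain q where q: "set q \<subseteq> carrier R" "length q = length l" "hd q = \<one>"
    "S.eval (map h (\<one> # l)) s = (s \<ominus>\<^sub>S h c) \<otimes>\<^sub>S S.eval (map h q) s \<oplus>\<^sub>S h (R.eval (\<one> # l) c)"
    using synthetic_division[OF R.one_closed Suc.prems c(1) s_closed] \<open>l \<noteq> []\<close> by auto
  obtain q' where q': "q = \<one> # q'" using q(2,3) \<open>l \<noteq> []\<close> by (cases q) auto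
  obtain cs where cs: "set cs \<subseteq> carrier R" "S.eval (map h q) s \<ominus>\<^sub>S linprod s cs \<in> ext \<mm>"
    using Suc(1)[of q'] Suc(2) q(1,2) unfolding q' by auto
  define E where "E = S.eval (map h q) s"
  define r where "r = R.eval (\<one> # l) c"
  have E: "E \<in> carrier S" unfolding E_def by (rule S.eval_in_carrier[OF set_map_hom[OF q(1)] s_closed])
  have r: "h r \<in> ext \<mm>" unfolding r_def by (rule hom_mem_ext[OF m_ideal c(2)])
  have "S.eval (map h (\<one> # l)) s \<ominus>\<^sub>S linprod s (c # cs)
      = ((s \<ominus>\<^sub>S h c) \<otimes>\<^sub>S E \<oplus>\<^sub>S h r) \<ominus>\<^sub>S (s \<ominus>\<^sub>S h c) \<otimes>\<^sub>S linprod s cs"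
    using q(4) unfolding E_def r_def by simp
  also have "\<dots> = (s \<ominus>\<^sub>S h c) \<otimes>\<^sub>S (E \<ominus>\<^sub>S linprod s cs) \<oplus>\<^sub>S h r"
    using E mB_closed[OF r] B_closed[OF linprod_mem_B[OF cs(1)]] s_closed hom_closed[OF c(1)] by algebra
  also have "\<dots> \<in> ext \<mm>"
    by (rule ext_add[OF m_ideal mB_mult(2)[OF cs(2)[folded E_def] lin_mem_B[OF c(1)]] r])
  finally show ?case using c(1) cs(1) by (intro exI[of _ "c # cs"]) simp
qed

definition comax :: "'c \<Rightarrow> 'c \<Rightarrow> bool" where
  "comax x y \<longleftrightarrow> (\<exists>u\<in>B. \<exists>v\<in>B. u \<otimes>\<^sub>S x \<oplus>\<^sub>S v \<otimes>\<^sub>S y = \<one>\<^sub>S)"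

lemma comax_sym:
  assumes "comax x y" "x \<in> B" "y \<in> B"
  shows "comax y x"
proof -
  obtain u v where uv: "u \<in> B" "v \<in> B" "u \<otimes>\<^sub>S x \<oplus>\<^sub>S v \<otimes>\<^sub>S y = \<one>\<^sub>S"
    using assms(1) unfolding comax_def by auto
  then have "v \<otimes>\<^sub>S y \<oplus>\<^sub>S u \<otimes>\<^sub>S x = \<one>\<^sub>S"
    using S.a_comm assms(2,3) B_closed by simp
  then show ?thesis using uv unfolding comax_def by auto
qed

lemma comax_one: "x \<in> B \<Longrightarrow> comax x \<one>\<^sub>S"
  unfolding comax_def
  by (rule bexI[OF _ ext_zero[OF R.oneideal]], rule bexI[OF _ one_mem_ext]) (use B_closed in simp)

lemma comax_mult:
  assumes "comax x y" "comax x z" and B: "x \<in> B" "y \<in> B" "z \<in> B"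
  shows "comax x (y \<otimes>\<^sub>S z)"
proof -
  obtain u v where uv: "u \<in> B" "v \<in> B" "u \<otimes>\<^sub>S x \<oplus>\<^sub>S v \<otimes>\<^sub>S y = \<one>\<^sub>S"
    using assms(1) unfolding comax_def by auto
  obtain u' v' where uv': "u' \<in> B" "v' \<in> B" "u' \<otimes>\<^sub>S x \<oplus>\<^sub>S v' \<otimes>\<^sub>S z = \<one>\<^sub>S"
    using assms(2) unfolding comax_def by auto
  let ?u = "u \<oplus>\<^sub>S (v \<otimes>\<^sub>S y) \<otimes>\<^sub>S u'"
  have "?u \<otimes>\<^sub>S x \<oplus>\<^sub>S (v \<otimes>\<^sub>S v') \<otimes>\<^sub>S (y \<otimes>\<^sub>S z)
      = u \<otimes>\<^sub>S x \<oplus>\<^sub>S (v \<otimes>\<^sub>S y) \<otimes>\<^sub>S (u' \<otimes>\<^sub>S x \<oplus>\<^sub>S v' \<otimes>\<^sub>S z)"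
    using B[THEN B_closed] uv(1,2)[THEN B_closed] uv'(1,2)[THEN B_closed] by algebra
  also have "\<dots> = \<one>\<^sub>S" unfolding uv'(3) using uv B B_closed by simp
  finally show ?thesis
    unfolding comax_def using uv uv' B
    by (intro bexI[of _ ?u] bexI[of _ "v \<otimes>\<^sub>S v'"] B_add B_mult) auto
qed

text \<open>The two factors differ by the image of d - c, which is a unit of the local ring
  R.\<close>

lemma comax_linear:
  assumes "c \<in> carrier R" "d \<in> carrier R" "d \<ominus> c \<notin> \<mm>"
  shows "comax (s \<ominus>\<^sub>S h c) (s \<ominus>\<^sub>S h d)"
proof -
  have dc: "d \<ominus> c \<in> carrier R" using assms by simp
  define r where "r = inv (d \<ominus> c)"
  have U: "d \<ominus> c \<in> Units R" by (rule unit_of_notin_max_ideal[OF local dc assms(3)])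
  then have r: "r \<in> carrier R" "r \<otimes> (d \<ominus> c) = \<one>" unfolding r_def by simp_all
  have "h r \<otimes>\<^sub>S (s \<ominus>\<^sub>S h c) \<oplus>\<^sub>S (\<ominus>\<^sub>S h r) \<otimes>\<^sub>S (s \<ominus>\<^sub>S h d) = h r \<otimes>\<^sub>S (h d \<ominus>\<^sub>S h c)"
    using s_closed hom_closed[OF r(1)] hom_closed[OF assms(1)] hom_closed[OF assms(2)] by algebra
  also have "\<dots> = h (r \<otimes> (d \<ominus> c))" using r(1) assms by (simp add: a_minus_def)
  also have "\<dots> = \<one>\<^sub>S" unfolding r(2) by simp
  finally show ?thesis
    unfolding comax_def using hom_mem_B[OF r(1)] B_neg by blast
qed

lemma comax_pow_linprod:
  assumes c: "c \<in> carrier R" and cs: "set cs \<subseteq> carrier R" "\<And>d. d \<in> set cs \<Longrightarrow> d \<ominus> c \<notin> \<mm>"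
  shows "comax ((s \<ominus>\<^sub>S h c) [^]\<^sub>S (e::nat)) (linprod s cs)"
proof -
  let ?t = "s \<ominus>\<^sub>S h c"
  note t = lin_mem_B[OF c] and p = linprod_mem_B[OF cs(1)]
  have tp: "comax ?t (linprod s cs)"
    using cs
  proof (induction cs)
    case Nil
    show ?case using comax_one[OF t] by simp
  next
    case (Cons d cs)
    have "comax ?t (linprod s cs)" by (rule Cons.IH) (use Cons.prems in auto)
    then show ?case
      using comax_mult[OF comax_linear[OF c, of d] _ t lin_mem_B linprod_mem_B] Cons.prems by auto
  qed
  have "comax (linprod s cs) (?t [^]\<^sub>S e)"
  proof (induction e)
    case 0
    then show ?case using comax_one[OF p] by simp
  next
    case (Suc e)
    then show ?case
      using comax_mult[OF Suc comax_sym[OF tp t p] p pow_mem_B[OF t] t] by simp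
  qed
  then show ?thesis by (rule comax_sym[OF _ p pow_mem_B[OF t]])
qed

text \<open>A factor s - hd with d congruent to c may be replaced by s - hc modulo m R[s]; e counts
  these factors.\<close>

lemma linprod_split:
  assumes c: "c \<in> carrier R" and cs: "set cs \<subseteq> carrier R"
  shows "\<exists>e::nat. linprod s cs \<ominus>\<^sub>S (s \<ominus>\<^sub>S h c) [^]\<^sub>S e \<otimes>\<^sub>S linprod s (filter (\<lambda>d. d \<ominus> c \<notin> \<mm>) cs) \<in> ext \<mm>"
  using cs
proof (induction cs)
  case Nil
  show ?case
    by (rule exI[of _ 0]) (use ext_zero[OF m_ideal] in \<open>auto simp: a_minus_def S.r_neg\<close>)
next
  case (Cons d cs)
  define t where "t = s \<ominus>\<^sub>S h c"
  define L where "L = linprod s cs"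
  define F where "F = linprod s (filter (\<lambda>d. d \<ominus> c \<notin> \<mm>) cs)"
  have d: "d \<in> carrier R" and csR: "set cs \<subseteq> carrier R" using Cons.prems by auto
  obtain e :: nat where e: "L \<ominus>\<^sub>S t [^]\<^sub>S e \<otimes>\<^sub>S F \<in> ext \<mm>"
    using Cons.IH[OF csR] unfolding L_def F_def t_def by auto
  define T where "T = t [^]\<^sub>S e"
  have B: "L \<in> B" "F \<in> B" "t \<in> B" "T \<in> B"
    unfolding L_def F_def t_def T_def using csR by (auto intro!: linprod_mem_B lin_mem_B[OF c] pow_mem_B)
  note car = B[THEN B_closed] hom_closed[OF c] hom_closed[OF d] s_closed
  show ?case
  proof (cases "d \<ominus> c \<in> \<mm>")
    case True
    have "linprod s (d # cs) \<ominus>\<^sub>S t [^]\<^sub>S Suc e \<otimes>\<^sub>S linprod s (filter (\<lambda>d. d \<ominus> c \<notin> \<mm>) (d # cs))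
        = (s \<ominus>\<^sub>S h d) \<otimes>\<^sub>S L \<ominus>\<^sub>S (T \<otimes>\<^sub>S t) \<otimes>\<^sub>S F"
      using True unfolding L_def F_def T_def by simp
    also have "\<dots> = t \<otimes>\<^sub>S (L \<ominus>\<^sub>S T \<otimes>\<^sub>S F) \<ominus>\<^sub>S (h d \<ominus>\<^sub>S h c) \<otimes>\<^sub>S L"
      unfolding t_def using car by algebra
    also have "h d \<ominus>\<^sub>S h c = h (d \<ominus> c)" using c d by (simp add: a_minus_def)
    also have "t \<otimes>\<^sub>S (L \<ominus>\<^sub>S T \<otimes>\<^sub>S F) \<ominus>\<^sub>S h (d \<ominus> c) \<otimes>\<^sub>S L \<in> ext \<mm>"
      by (rule ext_minus[OF m_ideal mB_mult(2)[OF e[folded T_def] B(3)] mB_mult(1)[OF hom_mem_ext[OF m_ideal True] B(1)]])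
    finally show ?thesis unfolding t_def by (rule exI)
  next
    case False
    have "linprod s (d # cs) \<ominus>\<^sub>S t [^]\<^sub>S e \<otimes>\<^sub>S linprod s (filter (\<lambda>d. d \<ominus> c \<notin> \<mm>) (d # cs))
        = (s \<ominus>\<^sub>S h d) \<otimes>\<^sub>S L \<ominus>\<^sub>S T \<otimes>\<^sub>S ((s \<ominus>\<^sub>S h d) \<otimes>\<^sub>S F)"
      using False unfolding L_def F_def T_def by simp
    also have "\<dots> = (s \<ominus>\<^sub>S h d) \<otimes>\<^sub>S (L \<ominus>\<^sub>S T \<otimes>\<^sub>S F)"
      using car by algebra
    also have "\<dots> \<in> ext \<mm>" by (rule mB_mult(2)[OF e[folded T_def] lin_mem_B[OF d]])
    finally show ?thesis unfolding t_def by (rule exI)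
  qed
qed

text \<open>Grouping the factors around the first root c writes the product, modulo m R[s], as a
  power of s - hc times a comaximal product, so one of the two lies in m R[s]. The second has fewer
  factors, since c itself was removed.\<close>

lemma exists_linear_pow_mem:
  assumes "set cs \<subseteq> carrier R" "linprod s cs \<in> ext \<mm>"
  shows "\<exists>c\<in>carrier R. \<exists>k::nat. (s \<ominus>\<^sub>S h c) [^]\<^sub>S k \<in> ext \<mm>"
  using assms
proof (induction "length cs" arbitrary: cs rule: less_induct)
  case less
  show ?case
  proof (cases cs)
    case Nil
    \<comment> \<open>The empty product 1 is the power with exponent 0, for any root.\<close>
    then show ?thesis using less.prems by (intro bexI[of _ \<zero>] exI[of _ 0]) auto
  next
    case (Cons c ds)
    have c: "c \<in> carrier R" using less.prems Cons by auto
    let ?F = "filter (\<lambda>d. d \<ominus> c \<notin> \<mm>) cs"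
    let ?t = "s \<ominus>\<^sub>S h c"
    have F: "set ?F \<subseteq> carrier R" using less.prems(1) by auto
    obtain e :: nat where e: "linprod s cs \<ominus>\<^sub>S ?t [^]\<^sub>S e \<otimes>\<^sub>S linprod s ?F \<in> ext \<mm>"
      using linprod_split[OF c less.prems(1)] by auto
    have "c \<ominus> c = \<zero>" using c by (simp add: a_minus_def R.r_neg)
    then have "c \<ominus> c \<in> \<mm>" using R.ideal_closed(2)[OF m_ideal] by simp
    then have len: "length ?F < length cs" using Cons by (simp add: le_imp_less_Suc)
    define T where "T = ?t [^]\<^sub>S e"
    define L where "L = linprod s cs"
    define P where "P = linprod s ?F"
    have B: "T \<in> B" "P \<in> B" "L \<in> B"
      unfolding T_def P_def L_def by (rule pow_mem_B[OF lin_mem_B[OF c]], rule linprod_mem_B[OF F], rule linprod_mem_B[OF less.prems(1)])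
    have "T \<otimes>\<^sub>S P = L \<ominus>\<^sub>S (L \<ominus>\<^sub>S T \<otimes>\<^sub>S P)" using B[THEN B_closed] by algebra
    then have TP: "T \<otimes>\<^sub>S P \<in> ext \<mm>"
      using ext_minus[OF m_ideal less.prems(2)[folded L_def] e[folded L_def T_def P_def]] by simp
    have "comax T P" unfolding T_def P_def by (rule comax_pow_linprod[OF c F]) auto
    then obtain u v where "u \<in> B" "v \<in> B" "u \<otimes>\<^sub>S T \<oplus>\<^sub>S v \<otimes>\<^sub>S P = \<one>\<^sub>S" unfolding comax_def by auto
    then have "T \<in> ext \<mm> \<or> P \<in> ext \<mm>" using comaximal_mult_mem[OF B(1,2) _ _ _ TP] by auto
    then show ?thesis
    proof
      assume "T \<in> ext \<mm>"
      then show ?thesis using c unfolding T_def by auto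
    next
      assume "P \<in> ext \<mm>"
      then show ?thesis using less.hyps[OF len F] unfolding P_def by auto
    qed
  qed
qed

text \<open>Some power of t = s - hc lies in m R[s]. It remains to express m R[s] by powers of t in
  place of powers of s, and to raise the exponent above all the powers that occur.\<close>

lemma exists_shift_integral_over_max_ideal:
  assumes closed: "algebraically_closed (R Quot \<mm>)"
  shows "\<exists>c\<in>carrier R. \<exists>k\<ge>1. (s \<ominus>\<^sub>S h c) [^]\<^sub>S k \<in> fspan \<mm> (pows (s \<ominus>\<^sub>S h c) k)"
proof -
  obtain l where l: "set l \<subseteq> carrier R" "length l = N" "\<ominus>\<^sub>S (s [^]\<^sub>S N) = S.eval (map h l) s"
    using fspan_pows_eval[OF s_closed fspan_neg[OF R.oneideal pws integral_eq]] by auto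
  have "S.eval (map h (\<one> # l)) s = \<zero>\<^sub>S"
    using l s_closed by (simp add: l(3)[symmetric] S.r_neg)
  moreover obtain cs where cs: "set cs \<subseteq> carrier R" "S.eval (map h (\<one> # l)) s \<ominus>\<^sub>S linprod s cs \<in> ext \<mm>"
    using exists_linear_factors[OF closed l(1)] by auto
  ultimately have "\<zero>\<^sub>S \<ominus>\<^sub>S linprod s cs \<in> ext \<mm>" by metis
  moreover have "linprod s cs = \<ominus>\<^sub>S (\<zero>\<^sub>S \<ominus>\<^sub>S linprod s cs)"
    using B_closed[OF linprod_mem_B[OF cs(1)]] by algebra
  ultimately have "linprod s cs \<in> ext \<mm>" using ext_neg[OF m_ideal] by metis
  then obtain c k where c: "c \<in> carrier R" and k: "(s \<ominus>\<^sub>S h c) [^]\<^sub>S (k::nat) \<in> ext \<mm>"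
    using exists_linear_pow_mem[OF cs(1)] by auto
  define t where "t = s \<ominus>\<^sub>S h c"
  have tB: "t \<in> B" unfolding t_def by (rule lin_mem_B[OF c])
  have t: "t \<in> carrier S" by (rule B_closed[OF tB])
  note pt = pows_carrier[OF t]
  have st: "s = t \<oplus>\<^sub>S h c" unfolding t_def using s_closed hom_closed[OF c] by algebra
  \<comment> \<open>Substituting s = t + hc never raises the degree, so s^j is a combination of 1,
    ..., t^j.\<close>
  have s_pow: "s [^]\<^sub>S j \<in> fspan (carrier R) (pows t (Suc j))" for j :: nat
  proof (induction j)
    case 0
    show ?case using fspan_gen_carrier[OF pt[of "Suc 0"] pow_mem_pows[of 0 "Suc 0" t]] by simp
  next
    case (Suc j)
    have "s \<otimes>\<^sub>S s [^]\<^sub>S j \<in> fspan (carrier R) (pows t (Suc (Suc j)))"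
    proof (rule fspan_mult[OF R.oneideal R.oneideal R.oneideal pt pt s_closed _ _ Suc])
      fix g assume "g \<in> set (pows t (Suc j))"
      then obtain i where i: "i < Suc j" "g = t [^]\<^sub>S i" unfolding set_pows by auto
      have "s \<otimes>\<^sub>S g = t [^]\<^sub>S Suc i \<oplus>\<^sub>S h c \<otimes>\<^sub>S t [^]\<^sub>S i"
        unfolding st i(2) S.nat_pow_Suc using t hom_closed[OF c] S.nat_pow_closed[OF t, of i] by algebra
      also have "\<dots> \<in> fspan (carrier R) (pows t (Suc (Suc j)))"
        by (rule fspan_add[OF R.oneideal pt fspan_gen_carrier[OF pt pow_mem_pows] fspan_gen[OF R.oneideal pt c pow_mem_pows]])
          (use i(1) in auto)
      finally show "s \<otimes>\<^sub>S g \<in> fspan (carrier R) (pows t (Suc (Suc j)))" .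
    qed auto
    then show ?case using s_closed by (simp add: S.m_comm)
  qed
  have ext_sub: "v \<in> fspan \<mm> (pows t N)" if v: "v \<in> ext \<mm>" for v
  proof -
    have "\<one>\<^sub>S \<otimes>\<^sub>S v \<in> fspan \<mm> (pows t N)"
    proof (rule fspan_mult[OF R.oneideal m_ideal m_ideal pws pt S.one_closed _ _ v[unfolded ext_def]])
      fix g assume "g \<in> set (pows s N)"
      then obtain i where i: "i < N" "g = s [^]\<^sub>S i" unfolding set_pows by auto
      then show "\<one>\<^sub>S \<otimes>\<^sub>S g \<in> fspan (carrier R) (pows t N)"
        using s_pow[of i] fspan_pows_mono[OF R.oneideal t, of "Suc i" N] s_closed by auto
    qed (rule R.ideal_closed(6)[OF m_ideal])
    then show ?thesis using mB_closed[OF v] by simp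
  qed
  \<comment> \<open>K \<ge> k keeps t^K in m R[s], K \<ge> N makes its expansion involve only lower
    powers of t, and K \<ge> 1 ensures a positive degree.\<close>
  define K where "K = max (max k N) 1"
  have K: "k \<le> K" "N \<le> K" "1 \<le> K" unfolding K_def by auto
  have "t [^]\<^sub>S K = t [^]\<^sub>S (K - k) \<otimes>\<^sub>S t [^]\<^sub>S k"
    using t K by (simp add: S.nat_pow_mult)
  also have "\<dots> \<in> ext \<mm>" by (rule mB_mult(2)[OF k[folded t_def] pow_mem_B[OF tB]])
  finally have "t [^]\<^sub>S K \<in> fspan \<mm> (pows t N)" by (rule ext_sub)
  then have "t [^]\<^sub>S K \<in> fspan \<mm> (pows t K)"
    using fspan_pows_mono[OF m_ideal t K(2)] by auto
  then show ?thesis using c K(3) unfolding t_def by (intro bexI[of _ c] exI[of _ K]) auto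
qed

end

section \<open>Polynomial rings and evaluation\<close>

text \<open>This makes the convolution in \<open>mpoly_ring\<close> a finite sum: exponents below m
  vanish wherever m does.\<close>

lemma finite_le_monomial:
  assumes "m \<in> monomials r"
  shows "finite {a. a \<le> m}"
proof (rule finite_subset)
  show "{a. a \<le> m} \<subseteq> {a. \<forall>i. (i \<in> {..<r} \<longrightarrow> a i \<in> {..Max (m ` {..<r})}) \<and> (i \<notin> {..<r} \<longrightarrow> a i = 0)}"
  proof (intro subsetI CollectI allI conjI impI)
    fix a i assume a: "a \<in> {a. a \<le> m}"
    then have ai: "a i \<le> m i" by (simp add: le_fun_def)
    show "a i \<in> {..Max (m ` {..<r})}" if "i \<in> {..<r}"
      using le_trans[OF ai Max_ge[of "m ` {..<r}" "m i"]] that by simp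
    show "a i = 0" if "i \<notin> {..<r}" using ai that assms by (auto simp: monomials_def)
  qed
  show "finite {a. \<forall>i. (i \<in> {..<r} \<longrightarrow> a i \<in> {..Max (m ` {..<r})}) \<and> (i \<notin> {..<r} \<longrightarrow> a i = (0::nat))}"
    by (rule finite_set_of_finite_funs) auto
qed

lemma monomials_add: "a \<in> monomials r \<Longrightarrow> b \<in> monomials r \<Longrightarrow> (\<lambda>i. a i + b i) \<in> monomials r"
  by (simp add: monomials_def)

locale mpoly_cring = cring R for R (structure) + fixes r :: nat
begin

abbreviation "P \<equiv> mpoly_ring R r"

definition mterm :: "'a \<Rightarrow> (nat \<Rightarrow> nat) \<Rightarrow> ((nat \<Rightarrow> nat) \<Rightarrow> 'a)" where
  "mterm c a = (\<lambda>m. if m = a then c else \<zero>)"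

lemma mp_const_eq_mterm: "mp_const R c = mterm c (\<lambda>i. 0)"
  by (simp add: mp_const_def mterm_def)

lemma mp_var_eq_mterm: "mp_var R i = mterm \<one> (\<lambda>j. if j = i then 1 else 0)"
  by (simp add: mp_var_def mterm_def)

lemma P_simps:
  "p \<oplus>\<^bsub>P\<^esub> q = (\<lambda>m. p m \<oplus> q m)" "\<zero>\<^bsub>P\<^esub> = (\<lambda>m. \<zero>)" "\<one>\<^bsub>P\<^esub> = mterm \<one> (\<lambda>i. 0)"
  by (simp_all add: mpoly_ring_def mterm_def)

lemma P_mult: "(p \<otimes>\<^bsub>P\<^esub> q) m = (if m \<in> monomials r
    then (\<Oplus>a\<in>{a. a \<le> m}. p a \<otimes> q (\<lambda>i. m i - a i)) else \<zero>)"
  by (simp add: mpoly_ring_def)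

lemma P_carrier: "p \<in> carrier P \<longleftrightarrow>
    (\<forall>m. p m \<in> carrier R) \<and> (\<forall>m. m \<notin> monomials r \<longrightarrow> p m = \<zero>) \<and> finite {m. p m \<noteq> \<zero>}"
  by (simp add: mpoly_ring_def)

lemma P_coeff: "p \<in> carrier P \<Longrightarrow> p m \<in> carrier R"
  by (simp add: P_carrier)

lemma mterm_carrier:
  assumes "c \<in> carrier R" "a \<in> monomials r"
  shows "mterm c a \<in> carrier P"
proof -
  have "finite {m. mterm c a m \<noteq> \<zero>}"
    by (rule finite_subset[of _ "{a}"]) (auto simp: mterm_def)
  then show ?thesis using assms unfolding P_carrier mterm_def by auto
qed

lemma P_add_closed:
  assumes "p \<in> carrier P" "q \<in> carrier P"
  shows "p \<oplus>\<^bsub>P\<^esub> q \<in> carrier P"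
proof -
  have "finite {m. p m \<oplus> q m \<noteq> \<zero>}"
    by (rule finite_subset[of _ "{m. p m \<noteq> \<zero>} \<union> {m. q m \<noteq> \<zero>}"]) (use assms in \<open>auto simp: P_carrier\<close>)
  then show ?thesis using assms by (simp add: P_carrier P_simps)
qed

lemma P_mult_closed:
  assumes p: "p \<in> carrier P" and q: "q \<in> carrier P"
  shows "p \<otimes>\<^bsub>P\<^esub> q \<in> carrier P"
proof -
  let ?A = "{m. p m \<noteq> \<zero>}" and ?B = "{m. q m \<noteq> \<zero>}"
  have fin: "finite ?A" "finite ?B" using p q by (auto simp: P_carrier)
  have "{m. (p \<otimes>\<^bsub>P\<^esub> q) m \<noteq> \<zero>} \<subseteq> (\<lambda>(a, b) i. a i + b i) ` (?A \<times> ?B)"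
  proof
    fix m assume "m \<in> {m. (p \<otimes>\<^bsub>P\<^esub> q) m \<noteq> \<zero>}"
    then have m: "m \<in> monomials r" "(\<Oplus>a\<in>{a. a \<le> m}. p a \<otimes> q (\<lambda>i. m i - a i)) \<noteq> \<zero>"
      by (auto simp: P_mult split: if_splits)
    obtain a where a: "a \<le> m" "p a \<otimes> q (\<lambda>i. m i - a i) \<noteq> \<zero>"
    proof (rule ccontr)
      assume "\<not> thesis"
      then have "(\<Oplus>a\<in>{a. a \<le> m}. p a \<otimes> q (\<lambda>i. m i - a i)) = (\<Oplus>a\<in>{a. a \<le> m}. \<zero>)"
        using that by (intro finsum_cong') auto
      then show False using m(2) by simp
    qed
    then have "p a \<noteq> \<zero>" "q (\<lambda>i. m i - a i) \<noteq> \<zero>" using P_coeff[OF p] P_coeff[OF q] by auto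
    moreover have "m = (\<lambda>i. a i + (m i - a i))" using a(1) by (auto simp: le_fun_def)
    ultimately show "m \<in> (\<lambda>(a, b) i. a i + b i) ` (?A \<times> ?B)"
      by (intro image_eqI[of _ _ "(a, \<lambda>i. m i - a i)"]) auto
  qed
  then have "finite {m. (p \<otimes>\<^bsub>P\<^esub> q) m \<noteq> \<zero>}" by (rule finite_subset) (use fin in auto)
  then show ?thesis
    unfolding P_carrier using P_coeff[OF p] P_coeff[OF q]
    by (auto simp: P_mult intro!: finsum_closed)
qed

lemma P_l_distr:
  assumes "p \<in> carrier P" "q \<in> carrier P" "s \<in> carrier P"
  shows "(p \<oplus>\<^bsub>P\<^esub> q) \<otimes>\<^bsub>P\<^esub> s = p \<otimes>\<^bsub>P\<^esub> s \<oplus>\<^bsub>P\<^esub> q \<otimes>\<^bsub>P\<^esub> s"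
proof
  fix m
  note c = P_coeff[OF assms(1)] P_coeff[OF assms(2)] P_coeff[OF assms(3)]
  have "(\<Oplus>a\<in>{a. a \<le> m}. (p a \<oplus> q a) \<otimes> s (\<lambda>i. m i - a i))
      = (\<Oplus>a\<in>{a. a \<le> m}. p a \<otimes> s (\<lambda>i. m i - a i) \<oplus> q a \<otimes> s (\<lambda>i. m i - a i))"
    by (rule finsum_cong') (use c in \<open>auto simp: l_distr\<close>)
  also have "\<dots> = (\<Oplus>a\<in>{a. a \<le> m}. p a \<otimes> s (\<lambda>i. m i - a i)) \<oplus> (\<Oplus>a\<in>{a. a \<le> m}. q a \<otimes> s (\<lambda>i. m i - a i))"
    by (rule finsum_addf) (use c in auto)
  finally show "((p \<oplus>\<^bsub>P\<^esub> q) \<otimes>\<^bsub>P\<^esub> s) m = (p \<otimes>\<^bsub>P\<^esub> s \<oplus>\<^bsub>P\<^esub> q \<otimes>\<^bsub>P\<^esub> s) m"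
    by (simp add: P_mult P_simps(1))
qed

lemma P_r_distr:
  assumes "p \<in> carrier P" "q \<in> carrier P" "s \<in> carrier P"
  shows "s \<otimes>\<^bsub>P\<^esub> (p \<oplus>\<^bsub>P\<^esub> q) = s \<otimes>\<^bsub>P\<^esub> p \<oplus>\<^bsub>P\<^esub> s \<otimes>\<^bsub>P\<^esub> q"
proof
  fix m
  note c = P_coeff[OF assms(1)] P_coeff[OF assms(2)] P_coeff[OF assms(3)]
  have "(\<Oplus>a\<in>{a. a \<le> m}. s a \<otimes> (p (\<lambda>i. m i - a i) \<oplus> q (\<lambda>i. m i - a i)))
      = (\<Oplus>a\<in>{a. a \<le> m}. s a \<otimes> p (\<lambda>i. m i - a i) \<oplus> s a \<otimes> q (\<lambda>i. m i - a i))"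
    by (rule finsum_cong') (use c in \<open>auto simp: r_distr\<close>)
  also have "\<dots> = (\<Oplus>a\<in>{a. a \<le> m}. s a \<otimes> p (\<lambda>i. m i - a i)) \<oplus> (\<Oplus>a\<in>{a. a \<le> m}. s a \<otimes> q (\<lambda>i. m i - a i))"
    by (rule finsum_addf) (use c in auto)
  finally show "(s \<otimes>\<^bsub>P\<^esub> (p \<oplus>\<^bsub>P\<^esub> q)) m = (s \<otimes>\<^bsub>P\<^esub> p \<oplus>\<^bsub>P\<^esub> s \<otimes>\<^bsub>P\<^esub> q) m"
    by (simp add: P_mult P_simps(1))
qed

lemma P_zero_mult:
  assumes "p \<in> carrier P"
  shows "\<zero>\<^bsub>P\<^esub> \<otimes>\<^bsub>P\<^esub> p = \<zero>\<^bsub>P\<^esub>" "p \<otimes>\<^bsub>P\<^esub> \<zero>\<^bsub>P\<^esub> = \<zero>\<^bsub>P\<^esub>"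
  using P_coeff[OF assms] by (auto simp: fun_eq_iff P_mult P_simps(2))

lemma mterm_mult:
  assumes c: "c \<in> carrier R" "d \<in> carrier R" and a: "a \<in> monomials r" and b: "b \<in> monomials r"
  shows "mterm c a \<otimes>\<^bsub>P\<^esub> mterm d b = mterm (c \<otimes> d) (\<lambda>i. a i + b i)"
proof
  fix m
  show "(mterm c a \<otimes>\<^bsub>P\<^esub> mterm d b) m = mterm (c \<otimes> d) (\<lambda>i. a i + b i) m"
  proof (cases "m \<in> monomials r")
    case False
    then have "m \<noteq> (\<lambda>i. a i + b i)" using monomials_add[OF a b] by auto
    then show ?thesis using False by (simp add: P_mult mterm_def)
  next
    case True
    have eq: "(mterm c a \<otimes>\<^bsub>P\<^esub> mterm d b) m
        = (\<Oplus>x\<in>{x. x \<le> m}. if a = x then c \<otimes> mterm d b (\<lambda>i. m i - x i) else \<zero>)"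
      using True c unfolding P_mult by (auto intro!: finsum_cong' simp: mterm_def)
    show ?thesis
    proof (cases "a \<le> m")
      case le: True
      then have "(\<lambda>i. m i - a i) = b \<longleftrightarrow> m = (\<lambda>i. a i + b i)"
        by (auto simp: fun_eq_iff le_fun_def) (metis le_add_diff_inverse)
      moreover have "(mterm c a \<otimes>\<^bsub>P\<^esub> mterm d b) m = c \<otimes> mterm d b (\<lambda>i. m i - a i)"
        unfolding eq by (rule finsum_singleton[OF _ finite_le_monomial[OF True]]) (use le c in \<open>auto simp: mterm_def\<close>)
      ultimately show ?thesis using c by (auto simp: mterm_def)
    next
      case nle: False
      then have "m \<noteq> (\<lambda>i. a i + b i)" by (auto simp: le_fun_def)
      moreover have "(mterm c a \<otimes>\<^bsub>P\<^esub> mterm d b) m = (\<Oplus>x\<in>{x. x \<le> m}. \<zero>)"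
        unfolding eq by (rule finsum_cong') (use nle in auto)
      ultimately show ?thesis by (simp add: mterm_def)
    qed
  qed
qed

text \<open>Polynomials are built by adding single terms. Distributivity then reduces the laws of
  multiplication, and later the multiplicativity of evaluation, to terms, where they are laws of
  exponents.\<close>

lemma mpoly_induct [consumes 1, case_names zero add]:
  assumes p: "p \<in> carrier P" and zero: "Q \<zero>\<^bsub>P\<^esub>"
    and add: "\<And>c a p. c \<in> carrier R \<Longrightarrow> a \<in> monomials r \<Longrightarrow> p \<in> carrier P \<Longrightarrow> Q p
      \<Longrightarrow> Q (mterm c a \<oplus>\<^bsub>P\<^esub> p)"
  shows "Q p"
proof -
  have "Q p" if "finite A" "p \<in> carrier P" "{m. p m \<noteq> \<zero>} \<subseteq> A" for A p
    using that
  proof (induction A arbitrary: p)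
    case empty
    then have "p = \<zero>\<^bsub>P\<^esub>" by (auto simp: P_simps(2))
    then show ?case using zero by simp
  next
    case (insert a A)
    show ?case
    proof (cases "p a = \<zero>")
      case True
      then show ?thesis using insert by auto
    next
      case False
      define q where "q = p(a := \<zero>)"
      have a: "a \<in> monomials r" using False insert.prems(1) by (auto simp: P_carrier)
      have "finite {m. q m \<noteq> \<zero>}"
        by (rule finite_subset[of _ "{m. p m \<noteq> \<zero>}"]) (use insert.prems(1) in \<open>auto simp: q_def P_carrier\<close>)
      then have q: "q \<in> carrier P" using insert.prems(1) by (auto simp: P_carrier q_def)
      have "Q q" by (rule insert.IH[OF q]) (use insert.prems(2) in \<open>auto simp: q_def\<close>)
      moreover have "p = mterm (p a) a \<oplus>\<^bsub>P\<^esub> q"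
        using P_coeff[OF insert.prems(1)] by (auto simp: P_simps(1) mterm_def q_def)
      ultimately show ?thesis using add[OF P_coeff[OF insert.prems(1)] a q] by metis
    qed
  qed
  then show ?thesis using p by (auto simp: P_carrier)
qed

lemma P_zero_closed: "\<zero>\<^bsub>P\<^esub> \<in> carrier P"
  by (simp add: P_carrier P_simps(2))

lemma P_abelian_group: "abelian_group P"
proof (rule abelian_groupI)
  fix p assume p: "p \<in> carrier P"
  have eq: "{m. \<ominus> p m \<noteq> \<zero>} = {m. p m \<noteq> \<zero>}" using P_coeff[OF p] by auto
  have "(\<lambda>m. \<ominus> p m) \<in> carrier P" using p eq by (simp add: P_carrier)
  moreover have "(\<lambda>m. \<ominus> p m) \<oplus>\<^bsub>P\<^esub> p = \<zero>\<^bsub>P\<^esub>"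
    using P_coeff[OF p] by (simp add: P_simps l_neg)
  ultimately show "\<exists>q\<in>carrier P. q \<oplus>\<^bsub>P\<^esub> p = \<zero>\<^bsub>P\<^esub>" by auto
  show "\<zero>\<^bsub>P\<^esub> \<oplus>\<^bsub>P\<^esub> p = p" using P_coeff[OF p] by (simp add: P_simps)
next
  fix p q s assume "p \<in> carrier P" "q \<in> carrier P" "s \<in> carrier P"
  note c = this[THEN P_coeff]
  show "p \<oplus>\<^bsub>P\<^esub> q \<oplus>\<^bsub>P\<^esub> s = p \<oplus>\<^bsub>P\<^esub> (q \<oplus>\<^bsub>P\<^esub> s)" using c by (simp add: P_simps a_assoc)
next
  fix p q assume "p \<in> carrier P" "q \<in> carrier P"
  note c = this[THEN P_coeff]
  show "p \<oplus>\<^bsub>P\<^esub> q = q \<oplus>\<^bsub>P\<^esub> p" using c by (simp add: P_simps a_comm)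
qed (auto intro: P_add_closed P_zero_closed)

lemma P_comm:
  assumes "p \<in> carrier P" "q \<in> carrier P"
  shows "p \<otimes>\<^bsub>P\<^esub> q = q \<otimes>\<^bsub>P\<^esub> p"
  using assms
proof (induction p rule: mpoly_induct)
  case zero
  then show ?case by (simp add: P_zero_mult)
next
  case (add c a p)
  have "mterm c a \<otimes>\<^bsub>P\<^esub> q = q \<otimes>\<^bsub>P\<^esub> mterm c a"
    using add.prems
  proof (induction q rule: mpoly_induct)
    case zero
    then show ?case using mterm_carrier add.hyps by (simp add: P_zero_mult)
  next
    case (add d b q)
    have "mterm c a \<otimes>\<^bsub>P\<^esub> mterm d b = mterm d b \<otimes>\<^bsub>P\<^esub> mterm c a"
      using add.hyps(1,2) \<open>c \<in> carrier R\<close> \<open>a \<in> monomials r\<close> by (simp add: mterm_mult m_comm add.commute)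
    then show ?case using add mterm_carrier \<open>c \<in> carrier R\<close> \<open>a \<in> monomials r\<close> by (simp add: P_l_distr P_r_distr)
  qed
  then show ?case using add mterm_carrier by (simp add: P_l_distr P_r_distr)
qed

lemma P_assoc:
  assumes "p \<in> carrier P" "q \<in> carrier P" "s \<in> carrier P"
  shows "p \<otimes>\<^bsub>P\<^esub> q \<otimes>\<^bsub>P\<^esub> s = p \<otimes>\<^bsub>P\<^esub> (q \<otimes>\<^bsub>P\<^esub> s)"
  using assms
proof (induction p rule: mpoly_induct)
  case zero
  then show ?case by (simp add: P_zero_mult P_mult_closed)
next
  case (add c a p)
  note ca = \<open>c \<in> carrier R\<close> \<open>a \<in> monomials r\<close>
  have "mterm c a \<otimes>\<^bsub>P\<^esub> q \<otimes>\<^bsub>P\<^esub> s = mterm c a \<otimes>\<^bsub>P\<^esub> (q \<otimes>\<^bsub>P\<^esub> s)"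
    using add.prems
  proof (induction q rule: mpoly_induct)
    case zero
    then show ?case using mterm_carrier[OF ca] by (simp add: P_zero_mult P_mult_closed)
  next
    case (add d b q)
    note db = \<open>d \<in> carrier R\<close> \<open>b \<in> monomials r\<close>
    have "mterm c a \<otimes>\<^bsub>P\<^esub> mterm d b \<otimes>\<^bsub>P\<^esub> s = mterm c a \<otimes>\<^bsub>P\<^esub> (mterm d b \<otimes>\<^bsub>P\<^esub> s)"
      using add.prems
    proof (induction s rule: mpoly_induct)
      case zero
      then show ?case using mterm_carrier[OF ca] mterm_carrier[OF db] by (simp add: P_zero_mult P_mult_closed)
    next
      case (add e f s)
      note ef = \<open>e \<in> carrier R\<close> \<open>f \<in> monomials r\<close>
      have "mterm c a \<otimes>\<^bsub>P\<^esub> mterm d b \<otimes>\<^bsub>P\<^esub> mterm e f = mterm c a \<otimes>\<^bsub>P\<^esub> (mterm d b \<otimes>\<^bsub>P\<^esub> mterm e f)"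
        using ca db ef by (simp add: mterm_mult monomials_add m_assoc add.assoc)
      then show ?case
        using add mterm_carrier[OF ca] mterm_carrier[OF db] mterm_carrier[OF ef]
        by (simp add: P_r_distr P_mult_closed)
    qed
    then show ?case
      using add mterm_carrier[OF ca] mterm_carrier[OF db]
      by (simp add: P_r_distr P_l_distr P_mult_closed)
  qed
  then show ?case using add mterm_carrier[OF ca] by (simp add: P_l_distr P_mult_closed)
qed

lemma zero_monomial: "(\<lambda>i. 0) \<in> monomials r"
  by (simp add: monomials_def)

lemma P_l_one:
  assumes "p \<in> carrier P"
  shows "\<one>\<^bsub>P\<^esub> \<otimes>\<^bsub>P\<^esub> p = p"
  using assms
proof (induction p rule: mpoly_induct)
  case zero
  show ?case unfolding P_simps(3) by (rule P_zero_mult(2)[OF mterm_carrier[OF one_closed zero_monomial]])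
next
  case (add c a p)
  then show ?case
    using mterm_carrier[OF one_closed zero_monomial] mterm_carrier[OF add(1,2)]
    by (simp add: P_simps(3) P_r_distr mterm_mult zero_monomial)
qed

lemma P_cring: "cring P"
proof (rule cringI[OF P_abelian_group])
  have "\<one>\<^bsub>P\<^esub> \<in> carrier P" by (simp add: P_simps(3) mterm_carrier zero_monomial)
  then show "comm_monoid P"
    by (intro comm_monoidI) (auto intro: P_mult_closed P_assoc P_l_one P_comm)
qed (rule P_l_distr)

sublocale P: cring P by (rule P_cring)

lemma mp_const_hom: "ring_hom_cring R P (mp_const R)"
proof -
  have "mp_const R \<in> ring_hom R P"
  proof (rule ring_hom_memI)
    fix x y assume xy: "x \<in> carrier R" "y \<in> carrier R"
    show "mp_const R x \<in> carrier P" unfolding mp_const_eq_mterm by (rule mterm_carrier[OF xy(1) zero_monomial])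
    show "mp_const R (x \<otimes> y) = mp_const R x \<otimes>\<^bsub>P\<^esub> mp_const R y"
      unfolding mp_const_eq_mterm using xy by (simp add: mterm_mult zero_monomial)
    show "mp_const R (x \<oplus> y) = mp_const R x \<oplus>\<^bsub>P\<^esub> mp_const R y"
      unfolding mp_const_eq_mterm P_simps(1) mterm_def by auto
  next
    show "mp_const R \<one> = \<one>\<^bsub>P\<^esub>" unfolding mp_const_eq_mterm P_simps(3) ..
  qed
  then show ?thesis
    by (intro ring_hom_cring.intro ring_hom_cring_axioms.intro is_cring P_cring)
qed

lemma var_monomial: "i < r \<Longrightarrow> (\<lambda>j. if j = i then k else 0) \<in> monomials r"
  by (auto simp: monomials_def)

lemma mp_var_closed: "i < r \<Longrightarrow> mp_var R i \<in> carrier P"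
  unfolding mp_var_eq_mterm by (rule mterm_carrier[OF one_closed var_monomial])

lemma mp_var_pow:
  assumes "i < r"
  shows "mp_var R i [^]\<^bsub>P\<^esub> (k::nat) = mterm \<one> (\<lambda>j. if j = i then k else 0)"
proof (induction k)
  case 0
  have "(\<lambda>j. if j = i then 0 else 0) = (\<lambda>j. 0::nat)" by auto
  then show ?case using P_simps(3) by simp
next
  case (Suc k)
  have eq: "(\<lambda>j. (if j = i then k else 0) + (if j = i then 1 else 0)) = (\<lambda>j. if j = i then Suc k else 0)" by auto
  have "mp_var R i [^]\<^bsub>P\<^esub> Suc k = mterm \<one> (\<lambda>j. if j = i then k else 0) \<otimes>\<^bsub>P\<^esub> mterm \<one> (\<lambda>j. if j = i then 1 else 0)"
    using Suc by (simp add: mp_var_eq_mterm)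
  also have "\<dots> = mterm \<one> (\<lambda>j. if j = i then Suc k else 0)"
    using mterm_mult[OF one_closed one_closed var_monomial[OF assms] var_monomial[OF assms], of k 1] eq by simp
  finally show ?case .
qed

lemma mterm_eq_const_mult:
  assumes "c \<in> carrier R" "a \<in> monomials r"
  shows "mterm c a = mp_const R c \<otimes>\<^bsub>P\<^esub> mterm \<one> a"
  unfolding mp_const_eq_mterm using assms by (simp add: mterm_mult zero_monomial)

end

locale mpoly_eval = mpoly_cring R r + ring_hom_cring R S h for R (structure) and S (structure) and h and r +
  fixes t :: "nat \<Rightarrow> 'c"
  assumes t_closed: "\<And>i. i < r \<Longrightarrow> t i \<in> carrier S"
begin

definition mon :: "(nat \<Rightarrow> nat) \<Rightarrow> 'c" where
  "mon m = (\<Otimes>\<^bsub>S\<^esub>i\<in>{..<r}. t i [^]\<^bsub>S\<^esub> m i)"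

definition ev :: "((nat \<Rightarrow> nat) \<Rightarrow> 'a) \<Rightarrow> 'c" where
  "ev p = (\<Oplus>\<^bsub>S\<^esub>m\<in>{m. p m \<noteq> \<zero>}. h (p m) \<otimes>\<^bsub>S\<^esub> mon m)"

lemma mon_closed: "mon m \<in> carrier S"
  unfolding mon_def using t_closed by (auto intro!: S.finprod_closed)

lemma mon_add: "mon (\<lambda>i. a i + b i) = mon a \<otimes>\<^bsub>S\<^esub> mon b"
proof -
  have "mon (\<lambda>i. a i + b i) = (\<Otimes>\<^bsub>S\<^esub>i\<in>{..<r}. t i [^]\<^bsub>S\<^esub> a i \<otimes>\<^bsub>S\<^esub> t i [^]\<^bsub>S\<^esub> b i)"
    unfolding mon_def by (rule S.finprod_cong') (use t_closed in \<open>auto simp: S.nat_pow_mult\<close>)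
  also have "\<dots> = mon a \<otimes>\<^bsub>S\<^esub> mon b"
    unfolding mon_def by (rule S.finprod_multf) (use t_closed in auto)
  finally show ?thesis .
qed

lemma mon_zero: "mon (\<lambda>i. 0) = \<one>\<^bsub>S\<^esub>"
  unfolding mon_def by simp

lemma mon_var:
  assumes "i < r"
  shows "mon (\<lambda>j. if j = i then 1 else 0) = t i"
proof -
  have "mon (\<lambda>j. if j = i then 1 else 0) = (\<Otimes>\<^bsub>S\<^esub>j\<in>{..<r}. if i = j then t j else \<one>\<^bsub>S\<^esub>)"
    unfolding mon_def by (rule S.finprod_cong') (use t_closed in auto)
  also have "\<dots> = t i" by (rule S.finprod_singleton) (use assms t_closed in auto)
  finally show ?thesis .
qed

text \<open>Evaluation sums over the support, which changes under addition; a common index set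
  allows sums to be compared termwise.\<close>

lemma ev_superset:
  assumes "p \<in> carrier P" "finite A" "{m. p m \<noteq> \<zero>} \<subseteq> A"
  shows "ev p = (\<Oplus>\<^bsub>S\<^esub>m\<in>A. h (p m) \<otimes>\<^bsub>S\<^esub> mon m)"
  unfolding ev_def
  by (rule S.add.finprod_mono_neutral_cong_left)
    (use assms P_coeff[OF assms(1)] mon_closed in auto)

lemma ev_closed: "p \<in> carrier P \<Longrightarrow> ev p \<in> carrier S"
  unfolding ev_def using P_coeff mon_closed by (auto intro!: S.finsum_closed)

lemma ev_add:
  assumes "p \<in> carrier P" "q \<in> carrier P"
  shows "ev (p \<oplus>\<^bsub>P\<^esub> q) = ev p \<oplus>\<^bsub>S\<^esub> ev q"
proof -
  let ?A = "{m. p m \<noteq> \<zero>} \<union> {m. q m \<noteq> \<zero>}"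
  have A: "finite ?A" using assms by (auto simp: P_carrier)
  note c = P_coeff[OF assms(1)] P_coeff[OF assms(2)] mon_closed
  have "ev (p \<oplus>\<^bsub>P\<^esub> q) = (\<Oplus>\<^bsub>S\<^esub>m\<in>?A. h ((p \<oplus>\<^bsub>P\<^esub> q) m) \<otimes>\<^bsub>S\<^esub> mon m)"
    by (rule ev_superset[OF P_add_closed[OF assms] A]) (auto simp: P_simps)
  also have "\<dots> = (\<Oplus>\<^bsub>S\<^esub>m\<in>?A. h (p m) \<otimes>\<^bsub>S\<^esub> mon m \<oplus>\<^bsub>S\<^esub> h (q m) \<otimes>\<^bsub>S\<^esub> mon m)"
    by (rule S.finsum_cong') (use c in \<open>auto simp: P_simps S.l_distr\<close>)
  also have "\<dots> = (\<Oplus>\<^bsub>S\<^esub>m\<in>?A. h (p m) \<otimes>\<^bsub>S\<^esub> mon m) \<oplus>\<^bsub>S\<^esub> (\<Oplus>\<^bsub>S\<^esub>m\<in>?A. h (q m) \<otimes>\<^bsub>S\<^esub> mon m)"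
    by (rule S.finsum_addf) (use c in auto)
  also have "\<dots> = ev p \<oplus>\<^bsub>S\<^esub> ev q"
    using ev_superset[OF assms(1) A] ev_superset[OF assms(2) A] by simp
  finally show ?thesis .
qed

lemma ev_mterm:
  assumes "c \<in> carrier R" "a \<in> monomials r"
  shows "ev (mterm c a) = h c \<otimes>\<^bsub>S\<^esub> mon a"
proof -
  have "ev (mterm c a) = (\<Oplus>\<^bsub>S\<^esub>m\<in>{a}. h (mterm c a m) \<otimes>\<^bsub>S\<^esub> mon m)"
    by (rule ev_superset[OF mterm_carrier[OF assms]]) (auto simp: mterm_def)
  then show ?thesis using assms mon_closed by (simp add: mterm_def)
qed

lemma ev_zero: "ev \<zero>\<^bsub>P\<^esub> = \<zero>\<^bsub>S\<^esub>"
  by (simp add: ev_def P_simps)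

lemma ev_mult:
  assumes "p \<in> carrier P" "q \<in> carrier P"
  shows "ev (p \<otimes>\<^bsub>P\<^esub> q) = ev p \<otimes>\<^bsub>S\<^esub> ev q"
  using assms
proof (induction p rule: mpoly_induct)
  case zero
  then show ?case by (simp add: P_zero_mult ev_zero ev_closed)
next
  case (add c a p)
  note ca = \<open>c \<in> carrier R\<close> \<open>a \<in> monomials r\<close>
  have "ev (mterm c a \<otimes>\<^bsub>P\<^esub> q) = ev (mterm c a) \<otimes>\<^bsub>S\<^esub> ev q"
    using add.prems
  proof (induction q rule: mpoly_induct)
    case zero
    then show ?case using mterm_carrier[OF ca] by (simp add: P_zero_mult ev_zero ev_closed)
  next
    case (add d b q)
    note db = \<open>d \<in> carrier R\<close> \<open>b \<in> monomials r\<close>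
    have "h (c \<otimes> d) \<otimes>\<^bsub>S\<^esub> (mon a \<otimes>\<^bsub>S\<^esub> mon b) = (h c \<otimes>\<^bsub>S\<^esub> mon a) \<otimes>\<^bsub>S\<^esub> (h d \<otimes>\<^bsub>S\<^esub> mon b)"
      unfolding hom_mult[OF ca(1) db(1)]
      using hom_closed[OF ca(1)] hom_closed[OF db(1)] mon_closed[of a] mon_closed[of b] by algebra
    then have "ev (mterm c a \<otimes>\<^bsub>P\<^esub> mterm d b) = ev (mterm c a) \<otimes>\<^bsub>S\<^esub> ev (mterm d b)"
      using ca db by (simp add: mterm_mult ev_mterm monomials_add mon_add)
    then show ?case
      using add mterm_carrier[OF ca] mterm_carrier[OF db]
      by (simp add: P_r_distr ev_add P_mult_closed S.r_distr ev_closed)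
  qed
  then show ?case
    using add mterm_carrier[OF ca] by (simp add: P_l_distr ev_add P_mult_closed S.l_distr ev_closed)
qed

lemma ev_hom: "ring_hom_cring P S ev"
proof -
  have "ev \<in> ring_hom P S"
    by (rule ring_hom_memI)
      (auto simp: ev_closed ev_mult ev_add P_simps(3) ev_mterm zero_monomial mon_zero)
  then show ?thesis
    by (intro ring_hom_cring.intro ring_hom_cring_axioms.intro S.is_cring P_cring)
qed

lemma ev_const: "c \<in> carrier R \<Longrightarrow> ev (mp_const R c) = h c"
  unfolding mp_const_eq_mterm by (simp add: ev_mterm zero_monomial mon_zero)

lemma ev_var: "i < r \<Longrightarrow> ev (mp_var R i) = t i"
  unfolding mp_var_eq_mterm using mon_var t_closed by (simp add: ev_mterm var_monomial)

end

section \<open>Quotients by monic polynomials\<close>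

locale mpoly_quot = mpoly_cring R r for R (structure) and r +
  fixes n :: "nat \<Rightarrow> nat" and a :: "nat \<Rightarrow> nat \<Rightarrow> 'a"
  assumes a_closed: "\<And>i j. i < r \<Longrightarrow> j \<in> {1..n i} \<Longrightarrow> a i j \<in> carrier R"
begin

abbreviation "f i \<equiv> monic_in_var R r i (n i) (a i)"

definition I0 :: "((nat \<Rightarrow> nat) \<Rightarrow> 'a) set" where
  "I0 = Idl\<^bsub>P\<^esub> {f i | i. i < r}"

abbreviation "T \<equiv> T_ring R r n a"

lemma T_eq: "T = P Quot I0"
  unfolding T_ring_def I0_def ..

sublocale const: ring_hom_cring R P "mp_const R" by (rule mp_const_hom)

lemma f_eq: "f i = mp_var R i [^]\<^bsub>P\<^esub> n i \<oplus>\<^bsub>P\<^esub>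
    (\<Oplus>\<^bsub>P\<^esub>j\<in>{1..n i}. mp_const R (a i j) \<otimes>\<^bsub>P\<^esub> mp_var R i [^]\<^bsub>P\<^esub> (n i - j))"
  unfolding monic_in_var_def Let_def ..

lemma f_closed: "i < r \<Longrightarrow> f i \<in> carrier P"
  unfolding f_eq using a_closed mp_var_closed by (auto intro!: P.finsum_closed P.a_closed P.m_closed)

lemma I0_ideal: "ideal I0 P"
  unfolding I0_def by (rule P.genideal_ideal) (use f_closed in auto)

lemma f_mem_I0: "i < r \<Longrightarrow> f i \<in> I0"
  unfolding I0_def using P.genideal_self[of "{f i | i. i < r}"] f_closed by blast

definition pr :: "((nat \<Rightarrow> nat) \<Rightarrow> 'a) \<Rightarrow> ((nat \<Rightarrow> nat) \<Rightarrow> 'a) set" where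
  "pr p = I0 +>\<^bsub>P\<^esub> p"

sublocale pr: ring_hom_cring P T pr
  unfolding T_eq pr_def using ideal.rcos_ring_hom_cring[OF I0_ideal P_cring] by simp

lemma T_cring: "cring T" by (rule pr.S.is_cring)

lemma T_elem: "x \<in> carrier T \<Longrightarrow> \<exists>p\<in>carrier P. x = pr p"
  unfolding T_eq FactRing_def A_RCOSETS_def' pr_def by auto

lemma pr_eq_iff: "p \<in> carrier P \<Longrightarrow> q \<in> carrier P \<Longrightarrow> pr p = pr q \<longleftrightarrow> p \<ominus>\<^bsub>P\<^esub> q \<in> I0"
  unfolding pr_def using P.quotient_eq_iff_same_a_r_cos[OF I0_ideal] by simp

lemma pr_I0:
  assumes "p \<in> I0"
  shows "pr p = \<zero>\<^bsub>T\<^esub>"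
proof -
  have p: "p \<in> carrier P" by (rule P.ideal_closed(1)[OF I0_ideal assms])
  then have "pr p = pr \<zero>\<^bsub>P\<^esub>" using pr_eq_iff[OF p P.zero_closed] assms by (simp add: a_minus_def)
  then show ?thesis by simp
qed

definition hT :: "'a \<Rightarrow> ((nat \<Rightarrow> nat) \<Rightarrow> 'a) set" where
  "hT c = pr (mp_const R c)"

sublocale hT: ring_hom_cring R T hT
proof -
  have "hT \<in> ring_hom R T" unfolding hT_def by (rule ring_hom_memI) auto
  then show "ring_hom_cring R T hT"
    by (intro ring_hom_cring.intro ring_hom_cring_axioms.intro is_cring T_cring)
qed

text \<open>In T the i-th equation expresses the power n i of the variable by lower ones;
  multiplying by the remaining cofactor of the monomial m gives a rewriting rule that lowers the
  total degree.\<close>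

lemma pr_monomial_reduce:
  assumes i: "i < r" and m: "m \<in> monomials r" "n i \<le> m i"
  shows "pr (mterm \<one> m) = \<ominus>\<^bsub>T\<^esub> (\<Oplus>\<^bsub>T\<^esub>j\<in>{1..n i}. hT (a i j) \<otimes>\<^bsub>T\<^esub> pr (mterm \<one> (m(i := m i - j))))"
proof -
  define y where "y = pr (mp_var R i)"
  define m' where "m' = m(i := m i - n i)"
  have m': "m' \<in> monomials r" using m i unfolding m'_def monomials_def by auto
  define w where "w = pr (mterm \<one> m')"
  have y: "y \<in> carrier T" unfolding y_def using mp_var_closed[OF i] by simp
  have w: "w \<in> carrier T" unfolding w_def using mterm_carrier[OF one_closed m'] by simp
  have red: "pr (mterm \<one> (m(i := m i - j))) = w \<otimes>\<^bsub>T\<^esub> y [^]\<^bsub>T\<^esub> (n i - j)" if "j \<le> n i" for j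
  proof -
    have "(\<lambda>l. m' l + (if l = i then n i - j else 0)) = m(i := m i - j)"
      using that m(2) unfolding m'_def by auto
    then have "mterm \<one> (m(i := m i - j)) = mterm \<one> m' \<otimes>\<^bsub>P\<^esub> mp_var R i [^]\<^bsub>P\<^esub> (n i - j)"
      unfolding mp_var_pow[OF i] using mterm_mult[OF one_closed one_closed m' var_monomial[OF i]] by simp
    then show ?thesis
      unfolding w_def y_def using mterm_carrier[OF one_closed m'] mp_var_closed[OF i] by (simp add: pr.hom_pow)
  qed
  define s where "s = (\<Oplus>\<^bsub>T\<^esub>j\<in>{1..n i}. hT (a i j) \<otimes>\<^bsub>T\<^esub> y [^]\<^bsub>T\<^esub> (n i - j))"
  have s: "s \<in> carrier T" unfolding s_def using a_closed[OF i] y by (auto intro!: pr.S.finsum_closed)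
  have "pr (f i) = y [^]\<^bsub>T\<^esub> n i \<oplus>\<^bsub>T\<^esub> s"
  proof -
    have c: "(\<lambda>j. mp_const R (a i j) \<otimes>\<^bsub>P\<^esub> mp_var R i [^]\<^bsub>P\<^esub> (n i - j)) \<in> {1..n i} \<rightarrow> carrier P"
      using a_closed[OF i] mp_var_closed[OF i] by auto
    have "pr (\<Oplus>\<^bsub>P\<^esub>j\<in>{1..n i}. mp_const R (a i j) \<otimes>\<^bsub>P\<^esub> mp_var R i [^]\<^bsub>P\<^esub> (n i - j))
        = (\<Oplus>\<^bsub>T\<^esub>j\<in>{1..n i}. pr (mp_const R (a i j) \<otimes>\<^bsub>P\<^esub> mp_var R i [^]\<^bsub>P\<^esub> (n i - j)))"
      using pr.hom_finsum[OF c] by (simp add: comp_def)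
    also have "\<dots> = s"
      unfolding s_def y_def hT_def
      by (rule pr.S.finsum_cong') (use a_closed[OF i] mp_var_closed[OF i] in \<open>auto simp: pr.hom_pow\<close>)
    finally show ?thesis
      unfolding f_eq y_def using P.finsum_closed[OF c] mp_var_closed[OF i] by (simp add: pr.hom_pow)
  qed
  then have "y [^]\<^bsub>T\<^esub> n i \<oplus>\<^bsub>T\<^esub> s = \<zero>\<^bsub>T\<^esub>" using pr_I0[OF f_mem_I0[OF i]] by simp
  then have yn: "y [^]\<^bsub>T\<^esub> n i = \<ominus>\<^bsub>T\<^esub> s" using y s by (simp add: pr.S.minus_equality)
  have "pr (mterm \<one> m) = w \<otimes>\<^bsub>T\<^esub> y [^]\<^bsub>T\<^esub> n i" using red[of 0] by simp
  also have "\<dots> = \<ominus>\<^bsub>T\<^esub> (w \<otimes>\<^bsub>T\<^esub> s)" unfolding yn using w s by (simp add: pr.S.r_minus)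
  also have "w \<otimes>\<^bsub>T\<^esub> s = (\<Oplus>\<^bsub>T\<^esub>j\<in>{1..n i}. w \<otimes>\<^bsub>T\<^esub> (hT (a i j) \<otimes>\<^bsub>T\<^esub> y [^]\<^bsub>T\<^esub> (n i - j)))"
    unfolding s_def by (rule pr.S.finsum_rdistr) (use w y a_closed[OF i] in auto)
  also have "\<dots> = (\<Oplus>\<^bsub>T\<^esub>j\<in>{1..n i}. hT (a i j) \<otimes>\<^bsub>T\<^esub> pr (mterm \<one> (m(i := m i - j))))"
    by (rule pr.S.finsum_cong') (use w y a_closed[OF i] red in \<open>auto simp: pr.S.m_lcomm\<close>)
  finally show ?thesis .
qed

definition box :: "(nat \<Rightarrow> nat) set" where
  "box = {m \<in> monomials r. \<forall>i<r. m i < n i}"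

lemma finite_box: "finite box"
proof (rule finite_subset)
  show "box \<subseteq> {m. m \<le> (\<lambda>i. if i < r then n i else 0)}"
    unfolding box_def monomials_def by (auto simp: le_fun_def intro: less_imp_le)
  show "finite {m. m \<le> (\<lambda>i. if i < r then n i else 0)}"
    by (rule finite_le_monomial[of _ r]) (simp add: monomials_def)
qed

text \<open>Monomials outside \<open>box\<close> are rewritten by \<open>pr_monomial_reduce\<close>.
  Each replacement lowers one exponent by some j \<ge> 1, so induction on the total degree ends in
  \<open>box\<close>, which is finite.\<close>

lemma T_finite: "\<exists>gs. set gs \<subseteq> carrier T \<and> carrier T \<subseteq> hT.fspan (carrier R) gs"
proof -
  obtain bl where bl: "set bl = box" using finite_list[OF finite_box] by auto
  define gs where "gs = map (\<lambda>m. pr (mterm \<one> m)) bl"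
  have gs: "set gs \<subseteq> carrier T"
    unfolding gs_def using bl mterm_carrier[OF one_closed] by (auto simp: box_def)
  note sub = hT.submod_fspan[OF gs oneideal]
  have mon: "pr (mterm \<one> m) \<in> hT.fspan (carrier R) gs" if "m \<in> monomials r" for m
    using that
  proof (induction "\<Sum>i<r. m i" arbitrary: m rule: less_induct)
    case less
    show ?case
    proof (cases "m \<in> box")
      case True
      then show ?thesis by (intro hT.fspan_gen_carrier[OF gs]) (auto simp: gs_def bl)
    next
      case False
      then obtain i where i: "i < r" "n i \<le> m i" using less.prems unfolding box_def by (auto simp: not_less)
      have "pr (mterm \<one> (m(i := m i - j))) \<in> hT.fspan (carrier R) gs" if j: "j \<in> {1..n i}" for j
      proof (rule less.hyps)
        show "m(i := m i - j) \<in> monomials r" using less.prems i(1) by (auto simp: monomials_def)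
        show "(\<Sum>l<r. (m(i := m i - j)) l) < (\<Sum>l<r. m l)"
          by (rule sum_strict_mono_ex1) (use i j in auto)
      qed
      then have "(\<Oplus>\<^bsub>T\<^esub>j\<in>{1..n i}. hT (a i j) \<otimes>\<^bsub>T\<^esub> pr (mterm \<one> (m(i := m i - j)))) \<in> hT.fspan (carrier R) gs"
        by (intro hT.submod_finsum[OF sub] hT.submod_closed(4)[OF sub] a_closed[OF i(1)])
      then show ?thesis
        unfolding pr_monomial_reduce[OF i(1) less.prems i(2)] by (rule hT.fspan_neg[OF oneideal gs])
    qed
  qed
  have "pr p \<in> hT.fspan (carrier R) gs" if "p \<in> carrier P" for p
    using that
  proof (induction p rule: mpoly_induct)
    case zero
    then show ?case using hT.submod_closed(2)[OF sub] by simp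
  next
    case (add c m p)
    have "pr (mterm c m \<oplus>\<^bsub>P\<^esub> p) = hT c \<otimes>\<^bsub>T\<^esub> pr (mterm \<one> m) \<oplus>\<^bsub>T\<^esub> pr p"
      unfolding hT_def mterm_eq_const_mult[OF add(1,2)]
      using add mterm_carrier[OF one_closed add(2)] by simp
    then show ?case
      using hT.submod_closed(3)[OF sub hT.submod_closed(4)[OF sub add(1) mon[OF add(2)]] add.IH] by simp
  qed
  then show ?thesis using gs T_elem by (intro exI[of _ gs]) auto
qed

end

section \<open>A finite domain presented as a quotient of T\<close>

locale monic_presentation = mpoly_eval R S h r t + mpoly_quot R r n a + S: domain S
  for R (structure) and S (structure) and h r t n a +
  assumes rel: "\<And>i. i < r \<Longrightarrow>
      t i [^]\<^bsub>S\<^esub> n i \<oplus>\<^bsub>S\<^esub> (\<Oplus>\<^bsub>S\<^esub>j\<in>{1..n i}. h (a i j) \<otimes>\<^bsub>S\<^esub> t i [^]\<^bsub>S\<^esub> (n i - j)) = \<zero>\<^bsub>S\<^esub>"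
    and inj: "inj_on h (carrier R)"
    and surj: "carrier S \<subseteq> ev ` carrier P"
    and noeth: "noetherian_ring R"
begin

sublocale ev: ring_hom_cring P S ev by (rule ev_hom)

definition J0 :: "((nat \<Rightarrow> nat) \<Rightarrow> 'a) set" where
  "J0 = {p \<in> carrier P. ev p = \<zero>\<^bsub>S\<^esub>}"

text \<open>The kernel of the map from T to S induced by \<open>ev\<close>, written as the image of
  the kernel on polynomials, so that the induced map itself is not constructed.\<close>

definition J :: "((nat \<Rightarrow> nat) \<Rightarrow> 'a) set set" where
  "J = pr ` J0"

lemma J0_ideal: "ideal J0 P"
  unfolding J0_def by (rule P.ideal_of_closed) auto

lemma ev_f: "i < r \<Longrightarrow> ev (f i) = \<zero>\<^bsub>S\<^esub>"
proof -
  assume i: "i < r"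
  have c: "(\<lambda>j. mp_const R (a i j) \<otimes>\<^bsub>P\<^esub> mp_var R i [^]\<^bsub>P\<^esub> (n i - j)) \<in> {1..n i} \<rightarrow> carrier P"
    using a_closed[OF i] mp_var_closed[OF i] by auto
  have "ev (\<Oplus>\<^bsub>P\<^esub>j\<in>{1..n i}. mp_const R (a i j) \<otimes>\<^bsub>P\<^esub> mp_var R i [^]\<^bsub>P\<^esub> (n i - j))
      = (\<Oplus>\<^bsub>S\<^esub>j\<in>{1..n i}. ev (mp_const R (a i j) \<otimes>\<^bsub>P\<^esub> mp_var R i [^]\<^bsub>P\<^esub> (n i - j)))"
    using ev.hom_finsum[OF c] by (simp add: comp_def)
  also have "\<dots> = (\<Oplus>\<^bsub>S\<^esub>j\<in>{1..n i}. h (a i j) \<otimes>\<^bsub>S\<^esub> t i [^]\<^bsub>S\<^esub> (n i - j))"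
    by (rule S.finsum_cong')
      (use a_closed[OF i] mp_var_closed[OF i] t_closed[OF i] in \<open>auto simp: ev.hom_pow ev_const ev_var[OF i]\<close>)
  finally have "ev (f i) = t i [^]\<^bsub>S\<^esub> n i \<oplus>\<^bsub>S\<^esub> (\<Oplus>\<^bsub>S\<^esub>j\<in>{1..n i}. h (a i j) \<otimes>\<^bsub>S\<^esub> t i [^]\<^bsub>S\<^esub> (n i - j))"
    unfolding f_eq using P.finsum_closed[OF c] mp_var_closed[OF i] by (simp add: ev.hom_pow ev_var[OF i])
  then show ?thesis using rel[OF i] by simp
qed

lemma I0_subset_J0: "I0 \<subseteq> J0"
  unfolding I0_def by (rule P.genideal_minimal[OF J0_ideal]) (use ev_f f_closed in \<open>auto simp: J0_def\<close>)

lemma pr_mem_J_iff: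
  assumes "p \<in> carrier P"
  shows "pr p \<in> J \<longleftrightarrow> ev p = \<zero>\<^bsub>S\<^esub>"
proof
  assume "pr p \<in> J"
  then obtain q where q: "q \<in> J0" "pr p = pr q" unfolding J_def by auto
  have qP: "q \<in> carrier P" using q(1) unfolding J0_def by simp
  have "p \<ominus>\<^bsub>P\<^esub> q \<in> J0" using pr_eq_iff[OF assms qP] q(2) I0_subset_J0 by auto
  then have "(p \<ominus>\<^bsub>P\<^esub> q) \<oplus>\<^bsub>P\<^esub> q \<in> J0" using P.ideal_closed(3)[OF J0_ideal] q(1) by simp
  moreover have "(p \<ominus>\<^bsub>P\<^esub> q) \<oplus>\<^bsub>P\<^esub> q = p" using assms qP by algebra
  ultimately show "ev p = \<zero>\<^bsub>S\<^esub>" unfolding J0_def by simp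
next
  assume "ev p = \<zero>\<^bsub>S\<^esub>"
  then show "pr p \<in> J" unfolding J_def J0_def using assms by auto
qed

lemma J_ideal: "ideal J T"
  using P.ring_ideal_imp_quot_ideal[OF I0_ideal J0_ideal] unfolding J_def T_eq pr_def[abs_def] .

lemma J_prime: "primeideal J T"
proof (rule primeidealI[OF J_ideal T_cring])
  have "\<one>\<^bsub>T\<^esub> \<notin> J" using pr_mem_J_iff[OF P.one_closed] S.one_not_zero by simp
  then show "carrier T \<noteq> J" using pr.S.one_closed by blast
  fix x y assume xy: "x \<in> carrier T" "y \<in> carrier T" "x \<otimes>\<^bsub>T\<^esub> y \<in> J"
  obtain p q where pq: "p \<in> carrier P" "x = pr p" "q \<in> carrier P" "y = pr q"
    using T_elem[OF xy(1)] T_elem[OF xy(2)] by auto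
  have "pr (p \<otimes>\<^bsub>P\<^esub> q) \<in> J" using xy(3) pq by simp
  then have "ev p \<otimes>\<^bsub>S\<^esub> ev q = \<zero>\<^bsub>S\<^esub>" using pr_mem_J_iff[of "p \<otimes>\<^bsub>P\<^esub> q"] pq by simp
  then have "ev p = \<zero>\<^bsub>S\<^esub> \<or> ev q = \<zero>\<^bsub>S\<^esub>" using S.integral pq by simp
  then show "x \<in> J \<or> y \<in> J" using pr_mem_J_iff pq by auto
qed

lemma hom_eq_zero: "c \<in> carrier R \<Longrightarrow> h c = \<zero>\<^bsub>S\<^esub> \<Longrightarrow> c = \<zero>"
  by (rule inj_onD[OF inj]) auto

lemma hT_mem_J:
  assumes "c \<in> carrier R" "hT c \<in> J"
  shows "c = \<zero>"
  using assms pr_mem_J_iff[OF const.hom_closed[OF assms(1)]] ev_const[OF assms(1)] hom_eq_zero[OF assms(1)]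
  unfolding hT_def by simp

text \<open>T is finite, hence integral, over R, and J contracts to zero because h is injective. By
  incomparability no prime lies strictly below J, whereas a chain with a positive number of steps
  would supply one just before its end.\<close>

lemma prime_height_J: "prime_height T J = 0"
proof -
  obtain gs where gs: "set gs \<subseteq> carrier T" "carrier T \<subseteq> hT.fspan (carrier R) gs" using T_finite by auto
  have no_smaller: "Q = J" if Q: "primeideal Q T" "Q \<subseteq> J" for Q
  proof -
    have "J = Q"
    proof (rule hT.primeideal_subset_imp_eq[OF Q(1) J_ideal Q(2)])
      show "hT c = \<zero>\<^bsub>T\<^esub>" if "c \<in> carrier R" "hT c \<in> J" for c using hT_mem_J[OF that] by simp
      show "\<exists>k. x [^]\<^bsub>T\<^esub> k \<in> hT.fspan (carrier R) (hT.pows x k)" if "x \<in> carrier T" for x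
        by (rule hT.exists_integral_equation[OF noeth gs that])
    qed
    then show ?thesis by simp
  qed
  have "length ps - 1 = 0" if ps: "prime_chain T ps" "last ps = J" for ps
  proof (rule ccontr)
    assume "length ps - 1 \<noteq> 0"
    then have len: "length ps \<ge> 2" by simp
    let ?Q = "ps ! (length ps - 2)"
    have ne: "ps \<noteq> []" using len by auto
    have last: "J = ps ! (length ps - 1)" using ps(2) last_conv_nth[OF ne] by simp
    have "?Q \<subset> J"
      unfolding last using ps(1) len unfolding prime_chain_def
      by (intro sorted_wrt_nth_less[of "(\<subset>)" ps]) auto
    moreover have "primeideal ?Q T" using ps(1) len unfolding prime_chain_def by simp
    ultimately show False using no_smaller by auto
  qed
  then have "prime_height T J \<le> 0"
    unfolding prime_height_def by (intro Sup_least) (auto simp: zero_enat_def)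
  then show ?thesis by simp
qed

lemma ideal_height_J: "ideal_height T J = 0"
proof -
  have "ideal_height T J \<le> prime_height T J"
    unfolding ideal_height_def by (rule Inf_lower) (use J_prime in auto)
  then show ?thesis using prime_height_J by simp
qed

lemma T_quot_map_eq: "T_quot_map R r n a J x = J +>\<^bsub>T\<^esub> hT x"
  unfolding T_quot_map_def hT_def pr_def I0_def ..

lemma inj_T_quot_map: "inj_on (T_quot_map R r n a J) (carrier R)"
proof (rule inj_onI)
  fix x y assume xy: "x \<in> carrier R" "y \<in> carrier R" "T_quot_map R r n a J x = T_quot_map R r n a J y"
  then have "hT x \<ominus>\<^bsub>T\<^esub> hT y \<in> J"
    using pr.S.quotient_eq_iff_same_a_r_cos[OF J_ideal] unfolding T_quot_map_eq by simp
  then have "hT (x \<ominus> y) \<in> J" using xy by (simp add: a_minus_def)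
  then have "x \<ominus> y = \<zero>" by (rule hT_mem_J[rotated]) (use xy in simp)
  then show "x = y" using xy by simp
qed

text \<open>The retraction is carried along the inverse of the isomorphism from T/J to S: an element
  of S is lifted to some polynomial and projected to T/J. The class does not depend on the lift, so
  \<open>\<kappa>_eq\<close> gives additivity and linearity despite the arbitrary choice.\<close>

lemma direct_summand_of_quotient:
  assumes "direct_summand_via R (T Quot J) (T_quot_map R r n a J)"
  shows "direct_summand_via R S h"
proof -
  obtain \<rho> where \<rho>: "\<And>s. s \<in> carrier (T Quot J) \<Longrightarrow> \<rho> s \<in> carrier R"
    "\<And>s u. s \<in> carrier (T Quot J) \<Longrightarrow> u \<in> carrier (T Quot J) \<Longrightarrow> \<rho> (s \<oplus>\<^bsub>T Quot J\<^esub> u) = \<rho> s \<oplus> \<rho> u"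
    "\<And>x s. x \<in> carrier R \<Longrightarrow> s \<in> carrier (T Quot J) \<Longrightarrow>
      \<rho> (T_quot_map R r n a J x \<otimes>\<^bsub>T Quot J\<^esub> s) = x \<otimes> \<rho> s"
    "\<rho> \<one>\<^bsub>T Quot J\<^esub> = \<one>"
    using assms unfolding direct_summand_via_def by metis
  interpret q: ring_hom_cring T "T Quot J" "(+>\<^bsub>T\<^esub>) J"
    by (rule ideal.rcos_ring_hom_cring[OF J_ideal T_cring])
  define \<kappa> where "\<kappa> p = J +>\<^bsub>T\<^esub> pr p" for p
  define lift where "lift s = (SOME p. p \<in> carrier P \<and> ev p = s)" for s
  have lift: "lift s \<in> carrier P \<and> ev (lift s) = s" if s: "s \<in> carrier S" for s
  proof -
    obtain p where "p \<in> carrier P" "s = ev p" using surj s by auto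
    then have "\<exists>p. p \<in> carrier P \<and> ev p = s" by auto
    then show ?thesis unfolding lift_def by (rule someI_ex)
  qed
  have \<kappa>_eq: "\<kappa> p = \<kappa> p'" if p: "p \<in> carrier P" "p' \<in> carrier P" "ev p = ev p'" for p p'
  proof -
    have "ev (p \<ominus>\<^bsub>P\<^esub> p') = \<zero>\<^bsub>S\<^esub>" using p by (simp add: a_minus_def S.r_neg)
    then have "pr (p \<ominus>\<^bsub>P\<^esub> p') \<in> J" by (rule iffD2[OF pr_mem_J_iff, rotated]) (use p in simp)
    then have "pr p \<ominus>\<^bsub>T\<^esub> pr p' \<in> J" using p by (simp add: a_minus_def)
    then show ?thesis
      unfolding \<kappa>_def using pr.S.quotient_eq_iff_same_a_r_cos[OF J_ideal] p by simp
  qed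
  have \<kappa>_closed: "\<kappa> p \<in> carrier (T Quot J)" if "p \<in> carrier P" for p
    unfolding \<kappa>_def using that by simp
  show ?thesis
    unfolding direct_summand_via_def
  proof (intro exI[of _ "\<lambda>s. \<rho> (\<kappa> (lift s))"] conjI ballI)
    fix s assume s: "s \<in> carrier S"
    show "\<rho> (\<kappa> (lift s)) \<in> carrier R" using \<rho>(1) \<kappa>_closed lift[OF s] by simp
    fix u assume u: "u \<in> carrier S"
    have "\<kappa> (lift (s \<oplus>\<^bsub>S\<^esub> u)) = \<kappa> (lift s \<oplus>\<^bsub>P\<^esub> lift u)"
      by (rule \<kappa>_eq) (use lift s u in auto)
    also have "\<dots> = \<kappa> (lift s) \<oplus>\<^bsub>T Quot J\<^esub> \<kappa> (lift u)"
      unfolding \<kappa>_def using lift[OF s] lift[OF u] by simp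
    finally show "\<rho> (\<kappa> (lift (s \<oplus>\<^bsub>S\<^esub> u))) = \<rho> (\<kappa> (lift s)) \<oplus> \<rho> (\<kappa> (lift u))"
      using \<rho>(2) \<kappa>_closed lift s u by simp
  next
    fix x s assume x: "x \<in> carrier R" and s: "s \<in> carrier S"
    have "\<kappa> (lift (h x \<otimes>\<^bsub>S\<^esub> s)) = \<kappa> (mp_const R x \<otimes>\<^bsub>P\<^esub> lift s)"
      by (rule \<kappa>_eq) (use lift s x ev_const in auto)
    also have "\<dots> = T_quot_map R r n a J x \<otimes>\<^bsub>T Quot J\<^esub> \<kappa> (lift s)"
      unfolding \<kappa>_def T_quot_map_eq hT_def using lift[OF s] x by simp
    finally show "\<rho> (\<kappa> (lift (h x \<otimes>\<^bsub>S\<^esub> s))) = x \<otimes> \<rho> (\<kappa> (lift s))"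
      using \<rho>(3)[OF x] \<kappa>_closed lift[OF s] by simp
  next
    have "\<kappa> (lift \<one>\<^bsub>S\<^esub>) = \<kappa> \<one>\<^bsub>P\<^esub>" by (rule \<kappa>_eq) (use lift in auto)
    also have "\<dots> = \<one>\<^bsub>T Quot J\<^esub>" unfolding \<kappa>_def by simp
    finally show "\<rho> (\<kappa> (lift \<one>\<^bsub>S\<^esub>)) = \<one>" using \<rho>(4) by simp
  qed
qed

end

context ring_hom_cring
begin

lemma fspan_subset_submod:
  assumes "submod M" "set gs \<subseteq> M"
  shows "fspan (carrier R) gs \<subseteq> M"
  using assms(2) submod_closed[OF assms(1)] by (induction gs) auto

text \<open>This passes from list spans to the indexing of \<open>monic_in_var\<close>, where the
  coefficient b j with 1 \<le> j \<le> k belongs to the exponent k - j. The sum is first formed by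
  exponents and then reindexed.\<close>

lemma fspan_pows_finsum:
  assumes I: "ideal I R" and x: "x \<in> carrier S" and v: "v \<in> fspan I (pows x k)"
  shows "\<exists>b. (\<forall>j\<in>{1..k}. b j \<in> I) \<and> v = (\<Oplus>\<^bsub>S\<^esub>j\<in>{1..k}. h (b j) \<otimes>\<^bsub>S\<^esub> x [^]\<^bsub>S\<^esub> (k - j))"
proof -
  have "\<exists>b. (\<forall>j\<in>{..<k}. b j \<in> I) \<and> v = (\<Oplus>\<^bsub>S\<^esub>j\<in>{..<k}. h (b j) \<otimes>\<^bsub>S\<^esub> x [^]\<^bsub>S\<^esub> j)"
    using v
  proof (induction k arbitrary: v)
    case (Suc k)
    obtain c w where cw: "c \<in> I" "w \<in> fspan I (pows x k)" "v = h c \<otimes>\<^bsub>S\<^esub> x [^]\<^bsub>S\<^esub> k \<oplus>\<^bsub>S\<^esub> w"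
      using Suc.prems unfolding pows_simps by (rule fspan_ConsE)
    obtain b where b: "\<forall>j\<in>{..<k}. b j \<in> I" "w = (\<Oplus>\<^bsub>S\<^esub>j\<in>{..<k}. h (b j) \<otimes>\<^bsub>S\<^esub> x [^]\<^bsub>S\<^esub> j)"
      using Suc.IH[OF cw(2)] by auto
    let ?b = "b(k := c)"
    note Ic = R.ideal_closed(1)[OF I]
    have "(\<Oplus>\<^bsub>S\<^esub>j\<in>{..<Suc k}. h (?b j) \<otimes>\<^bsub>S\<^esub> x [^]\<^bsub>S\<^esub> j)
        = h c \<otimes>\<^bsub>S\<^esub> x [^]\<^bsub>S\<^esub> k \<oplus>\<^bsub>S\<^esub> (\<Oplus>\<^bsub>S\<^esub>j\<in>{..<k}. h (?b j) \<otimes>\<^bsub>S\<^esub> x [^]\<^bsub>S\<^esub> j)"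
      unfolding lessThan_Suc using b(1) Ic[OF cw(1)] x Ic by (subst S.finsum_insert) auto
    also have "(\<Oplus>\<^bsub>S\<^esub>j\<in>{..<k}. h (?b j) \<otimes>\<^bsub>S\<^esub> x [^]\<^bsub>S\<^esub> j) = w"
      unfolding b(2) by (rule S.finsum_cong') (use b(1) Ic x in auto)
    finally have "v = (\<Oplus>\<^bsub>S\<^esub>j\<in>{..<Suc k}. h (?b j) \<otimes>\<^bsub>S\<^esub> x [^]\<^bsub>S\<^esub> j)" using cw(3) by simp
    then show ?case using b(1) cw(1) by (intro exI[of _ ?b]) (auto simp: less_Suc_eq)
  qed auto
  then obtain b where b: "\<forall>j\<in>{..<k}. b j \<in> I" "v = (\<Oplus>\<^bsub>S\<^esub>j\<in>{..<k}. h (b j) \<otimes>\<^bsub>S\<^esub> x [^]\<^bsub>S\<^esub> j)" by auto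
  have img: "(\<lambda>j. k - j) ` {1..k} = {..<k}"
  proof
    show "{..<k} \<subseteq> (\<lambda>j. k - j) ` {1..k}"
    proof
      fix j assume "j \<in> {..<k}"
      then show "j \<in> (\<lambda>j. k - j) ` {1..k}" by (intro image_eqI[of _ _ "k - j"]) auto
    qed
  qed auto
  have "(\<Oplus>\<^bsub>S\<^esub>j\<in>(\<lambda>j. k - j) ` {1..k}. h (b j) \<otimes>\<^bsub>S\<^esub> x [^]\<^bsub>S\<^esub> j)
      = (\<Oplus>\<^bsub>S\<^esub>j\<in>{1..k}. h (b (k - j)) \<otimes>\<^bsub>S\<^esub> x [^]\<^bsub>S\<^esub> (k - j))"
    by (rule S.finsum_reindex) (use b(1) R.ideal_closed(1)[OF I] x in \<open>auto simp: inj_on_def\<close>)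
  then show ?thesis using b unfolding img by (intro exI[of _ "\<lambda>j. b (k - j)"]) auto
qed

end

section \<open>The reduction\<close>

text \<open>A statement outside the locales, so that \<open>complete_integral_element\<close> is
  interpreted anew for each d with its own exponent N.\<close>

lemma exists_shifted_monic_equation:
  fixes R (structure) and D (structure)
  assumes hom: "ring_hom_cring R D h" and R: "complete_local_ring R" and D: "domain D"
    and inj: "inj_on h (carrier R)" and closed: "algebraically_closed (R Quot max_ideal R)"
    and gs: "set gs \<subseteq> carrier D" "carrier D \<subseteq> ring_hom_cring.fspan D h (carrier R) gs"
    and d: "d \<in> carrier D"
  shows "\<exists>c (k::nat) b. c \<in> carrier R \<and> k \<ge> 1 \<and> (\<forall>j\<in>{1..k}. b j \<in> max_ideal R) \<and>
    (d \<ominus>\<^bsub>D\<^esub> h c) [^]\<^bsub>D\<^esub> k \<oplus>\<^bsub>D\<^esub>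
      (\<Oplus>\<^bsub>D\<^esub>j\<in>{1..k}. h (b j) \<otimes>\<^bsub>D\<^esub> (d \<ominus>\<^bsub>D\<^esub> h c) [^]\<^bsub>D\<^esub> (k - j)) = \<zero>\<^bsub>D\<^esub>"
proof -
  interpret h: ring_hom_cring R D h by (rule hom)
  interpret R: complete_local_ring R by (rule R)
  interpret D: domain D by (rule D)
  obtain N where N: "d [^]\<^bsub>D\<^esub> N \<in> h.fspan (carrier R) (h.pows d N)"
    using h.exists_integral_equation[OF R.noetherian_ring_axioms gs d] by auto
  interpret complete_integral_element R D h d N
    by unfold_locales (use N d inj in auto)
  obtain c k where c: "c \<in> carrier R" "k \<ge> 1"
    and k: "(d \<ominus>\<^bsub>D\<^esub> h c) [^]\<^bsub>D\<^esub> k \<in> h.fspan R.\<mm> (h.pows (d \<ominus>\<^bsub>D\<^esub> h c) k)"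
    using exists_shift_integral_over_max_ideal[OF closed] by auto
  define x where "x = d \<ominus>\<^bsub>D\<^esub> h c"
  have x: "x \<in> carrier D" unfolding x_def using d c by simp
  obtain b where b: "\<forall>j\<in>{1..k}. b j \<in> R.\<mm>"
    "\<ominus>\<^bsub>D\<^esub> (x [^]\<^bsub>D\<^esub> k) = (\<Oplus>\<^bsub>D\<^esub>j\<in>{1..k}. h (b j) \<otimes>\<^bsub>D\<^esub> x [^]\<^bsub>D\<^esub> (k - j))"
    using h.fspan_pows_finsum[OF R.m_ideal x h.fspan_neg[OF R.m_ideal h.pows_carrier[OF x] k[folded x_def]]]
    by auto
  have "x [^]\<^bsub>D\<^esub> k \<oplus>\<^bsub>D\<^esub> (\<Oplus>\<^bsub>D\<^esub>j\<in>{1..k}. h (b j) \<otimes>\<^bsub>D\<^esub> x [^]\<^bsub>D\<^esub> (k - j)) = \<zero>\<^bsub>D\<^esub>"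
    unfolding b(2)[symmetric] by (rule h.S.r_neg[OF h.S.nat_pow_closed[OF x]])
  then show ?thesis using c b(1) unfolding x_def by (intro exI[of _ c] exI[of _ k] exI[of _ b]) simp
qed

theorem theorem5:
  fixes R :: "('a, 'm) ring_scheme" and S :: "('b, 'n) ring_scheme" and \<iota> :: "'a \<Rightarrow> 'b"
  assumes reg: "regular_local_ring R"
    and compl: "madic_complete R"
    and alg_closed: "algebraically_closed (R Quot max_ideal R)"
    and hyp: "\<And>(r::nat) (n::nat \<Rightarrow> nat) (a::nat \<Rightarrow> nat \<Rightarrow> 'a) J.
      \<lbrakk> r \<ge> 1;
        \<forall>i<r. n i \<ge> 1;
        \<forall>i<r. \<forall>j\<in>{1..n i}. a i j \<in> max_ideal R;
        ideal J (T_ring R r n a);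
        ideal_height (T_ring R r n a) J = 0;
        inj_on (T_quot_map R r n a J) (carrier R) \<rbrakk>
      \<Longrightarrow> direct_summand_via R (T_ring R r n a Quot J) (T_quot_map R r n a J)"
    and S_ring: "cring S"
    and hom: "\<iota> \<in> ring_hom R S"
    and inj: "inj_on \<iota> (carrier R)"
    and fin: "module_finite_via R S \<iota>"
  shows "direct_summand_via R S \<iota>"
proof -
  have loc: "local_ring R" and noeth: "noetherian_ring R"
    using reg unfolding regular_local_ring_def by auto
  interpret R: domain R by (rule regular_local_ring_domain[OF reg])
  interpret R: noetherian_ring R by (rule noeth)
  interpret R: noetherian_cring R ..
  interpret R: complete_local_ring R by unfold_locales (rule loc, rule compl)
  interpret S: cring S by (rule S_ring)
  interpret \<iota>: ring_hom_cring R S \<iota>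
    by (intro ring_hom_cring.intro ring_hom_cring_axioms.intro R.is_cring S_ring hom)
  \<comment> \<open>U is multiplicative because R is a domain, and omits zero because the map to S
    is injective. A prime avoiding U contracts to zero, so R still embeds in the quotient by
    it.\<close>
  define U where "U = \<iota> ` (carrier R - {\<zero>\<^bsub>R\<^esub>})"
  have \<iota>_zero: "x = \<zero>\<^bsub>R\<^esub>" if "x \<in> carrier R" "\<iota> x = \<zero>\<^bsub>S\<^esub>" for x
    by (rule inj_onD[OF inj]) (use that in auto)
  have "\<exists>Q. primeideal Q S \<and> {\<zero>\<^bsub>S\<^esub>} \<subseteq> Q \<and> Q \<inter> U = {}"
  proof (rule S.exists_primeideal_disjoint[OF S.zeroideal])
    show "U \<subseteq> carrier S" unfolding U_def by auto
    have "\<one>\<^bsub>S\<^esub> = \<iota> \<one>\<^bsub>R\<^esub>" by simp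
    then show "\<one>\<^bsub>S\<^esub> \<in> U" unfolding U_def using R.one_not_zero R.one_closed by blast
    show "{\<zero>\<^bsub>S\<^esub>} \<inter> U = {}" unfolding U_def using \<iota>_zero by force
    fix x y assume "x \<in> U" "y \<in> U"
    then obtain x' y' where xy: "x' \<in> carrier R" "x' \<noteq> \<zero>\<^bsub>R\<^esub>" "x = \<iota> x'" "y' \<in> carrier R" "y' \<noteq> \<zero>\<^bsub>R\<^esub>" "y = \<iota> y'"
      unfolding U_def by auto
    have "x \<otimes>\<^bsub>S\<^esub> y = \<iota> (x' \<otimes>\<^bsub>R\<^esub> y')" using xy by simp
    moreover have "x' \<otimes>\<^bsub>R\<^esub> y' \<noteq> \<zero>\<^bsub>R\<^esub>" using R.integral xy by auto
    ultimately show "x \<otimes>\<^bsub>S\<^esub> y \<in> U"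
      unfolding U_def using xy by (intro image_eqI[of _ _ "x' \<otimes>\<^bsub>R\<^esub> y'"]) auto
  qed
  then obtain Q where Q: "primeideal Q S" "Q \<inter> U = {}" by (elim exE conjE)
  note Qi = primeideal.axioms(1)[OF Q(1)]
  define D where "D = S Quot Q"
  define \<pi> where "\<pi> = (+>\<^bsub>S\<^esub>) Q"
  define h where "h x = \<pi> (\<iota> x)" for x
  interpret D: domain D unfolding D_def by (rule primeideal.quotient_is_domain[OF Q(1)])
  interpret \<pi>: ring_hom_cring S D \<pi>
    unfolding D_def \<pi>_def by (rule primeideal.rcos_ring_hom_cring[OF Q(1)])
  have "h \<in> ring_hom R D" unfolding h_def by (rule ring_hom_memI) auto
  then interpret h: ring_hom_cring R D h
    by (intro ring_hom_cring.intro ring_hom_cring_axioms.intro R.is_cring D.is_cring)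
  have D_elem: "\<exists>s\<in>carrier S. d = \<pi> s" if "d \<in> carrier D" for d
    using that unfolding D_def \<pi>_def FactRing_def A_RCOSETS_def' by auto
  have inj_h: "inj_on h (carrier R)"
  proof (rule inj_onI)
    fix x y assume xy: "x \<in> carrier R" "y \<in> carrier R" "h x = h y"
    then have "\<iota> x \<ominus>\<^bsub>S\<^esub> \<iota> y \<in> Q"
      using S.quotient_eq_iff_same_a_r_cos[OF Qi] unfolding h_def \<pi>_def by simp
    then have "\<iota> (x \<ominus>\<^bsub>R\<^esub> y) \<in> Q" using xy by (simp add: a_minus_def)
    then have "x \<ominus>\<^bsub>R\<^esub> y = \<zero>\<^bsub>R\<^esub>" using Q(2) xy(1,2) R.minus_closed unfolding U_def by blast
    then show "x = y" using xy by simp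
  qed
  obtain G where G: "finite G" "G \<subseteq> carrier S"
    "\<And>s. s \<in> carrier S \<Longrightarrow> \<exists>c. (\<forall>g\<in>G. c g \<in> carrier R) \<and> s = (\<Oplus>\<^bsub>S\<^esub>g\<in>G. \<iota> (c g) \<otimes>\<^bsub>S\<^esub> g)"
    using fin unfolding module_finite_via_def by metis
  obtain gl where gl: "set gl = G" using finite_list[OF G(1)] by auto
  \<comment> \<open>The extra generator 1 guarantees at least one variable, as the hypothesis
    demands r \<ge> 1 while G may be empty.\<close>
  define gs where "gs = \<one>\<^bsub>D\<^esub> # map \<pi> gl"
  have gs: "set gs \<subseteq> carrier D" unfolding gs_def using gl G(2) by auto
  note sub = h.submod_fspan[OF gs R.oneideal]
  have gen: "carrier D \<subseteq> h.fspan (carrier R) gs"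
  proof
    fix d assume "d \<in> carrier D"
    then obtain s where s: "s \<in> carrier S" "d = \<pi> s" using D_elem by auto
    obtain c where c: "\<forall>g\<in>G. c g \<in> carrier R" "s = (\<Oplus>\<^bsub>S\<^esub>g\<in>G. \<iota> (c g) \<otimes>\<^bsub>S\<^esub> g)" using G(3)[OF s(1)] by auto
    have cl: "(\<lambda>g. \<iota> (c g) \<otimes>\<^bsub>S\<^esub> g) \<in> G \<rightarrow> carrier S" using c(1) G(2) by auto
    have "d = (\<Oplus>\<^bsub>D\<^esub>g\<in>G. \<pi> (\<iota> (c g) \<otimes>\<^bsub>S\<^esub> g))"
      unfolding s(2) c(2) using \<pi>.hom_finsum[OF cl] by (simp add: comp_def)
    also have "\<dots> \<in> h.fspan (carrier R) gs"
    proof (rule h.submod_finsum[OF sub])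
      fix g assume g: "g \<in> G"
      have "h (c g) \<otimes>\<^bsub>D\<^esub> \<pi> g \<in> h.fspan (carrier R) gs"
        by (rule h.fspan_gen[OF R.oneideal gs]) (use c(1) g gl in \<open>auto simp: gs_def\<close>)
      moreover have "\<iota> (c g) \<in> carrier S" "g \<in> carrier S" using c(1) g G(2) by auto
      ultimately show "\<pi> (\<iota> (c g) \<otimes>\<^bsub>S\<^esub> g) \<in> h.fspan (carrier R) gs" unfolding h_def by simp
    qed
    finally show "d \<in> h.fspan (carrier R) gs" .
  qed
  \<comment> \<open>Naming the equation lets its witnesses be chosen as functions of the element d;
    their values at the generators supply the data for T.\<close>
  define eqn where "eqn d c k b \<longleftrightarrow> c \<in> carrier R \<and> k \<ge> 1 \<and> (\<forall>j\<in>{1..k}. b j \<in> max_ideal R) \<and>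
    (d \<ominus>\<^bsub>D\<^esub> h c) [^]\<^bsub>D\<^esub> k \<oplus>\<^bsub>D\<^esub>
      (\<Oplus>\<^bsub>D\<^esub>j\<in>{1..k}. h (b j) \<otimes>\<^bsub>D\<^esub> (d \<ominus>\<^bsub>D\<^esub> h c) [^]\<^bsub>D\<^esub> (k - j)) = \<zero>\<^bsub>D\<^esub>" for d c b and k :: nat
  have "\<exists>c k b. eqn d c k b" if "d \<in> carrier D" for d
    unfolding eqn_def
    by (rule exists_shifted_monic_equation[OF h.ring_hom_cring_axioms R.complete_local_ring_axioms
          D.domain_axioms inj_h alg_closed gs gen that])
  then obtain c k b where eqn: "\<And>d. d \<in> carrier D \<Longrightarrow> eqn d (c d) (k d) (b d)" by metis
  note ckb = eqn[unfolded eqn_def]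
  define r where "r = length gs"
  define t where "t i = gs ! i \<ominus>\<^bsub>D\<^esub> h (c (gs ! i))" for i
  define n where "n i = k (gs ! i)" for i
  define a where "a i = b (gs ! i)" for i
  have gsi: "gs ! i \<in> carrier D" if "i < r" for i using that gs unfolding r_def by auto
  have am: "a i j \<in> max_ideal R" if "i < r" "j \<in> {1..n i}" for i j
    using ckb[OF gsi[OF that(1)]] that(2) unfolding a_def n_def by simp
  interpret E: mpoly_eval R D h r t
    by unfold_locales (use gsi ckb in \<open>simp add: t_def\<close>)
  interpret M: monic_presentation R D h r t n a
  proof unfold_locales
    show "a i j \<in> carrier R" if "i < r" "j \<in> {1..n i}" for i j
      by (rule R.ideal_closed(1)[OF R.m_ideal am[OF that]])
    show "t i [^]\<^bsub>D\<^esub> n i \<oplus>\<^bsub>D\<^esub> (\<Oplus>\<^bsub>D\<^esub>j\<in>{1..n i}. h (a i j) \<otimes>\<^bsub>D\<^esub> t i [^]\<^bsub>D\<^esub> (n i - j)) = \<zero>\<^bsub>D\<^esub>" if "i < r" for i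
      using ckb[OF gsi[OF that]] unfolding t_def n_def a_def by simp
    show "inj_on h (carrier R)" by (rule inj_h)
    show "carrier D \<subseteq> E.ev ` carrier E.P"
    proof (rule subset_trans[OF gen h.fspan_subset_submod])
      interpret ev: ring_hom_cring E.P D E.ev by (rule E.ev_hom)
      interpret const: ring_hom_cring R E.P "mp_const R" by (rule E.mp_const_hom)
      show "h.submod (E.ev ` carrier E.P)"
        unfolding h.submod_def
      proof (intro conjI ballI)
        show "E.ev ` carrier E.P \<subseteq> carrier D" by auto
        show "\<zero>\<^bsub>D\<^esub> \<in> E.ev ` carrier E.P" by (rule image_eqI[of _ _ "\<zero>\<^bsub>E.P\<^esub>"]) auto
        fix x assume "x \<in> E.ev ` carrier E.P"
        then obtain p where p: "p \<in> carrier E.P" "x = E.ev p" by auto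
        {
          fix y assume "y \<in> E.ev ` carrier E.P"
          then obtain q where q: "q \<in> carrier E.P" "y = E.ev q" by auto
          show "x \<oplus>\<^bsub>D\<^esub> y \<in> E.ev ` carrier E.P"
            by (rule image_eqI[of _ _ "p \<oplus>\<^bsub>E.P\<^esub> q"]) (use p q in auto)
        }
      next
        fix e x assume e: "e \<in> carrier R" and "x \<in> E.ev ` carrier E.P"
        then obtain p where p: "p \<in> carrier E.P" "x = E.ev p" by auto
        show "h e \<otimes>\<^bsub>D\<^esub> x \<in> E.ev ` carrier E.P"
          by (rule image_eqI[of _ _ "mp_const R e \<otimes>\<^bsub>E.P\<^esub> p"]) (use p e E.ev_const in auto)
      qed
      show "set gs \<subseteq> E.ev ` carrier E.P"
      proof
        fix g assume "g \<in> set gs"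
        then obtain i where i: "i < r" "g = gs ! i" unfolding r_def by (metis in_set_conv_nth)
        have cg: "c g \<in> carrier R" "g \<in> carrier D" using ckb gsi[OF i(1)] i(2) by auto
        have ti: "t i = g \<ominus>\<^bsub>D\<^esub> h (c g)" unfolding t_def i(2) ..
        \<comment> \<open>Shifting loses no generator: g = t i + h (c g) is the value of the i-th
          variable plus a constant.\<close>
        have "E.ev (mp_var R i \<oplus>\<^bsub>E.P\<^esub> mp_const R (c g)) = (g \<ominus>\<^bsub>D\<^esub> h (c g)) \<oplus>\<^bsub>D\<^esub> h (c g)"
          using E.ev_var[OF i(1)] E.ev_const[OF cg(1)] E.mp_var_closed[OF i(1)] cg ti by simp
        also have "\<dots> = g" using cg(2) h.hom_closed[OF cg(1)] by algebra
        finally show "g \<in> E.ev ` carrier E.P"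
          using E.mp_var_closed[OF i(1)] cg(1) by (intro image_eqI[of _ _ "mp_var R i \<oplus>\<^bsub>E.P\<^esub> mp_const R (c g)"]) auto
      qed
    qed
  qed
  have "direct_summand_via R (T_ring R r n a Quot M.J) (T_quot_map R r n a M.J)"
  proof (rule hyp)
    show "r \<ge> 1" unfolding r_def gs_def by simp
    show "\<forall>i<r. n i \<ge> 1" using ckb gsi unfolding n_def by simp
    show "\<forall>i<r. \<forall>j\<in>{1..n i}. a i j \<in> max_ideal R" using am by simp
  qed (rule M.J_ideal M.ideal_height_J M.inj_T_quot_map)+
  then have "direct_summand_via R D h" by (rule M.direct_summand_of_quotient)
  then obtain \<rho> where \<rho>: "\<forall>s\<in>carrier D. \<rho> s \<in> carrier R"
    "\<forall>s\<in>carrier D. \<forall>t\<in>carrier D. \<rho> (s \<oplus>\<^bsub>D\<^esub> t) = \<rho> s \<oplus>\<^bsub>R\<^esub> \<rho> t"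
    "\<forall>x\<in>carrier R. \<forall>s\<in>carrier D. \<rho> (h x \<otimes>\<^bsub>D\<^esub> s) = x \<otimes>\<^bsub>R\<^esub> \<rho> s"
    "\<rho> \<one>\<^bsub>D\<^esub> = \<one>\<^bsub>R\<^esub>"
    unfolding direct_summand_via_def by (elim exE conjE)
  \<comment> \<open>The projection to the quotient carries \<iota> to h and 1 to 1, so composing it
    with the retraction of D retracts S.\<close>
  show ?thesis
    unfolding direct_summand_via_def
    by (rule exI[of _ "\<lambda>s. \<rho> (\<pi> s)"]) (use \<rho> in \<open>auto simp: h_def\<close>)
qed

end
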